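(* Let $T$ be a set. For any regular calculus $P\colon\mathbb{F}\mathrm{Rg}(T)\to\mathbb{P}\mathrm{oset}$, the category $\mathcal{R}_P=\mathrm{LAdj}(\mathbb{I}\mathrm{ntRel}_P)$ of internal functions in $\mathbb{I}\mathrm{ntRel}_P$ is regular.
   Context: Composition is written in diagrammatic order: $f;g$ means first $f$, then $g$; an object's name also denotes its identity morphism. A po-category is a category enriched in posets; po-functors are poset-enriched functors. $\mathbb{P}\mathrm{oset}$ is the po-category of posets and monotone maps (pointwise order), symmetric monoidal under cartesian product. $L\colon c\to d$ is left adjoint to $R\colon d\to c$ if $\mathrm{id}_c\le L;R$ and $R;L\le\mathrm{id}_d$. $\mathrm{LAdj}(\mathbb{C})$ is the category with the objects of the po-category $\mathbb{C}$ and its left adjoints as morphisms. A po-functor $F$ between symmetric monoidal po-categories is ajax if it is lax symmetric monoidal (laxator naturality squares commute strictly) and its laxators $\rho\colon I\to F(I)$, $\rho_{c,c'}\colon F(c)\otimes F(c')\to F(c\otimes c')$ are right adjoints. For a regular category $\mathcal{R}$, $\mathbb{R}\mathrm{el}_{\mathcal{R}}$ is the po-category with the same objects, morphisms $r\to s$ the subobjects of $r\times s$ ordered by inclusion, composed by pullback and image factorization, symmetric monoidal under $\times$. For a set $T$, $\mathsf{FRg}(T)$ is the regular category whose objects (contexts) are triples $\Gamma=(n,S,\tau)$ with $n\in\mathbb{N}$, $S\subseteq T$ finite, $\tau\colon\{1,\dots,n\}\to S$; a morphism $(n,S,\tau)\to(n',S',\tau')$ exists only if $S'\subseteq S$ and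 is a function $f\colon\{1,\dots,n'\}\to\{1,\dots,n\}$ with $\tau\circ f=\tau'$. Its terminal object is $0=(0,\varnothing,!)$ and its product is $\Gamma\oplus\Gamma'=(n+n',S\cup S',[\tau,\tau'])$. Put $\mathbb{F}\mathrm{Rg}(T)=\mathbb{R}\mathrm{el}_{\mathsf{FRg}(T)}$. A regular calculus is a pair $(T,P)$ with $P\colon\mathbb{F}\mathrm{Rg}(T)\to\mathbb{P}\mathrm{oset}$ an ajax po-functor. For $f\colon\Gamma\to\Gamma'$ in $\mathsf{FRg}(T)$, $f_!\colon P(\Gamma)\to P(\Gamma')$ is $P$ applied to the graph $\langle\mathrm{id},f\rangle$, and $f^*\colon P(\Gamma')\to P(\Gamma)$ is $P$ applied to the co-graph $\langle f,\mathrm{id}\rangle$. $\delta_\Gamma,\epsilon_\Gamma,\pi_i$ denote the diagonal $\Gamma\to\Gamma\oplus\Gamma$, the map $\Gamma\to0$ and the projections $\Gamma_1\oplus\Gamma_2\to\Gamma_i$; $\vdash$ is the order of $P(\Gamma)$. The po-category $\mathbb{I}\mathrm{ntRel}_P$ of internal relations has objects the pairs $(\Gamma,\varphi)$ with $\varphi\in P(\Gamma)$, hom-posets $$\mathbb{I}\mathrm{ntRel}_P(\varphi_1,\varphi_2)=\{\theta\in P(\Gamma_1\oplus\Gamma_2)\mid(\pi_1)_!\theta\vdash\varphi_1,\ (\pi_2)_!\theta\vdash\varphi_2\},$$ composition $\theta;\theta'=(\Gamma_1\oplus\epsilon_{\Gamma_2}\oplus\Gamma_3)_!\,(\Gamma_1\oplus\delta_{\Gamma_2}\oplus\Gamma_3)^*\,\rho(\theta,\theta')$,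 and identities $\mathrm{id}_\varphi=(\delta_\Gamma)_!(\varphi)$. *)

theory Defs
  imports "HOL-Library.FuncSet"
begin

section \<open>Categories, finite limits, regular categories\<close>

text \<open>Hom-sets of different pairs of objects need not be disjoint; hence composition takes the three
  objects involved as arguments. \<open>cmp C x y z f g\<close> is the diagrammatic composite \<open>f;g\<close> of
  \<open>f : x \<rightarrow> y\<close> and \<open>g : y \<rightarrow> z\<close>. Values outside the hom-sets are irrelevant.\<close>

record ('o, 'm) cat =
  obj :: "'o set"
  hom :: "'o \<Rightarrow> 'o \<Rightarrow> 'm set"
  cmp :: "'o \<Rightarrow> 'o \<Rightarrow> 'o \<Rightarrow> 'm \<Rightarrow> 'm \<Rightarrow> 'm"
  idn :: "'o \<Rightarrow> 'm"

locale category =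
  fixes C :: "('o, 'm, 'z) cat_scheme"
  assumes idn_in_hom: "x \<in> obj C \<Longrightarrow> idn C x \<in> hom C x x"
    and cmp_in_hom: "\<lbrakk>x \<in> obj C; y \<in> obj C; z \<in> obj C; f \<in> hom C x y; g \<in> hom C y z\<rbrakk>
      \<Longrightarrow> cmp C x y z f g \<in> hom C x z"
    and cmp_idn_left: "\<lbrakk>x \<in> obj C; y \<in> obj C; f \<in> hom C x y\<rbrakk> \<Longrightarrow> cmp C x x y (idn C x) f = f"
    and cmp_idn_right: "\<lbrakk>x \<in> obj C; y \<in> obj C; f \<in> hom C x y\<rbrakk> \<Longrightarrow> cmp C x y y f (idn C y) = f"
    and cmp_assoc: "\<lbrakk>w \<in> obj C; x \<in> obj C; y \<in> obj C; z \<in> obj C;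
        f \<in> hom C w x; g \<in> hom C x y; h \<in> hom C y z\<rbrakk>
      \<Longrightarrow> cmp C w y z (cmp C w x y f g) h = cmp C w x z f (cmp C x y z g h)"

definition is_functor ::
  "('o, 'm, 'z) cat_scheme \<Rightarrow> ('o2, 'm2, 'z2) cat_scheme \<Rightarrow> ('o \<Rightarrow> 'o2) \<Rightarrow> ('o \<Rightarrow> 'o \<Rightarrow> 'm \<Rightarrow> 'm2) \<Rightarrow> bool"
  where "is_functor C D FO FM \<longleftrightarrow>
    (\<forall>x\<in>obj C. FO x \<in> obj D) \<and>
    (\<forall>x\<in>obj C. \<forall>y\<in>obj C. \<forall>f\<in>hom C x y. FM x y f \<in> hom D (FO x) (FO y)) \<and>
    (\<forall>x\<in>obj C. FM x x (idn C x) = idn D (FO x)) \<and>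
    (\<forall>x\<in>obj C. \<forall>y\<in>obj C. \<forall>z\<in>obj C. \<forall>f\<in>hom C x y. \<forall>g\<in>hom C y z.
      FM x z (cmp C x y z f g) = cmp D (FO x) (FO y) (FO z) (FM x y f) (FM y z g))"

definition cone ::
  "('j, 'k, 'y) cat_scheme \<Rightarrow> ('o, 'm, 'z) cat_scheme \<Rightarrow> ('j \<Rightarrow> 'o) \<Rightarrow> ('j \<Rightarrow> 'j \<Rightarrow> 'k \<Rightarrow> 'm)
    \<Rightarrow> 'o \<Rightarrow> ('j \<Rightarrow> 'm) \<Rightarrow> bool"
  where "cone J C DO DM v leg \<longleftrightarrow>
    v \<in> obj C \<and> (\<forall>i\<in>obj J. leg i \<in> hom C v (DO i)) \<and>
    (\<forall>i\<in>obj J. \<forall>j\<in>obj J. \<forall>f\<in>hom J i j. cmp C v (DO i) (DO j) (leg i) (DM i j f) = leg j)"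

definition limit_cone ::
  "('j, 'k, 'y) cat_scheme \<Rightarrow> ('o, 'm, 'z) cat_scheme \<Rightarrow> ('j \<Rightarrow> 'o) \<Rightarrow> ('j \<Rightarrow> 'j \<Rightarrow> 'k \<Rightarrow> 'm)
    \<Rightarrow> 'o \<Rightarrow> ('j \<Rightarrow> 'm) \<Rightarrow> bool"
  where "limit_cone J C DO DM v leg \<longleftrightarrow>
    cone J C DO DM v leg \<and>
    (\<forall>w leg'. cone J C DO DM w leg' \<longrightarrow>
      (\<exists>!h. h \<in> hom C w v \<and> (\<forall>i\<in>obj J. cmp C w v (DO i) h (leg i) = leg' i)))"

text \<open>Every finite category is isomorphic to one whose objects and morphisms are natural numbers,
  so it suffices to let the index category range over those.\<close>

definition has_finite_limits :: "('o, 'm, 'z) cat_scheme \<Rightarrow> bool"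
  where "has_finite_limits C \<longleftrightarrow>
    (\<forall>(J :: (nat, nat) cat) DO DM.
      category J \<and> finite (obj J) \<and> (\<forall>i\<in>obj J. \<forall>j\<in>obj J. finite (hom J i j)) \<and> is_functor J C DO DM
      \<longrightarrow> (\<exists>v leg. limit_cone J C DO DM v leg))"

text \<open>\<open>pullback C x y z f g p p1 p2\<close>: the span \<open>x \<leftarrow> p \<rightarrow> y\<close> given by \<open>p1\<close>, \<open>p2\<close> is a pullback of
  the cospan \<open>f : x \<rightarrow> z\<close>, \<open>g : y \<rightarrow> z\<close>.\<close>

definition pullback ::
  "('o, 'm, 'z) cat_scheme \<Rightarrow> 'o \<Rightarrow> 'o \<Rightarrow> 'o \<Rightarrow> 'm \<Rightarrow> 'm \<Rightarrow> 'o \<Rightarrow> 'm \<Rightarrow> 'm \<Rightarrow> bool"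
  where "pullback C x y z f g p p1 p2 \<longleftrightarrow>
    x \<in> obj C \<and> y \<in> obj C \<and> z \<in> obj C \<and> p \<in> obj C \<and>
    f \<in> hom C x z \<and> g \<in> hom C y z \<and> p1 \<in> hom C p x \<and> p2 \<in> hom C p y \<and>
    cmp C p x z p1 f = cmp C p y z p2 g \<and>
    (\<forall>w\<in>obj C. \<forall>a\<in>hom C w x. \<forall>b\<in>hom C w y. cmp C w x z a f = cmp C w y z b g \<longrightarrow>
      (\<exists>!h. h \<in> hom C w p \<and> cmp C w p x h p1 = a \<and> cmp C w p y h p2 = b))"

definition coequalizer ::
  "('o, 'm, 'z) cat_scheme \<Rightarrow> 'o \<Rightarrow> 'o \<Rightarrow> 'm \<Rightarrow> 'm \<Rightarrow> 'o \<Rightarrow> 'm \<Rightarrow> bool"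
  where "coequalizer C x y u v q e \<longleftrightarrow>
    x \<in> obj C \<and> y \<in> obj C \<and> q \<in> obj C \<and> u \<in> hom C x y \<and> v \<in> hom C x y \<and> e \<in> hom C y q \<and>
    cmp C x y q u e = cmp C x y q v e \<and>
    (\<forall>w\<in>obj C. \<forall>g\<in>hom C y w. cmp C x y w u g = cmp C x y w v g \<longrightarrow>
      (\<exists>!h. h \<in> hom C q w \<and> cmp C y q w e h = g))"

definition regular_epi :: "('o, 'm, 'z) cat_scheme \<Rightarrow> 'o \<Rightarrow> 'o \<Rightarrow> 'm \<Rightarrow> bool"
  where "regular_epi C y q e \<longleftrightarrow> (\<exists>x u v. coequalizer C x y u v q e)"

locale regular_category = category C
  for C :: "('o, 'm, 'z) cat_scheme" +
  assumes finite_limits: "has_finite_limits C"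
    and kernel_pair_coequalizer:
      "pullback C x x y f f k k1 k2 \<Longrightarrow> \<exists>q e. coequalizer C k x k1 k2 q e"
    and regular_epi_stable:
      "\<lbrakk>pullback C x y z f g p p1 p2; regular_epi C x z f\<rbrakk> \<Longrightarrow> regular_epi C p y p2"


section \<open>Po-categories\<close>

record ('o, 'm) pocat = "('o, 'm) cat" +
  leq :: "'o \<Rightarrow> 'o \<Rightarrow> 'm \<Rightarrow> 'm \<Rightarrow> bool"

definition po_functor ::
  "('o, 'm, 'z) pocat_scheme \<Rightarrow> ('o2, 'm2, 'z2) pocat_scheme \<Rightarrow> ('o \<Rightarrow> 'o2) \<Rightarrow> ('o \<Rightarrow> 'o \<Rightarrow> 'm \<Rightarrow> 'm2) \<Rightarrow> bool"
  where "po_functor C D FO FM \<longleftrightarrow>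
    is_functor C D FO FM \<and>
    (\<forall>x\<in>obj C. \<forall>y\<in>obj C. \<forall>f\<in>hom C x y. \<forall>g\<in>hom C x y.
      leq C x y f g \<longrightarrow> leq D (FO x) (FO y) (FM x y f) (FM x y g))"

definition adjoint_pair :: "('o, 'm, 'z) pocat_scheme \<Rightarrow> 'o \<Rightarrow> 'o \<Rightarrow> 'm \<Rightarrow> 'm \<Rightarrow> bool"
  where "adjoint_pair C c d L R \<longleftrightarrow>
    L \<in> hom C c d \<and> R \<in> hom C d c \<and>
    leq C c c (idn C c) (cmp C c d c L R) \<and> leq C d d (cmp C d c d R L) (idn C d)"

definition LAdj :: "('o, 'm, 'z) pocat_scheme \<Rightarrow> ('o, 'm) cat"
  where "LAdj C = \<lparr>obj = obj C, hom = (\<lambda>c d. {L. \<exists>R. adjoint_pair C c d L R}), cmp = cmp C, idn = idn C\<rparr>"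

text \<open>A poset is represented by its order relation \<open>r\<close>; its carrier is \<open>Field r\<close>. Morphisms are
  extensional functions so that equality of morphisms is equality of maps on the carrier.\<close>

definition monotone_map :: "'a rel \<Rightarrow> 'b rel \<Rightarrow> ('a \<Rightarrow> 'b) \<Rightarrow> bool"
  where "monotone_map r s f \<longleftrightarrow> f \<in> Field r \<rightarrow> Field s \<and> (\<forall>x y. (x, y) \<in> r \<longrightarrow> (f x, f y) \<in> s)"

definition Poset :: "('p rel, 'p \<Rightarrow> 'p) pocat"
  where "Poset = \<lparr>
    obj = {r. Partial_order r},
    hom = (\<lambda>r s. {f \<in> extensional (Field r). monotone_map r s f}),
    cmp = (\<lambda>r s t f g. compose (Field r) g f),
    idn = (\<lambda>r. restrict id (Field r)),
    leq = (\<lambda>r s f g. \<forall>x\<in>Field r. (f x, g x) \<in> s)\<rparr>"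

definition product_order :: "'a rel \<Rightarrow> 'b rel \<Rightarrow> ('a \<times> 'b) rel"
  where "product_order r s = {((a, b), (a', b')). (a, a') \<in> r \<and> (b, b') \<in> s}"

definition unit_order :: "unit rel"
  where "unit_order = {((), ())}"

text \<open>\<open>Poset\<close> only relates posets over one element type, whereas a laxator \<open>P c \<times> P c' \<rightarrow> P (c \<otimes> c')\<close>
  has its domain over a product type; so right adjoints of monotone maps are spelled out for
  posets over different types.\<close>

definition is_right_adjoint_map :: "'a rel \<Rightarrow> 'b rel \<Rightarrow> ('a \<Rightarrow> 'b) \<Rightarrow> bool"
  where "is_right_adjoint_map d c R \<longleftrightarrow>
    monotone_map d c R \<and>
    (\<exists>L. monotone_map c d L \<and> (\<forall>x\<in>Field c. (x, R (L x)) \<in> c) \<and> (\<forall>y\<in>Field d. (L (R y), y) \<in> d))"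


section \<open>Symmetric monoidal po-categories and ajax po-functors to posets\<close>

text \<open>\<open>tensm C c d c' d' f f'\<close> is \<open>f \<otimes> f'\<close> for \<open>f : c \<rightarrow> d\<close> and \<open>f' : c' \<rightarrow> d'\<close>;
  \<open>massoc C c c' c'' : (c \<otimes> c') \<otimes> c'' \<rightarrow> c \<otimes> (c' \<otimes> c'')\<close>, \<open>mlunit C c : I \<otimes> c \<rightarrow> c\<close>,
  \<open>mrunit C c : c \<otimes> I \<rightarrow> c\<close>, \<open>mbraid C c c' : c \<otimes> c' \<rightarrow> c' \<otimes> c\<close>.\<close>

record ('o, 'm) smpocat = "('o, 'm) pocat" +
  munit :: "'o"
  tens :: "'o \<Rightarrow> 'o \<Rightarrow> 'o"
  tensm :: "'o \<Rightarrow> 'o \<Rightarrow> 'o \<Rightarrow> 'o \<Rightarrow> 'm \<Rightarrow> 'm \<Rightarrow> 'm"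
  massoc :: "'o \<Rightarrow> 'o \<Rightarrow> 'o \<Rightarrow> 'm"
  mlunit :: "'o \<Rightarrow> 'm"
  mrunit :: "'o \<Rightarrow> 'm"
  mbraid :: "'o \<Rightarrow> 'o \<Rightarrow> 'm"

record ('o, 'm, 'p) lax_data =
  ob :: "'o \<Rightarrow> 'p rel"
  mor :: "'o \<Rightarrow> 'o \<Rightarrow> 'm \<Rightarrow> 'p \<Rightarrow> 'p"
  lax0 :: "unit \<Rightarrow> 'p"
  lax :: "'o \<Rightarrow> 'o \<Rightarrow> 'p \<times> 'p \<Rightarrow> 'p"

text \<open>Lax symmetric monoidal po-functors to \<open>Poset\<close> (with cartesian product), all diagrams being
  evaluated at elements.\<close>

locale lax_monoidal_po_functor =
  fixes C :: "('o, 'm, 'z) smpocat_scheme" and P :: "('o, 'm, 'p, 'y) lax_data_scheme"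
  assumes po_functor: "po_functor C Poset (ob P) (mor P)"
    and lax0_monotone: "monotone_map unit_order (ob P (munit C)) (lax0 P)"
    and lax_monotone: "\<lbrakk>c \<in> obj C; c' \<in> obj C\<rbrakk>
      \<Longrightarrow> monotone_map (product_order (ob P c) (ob P c')) (ob P (tens C c c')) (lax P c c')"
    and lax_natural: "\<lbrakk>c \<in> obj C; c' \<in> obj C; d \<in> obj C; d' \<in> obj C; f \<in> hom C c d; f' \<in> hom C c' d';
        x \<in> Field (ob P c); x' \<in> Field (ob P c')\<rbrakk>
      \<Longrightarrow> mor P (tens C c c') (tens C d d') (tensm C c d c' d' f f') (lax P c c' (x, x'))
        = lax P d d' (mor P c d f x, mor P c' d' f' x')"
    and lax_assoc: "\<lbrakk>c \<in> obj C; c' \<in> obj C; c'' \<in> obj C;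
        x \<in> Field (ob P c); x' \<in> Field (ob P c'); x'' \<in> Field (ob P c'')\<rbrakk>
      \<Longrightarrow> mor P (tens C (tens C c c') c'') (tens C c (tens C c' c'')) (massoc C c c' c'')
            (lax P (tens C c c') c'' (lax P c c' (x, x'), x''))
        = lax P c (tens C c' c'') (x, lax P c' c'' (x', x''))"
    and lax_lunit: "\<lbrakk>c \<in> obj C; x \<in> Field (ob P c)\<rbrakk>
      \<Longrightarrow> mor P (tens C (munit C) c) c (mlunit C c) (lax P (munit C) c (lax0 P (), x)) = x"
    and lax_runit: "\<lbrakk>c \<in> obj C; x \<in> Field (ob P c)\<rbrakk>
      \<Longrightarrow> mor P (tens C c (munit C)) c (mrunit C c) (lax P c (munit C) (x, lax0 P ())) = x"
    and lax_braid: "\<lbrakk>c \<in> obj C; c' \<in> obj C; x \<in> Field (ob P c); x' \<in> Field (ob P c')\<rbrakk>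
      \<Longrightarrow> mor P (tens C c c') (tens C c' c) (mbraid C c c') (lax P c c' (x, x'))
        = lax P c' c (x', x)"

locale ajax_po_functor = lax_monoidal_po_functor C P
  for C :: "('o, 'm, 'z) smpocat_scheme" and P :: "('o, 'm, 'p, 'y) lax_data_scheme" +
  assumes lax0_right_adjoint: "is_right_adjoint_map unit_order (ob P (munit C)) (lax0 P)"
    and lax_right_adjoint: "\<lbrakk>c \<in> obj C; c' \<in> obj C\<rbrakk>
      \<Longrightarrow> is_right_adjoint_map (product_order (ob P c) (ob P c')) (ob P (tens C c c')) (lax P c c')"


section \<open>Chosen finite products and the po-category of relations\<close>

record ('o, 'm) fpcat = "('o, 'm) cat" +
  one :: "'o"
  prd :: "'o \<Rightarrow> 'o \<Rightarrow> 'o"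
  pr1 :: "'o \<Rightarrow> 'o \<Rightarrow> 'm"
  pr2 :: "'o \<Rightarrow> 'o \<Rightarrow> 'm"

definition bang :: "('o, 'm, 'z) fpcat_scheme \<Rightarrow> 'o \<Rightarrow> 'm"
  where "bang C x = (THE h. h \<in> hom C x (one C))"

definition tuple :: "('o, 'm, 'z) fpcat_scheme \<Rightarrow> 'o \<Rightarrow> 'o \<Rightarrow> 'o \<Rightarrow> 'm \<Rightarrow> 'm \<Rightarrow> 'm"
  where "tuple C z x y f g = (THE h. h \<in> hom C z (prd C x y) \<and>
    cmp C z (prd C x y) x h (pr1 C x y) = f \<and> cmp C z (prd C x y) y h (pr2 C x y) = g)"

definition diag :: "('o, 'm, 'z) fpcat_scheme \<Rightarrow> 'o \<Rightarrow> 'm"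
  where "diag C x = tuple C x x x (idn C x) (idn C x)"

text \<open>\<open>times C x y x' y' f g : x \<times> x' \<rightarrow> y \<times> y'\<close> for \<open>f : x \<rightarrow> y\<close> and \<open>g : x' \<rightarrow> y'\<close>.\<close>

definition times :: "('o, 'm, 'z) fpcat_scheme \<Rightarrow> 'o \<Rightarrow> 'o \<Rightarrow> 'o \<Rightarrow> 'o \<Rightarrow> 'm \<Rightarrow> 'm \<Rightarrow> 'm"
  where "times C x y x' y' f g = tuple C (prd C x x') y y'
    (cmp C (prd C x x') x y (pr1 C x x') f) (cmp C (prd C x x') x' y' (pr2 C x x') g)"

definition prod_assoc :: "('o, 'm, 'z) fpcat_scheme \<Rightarrow> 'o \<Rightarrow> 'o \<Rightarrow> 'o \<Rightarrow> 'm"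
  where "prod_assoc C x y z =
    (let xy = prd C x y; p = prd C xy z in
      tuple C p x (prd C y z)
        (cmp C p xy x (pr1 C xy z) (pr1 C x y))
        (tuple C p y z (cmp C p xy y (pr1 C xy z) (pr2 C x y)) (pr2 C xy z)))"

definition prod_swap :: "('o, 'm, 'z) fpcat_scheme \<Rightarrow> 'o \<Rightarrow> 'o \<Rightarrow> 'm"
  where "prod_swap C x y = tuple C (prd C x y) y x (pr2 C x y) (pr1 C x y)"

definition monic :: "('o, 'm, 'z) cat_scheme \<Rightarrow> 'o \<Rightarrow> 'o \<Rightarrow> 'm \<Rightarrow> bool"
  where "monic C x y m \<longleftrightarrow> x \<in> obj C \<and> y \<in> obj C \<and> m \<in> hom C x y \<and>
    (\<forall>w\<in>obj C. \<forall>a\<in>hom C w x. \<forall>b\<in>hom C w x. cmp C w x y a m = cmp C w x y b m \<longrightarrow> a = b)"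

definition monics :: "('o, 'm, 'z) cat_scheme \<Rightarrow> 'o \<Rightarrow> ('o \<times> 'm) set"
  where "monics C y = {(x, m). monic C x y m}"

definition factors :: "('o, 'm, 'z) cat_scheme \<Rightarrow> 'o \<Rightarrow> 'o \<times> 'm \<Rightarrow> 'o \<times> 'm \<Rightarrow> bool"
  where "factors C y = (\<lambda>(x, m) (x', m'). \<exists>k\<in>hom C x x'. cmp C x x' y k m' = m)"

definition same_subobject :: "('o, 'm, 'z) cat_scheme \<Rightarrow> 'o \<Rightarrow> ('o \<times> 'm) rel"
  where "same_subobject C y =
    {(a, b). a \<in> monics C y \<and> b \<in> monics C y \<and> factors C y a b \<and> factors C y b a}"

definition subobjects :: "('o, 'm, 'z) cat_scheme \<Rightarrow> 'o \<Rightarrow> ('o \<times> 'm) set set"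
  where "subobjects C y = monics C y // same_subobject C y"

definition subobject_of :: "('o, 'm, 'z) cat_scheme \<Rightarrow> 'o \<Rightarrow> 'o \<Rightarrow> 'm \<Rightarrow> ('o \<times> 'm) set"
  where "subobject_of C x y m = same_subobject C y `` {(x, m)}"

definition subobject_le :: "('o, 'm, 'z) cat_scheme \<Rightarrow> 'o \<Rightarrow> ('o \<times> 'm) set \<Rightarrow> ('o \<times> 'm) set \<Rightarrow> bool"
  where "subobject_le C y A B \<longleftrightarrow> (\<exists>a\<in>A. \<exists>b\<in>B. factors C y a b)"

text \<open>\<open>graph C x y f : x \<rightarrow> y\<close> and \<open>cograph C x y f : y \<rightarrow> x\<close> are the relations
  \<open>\<langle>id, f\<rangle> : x \<rightarrow> x \<times> y\<close> and \<open>\<langle>f, id\<rangle> : x \<rightarrow> y \<times> x\<close> of a morphism \<open>f : x \<rightarrow> y\<close>.\<close>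

definition graph :: "('o, 'm, 'z) fpcat_scheme \<Rightarrow> 'o \<Rightarrow> 'o \<Rightarrow> 'm \<Rightarrow> ('o \<times> 'm) set"
  where "graph C x y f = subobject_of C x (prd C x y) (tuple C x x y (idn C x) f)"

definition cograph :: "('o, 'm, 'z) fpcat_scheme \<Rightarrow> 'o \<Rightarrow> 'o \<Rightarrow> 'm \<Rightarrow> ('o \<times> 'm) set"
  where "cograph C x y f = subobject_of C x (prd C y x) (tuple C x y x f (idn C x))"

text \<open>The composite of \<open>A \<subseteq> r \<times> s\<close> and \<open>B \<subseteq> s \<times> t\<close> consists of all monos \<open>m : z \<rightarrow> r \<times> t\<close>
  occurring in a factorization, regular epi \<open>e\<close> followed by \<open>m\<close>, of the map
  \<open>p = a \<times>\<^sub>s b \<rightarrow> r \<times> t\<close> for representatives \<open>a\<close> of \<open>A\<close> and \<open>b\<close> of \<open>B\<close>. As image factorizations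
  are unique up to isomorphism, this set is a single equivalence class.\<close>

definition rel_comp ::
  "('o, 'm, 'z) fpcat_scheme \<Rightarrow> 'o \<Rightarrow> 'o \<Rightarrow> 'o \<Rightarrow> ('o \<times> 'm) set \<Rightarrow> ('o \<times> 'm) set \<Rightarrow> ('o \<times> 'm) set"
  where "rel_comp C r s t A B =
    {(z, m). monic C z (prd C r t) m \<and>
      (\<exists>(x, a)\<in>A. \<exists>(y, b)\<in>B. \<exists>p p1 p2 e.
        pullback C x y s (cmp C x (prd C r s) s a (pr2 C r s)) (cmp C y (prd C s t) s b (pr1 C s t)) p p1 p2 \<and>
        regular_epi C p z e \<and>
        cmp C p z (prd C r t) e m =
          tuple C p r t
            (cmp C p x r p1 (cmp C x (prd C r s) r a (pr1 C r s)))
            (cmp C p y t p2 (cmp C y (prd C s t) t b (pr2 C s t))))}"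

text \<open>The tensor of \<open>A \<subseteq> r \<times> s\<close> and \<open>B \<subseteq> r' \<times> s'\<close> is their product, regarded as a subobject of
  \<open>(r \<times> r') \<times> (s \<times> s')\<close> by exchanging the middle factors.\<close>

definition rel_tensor ::
  "('o, 'm, 'z) fpcat_scheme \<Rightarrow> 'o \<Rightarrow> 'o \<Rightarrow> 'o \<Rightarrow> 'o \<Rightarrow> ('o \<times> 'm) set \<Rightarrow> ('o \<times> 'm) set \<Rightarrow> ('o \<times> 'm) set"
  where "rel_tensor C r s r' s' A B =
    (\<Union>(x, a)\<in>A. \<Union>(y, b)\<in>B.
      subobject_of C (prd C x y) (prd C (prd C r r') (prd C s s'))
        (tuple C (prd C x y) (prd C r r') (prd C s s')
          (times C x r y r' (cmp C x (prd C r s) r a (pr1 C r s)) (cmp C y (prd C r' s') r' b (pr1 C r' s')))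
          (times C x s y s' (cmp C x (prd C r s) s a (pr2 C r s)) (cmp C y (prd C r' s') s' b (pr2 C r' s')))))"

definition Rel :: "('o, 'm, 'z) fpcat_scheme \<Rightarrow> ('o, ('o \<times> 'm) set) smpocat"
  where "Rel C = \<lparr>
    obj = obj C,
    hom = (\<lambda>r s. subobjects C (prd C r s)),
    cmp = rel_comp C,
    idn = (\<lambda>r. graph C r r (idn C r)),
    leq = (\<lambda>r s. subobject_le C (prd C r s)),
    munit = one C,
    tens = prd C,
    tensm = rel_tensor C,
    massoc = (\<lambda>x y z. graph C (prd C (prd C x y) z) (prd C x (prd C y z)) (prod_assoc C x y z)),
    mlunit = (\<lambda>x. graph C (prd C (one C) x) x (pr2 C (one C) x)),
    mrunit = (\<lambda>x. graph C (prd C x (one C)) x (pr1 C x (one C))),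
    mbraid = (\<lambda>x y. graph C (prd C x y) (prd C y x) (prod_swap C x y))\<rparr>"


section \<open>Regular calculi and internal relations\<close>

text \<open>A context \<open>(n, S, \<tau>)\<close> is represented by \<open>(ts, S)\<close> where \<open>ts = [\<tau> 1, \<dots>, \<tau> n]\<close>; positions are
  counted from \<open>0\<close>.\<close>

type_synonym 't ctx = "'t list \<times> 't set"

definition FRg :: "'t set \<Rightarrow> ('t ctx, nat \<Rightarrow> nat) fpcat"
  where "FRg T = \<lparr>
    obj = {(ts, S). finite S \<and> S \<subseteq> T \<and> set ts \<subseteq> S},
    hom = (\<lambda>(ts, S) (ts', S').
      {f. S' \<subseteq> S \<and> f \<in> {..<length ts'} \<rightarrow>\<^sub>E {..<length ts} \<and> (\<forall>i<length ts'. ts ! f i = ts' ! i)}),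
    cmp = (\<lambda>_ _ (ts'', _) f g. compose {..<length ts''} f g),
    idn = (\<lambda>(ts, _). restrict id {..<length ts}),
    one = ([], {}),
    prd = (\<lambda>(ts, S) (ts', S'). (ts @ ts', S \<union> S')),
    pr1 = (\<lambda>(ts, _) _. \<lambda>i\<in>{..<length ts}. i),
    pr2 = (\<lambda>(ts, _) (ts', _). \<lambda>i\<in>{..<length ts'}. length ts + i)\<rparr>"

type_synonym ('t, 'p) calculus = "('t ctx, ('t ctx \<times> (nat \<Rightarrow> nat)) set, 'p) lax_data"

definition regular_calculus :: "'t set \<Rightarrow> ('t, 'p) calculus \<Rightarrow> bool"
  where "regular_calculus T P \<longleftrightarrow> ajax_po_functor (Rel (FRg T)) P"

definition push :: "'t set \<Rightarrow> ('t, 'p) calculus \<Rightarrow> 't ctx \<Rightarrow> 't ctx \<Rightarrow> (nat \<Rightarrow> nat) \<Rightarrow> 'p \<Rightarrow> 'p"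
  where "push T P G G' f = mor P G G' (graph (FRg T) G G' f)"

definition pull :: "'t set \<Rightarrow> ('t, 'p) calculus \<Rightarrow> 't ctx \<Rightarrow> 't ctx \<Rightarrow> (nat \<Rightarrow> nat) \<Rightarrow> 'p \<Rightarrow> 'p"
  where "pull T P G G' f = mor P G' G (cograph (FRg T) G G' f)"

text \<open>The product of contexts is strictly associative and unital. Hence
  \<open>(G1 \<oplus> G2) \<oplus> (G2 \<oplus> G3) = (G1 \<oplus> (G2 \<oplus> G2)) \<oplus> G3\<close> and \<open>(G1 \<oplus> 0) \<oplus> G3 = G1 \<oplus> G3\<close>, and no
  coherence isomorphisms occur in the next definition.\<close>

definition intrel_comp ::
  "'t set \<Rightarrow> ('t, 'p) calculus \<Rightarrow> 't ctx \<Rightarrow> 't ctx \<Rightarrow> 't ctx \<Rightarrow> 'p \<Rightarrow> 'p \<Rightarrow> 'p"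
  where "intrel_comp T P G1 G2 G3 \<theta> \<theta>' =
    (let F = FRg T;
         G12 = prd F G1 G2; G22 = prd F G2 G2; G122 = prd F G1 G22; G10 = prd F G1 (one F);
         dup = times F G12 G122 G3 G3 (times F G1 G1 G2 G22 (idn F G1) (diag F G2)) (idn F G3);
         del = times F G12 G10 G3 G3 (times F G1 G1 G2 (one F) (idn F G1) (bang F G2)) (idn F G3)
     in push T P (prd F G12 G3) (prd F G10 G3) del
          (pull T P (prd F G12 G3) (prd F G122 G3) dup
            (lax P G12 (prd F G2 G3) (\<theta>, \<theta>'))))"

definition IntRel :: "'t set \<Rightarrow> ('t, 'p) calculus \<Rightarrow> ('t ctx \<times> 'p, 'p) pocat"
  where "IntRel T P = (let F = FRg T in \<lparr>
    obj = {(G, \<phi>). G \<in> obj F \<and> \<phi> \<in> Field (ob P G)},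
    hom = (\<lambda>(G1, \<phi>1) (G2, \<phi>2). {\<theta> \<in> Field (ob P (prd F G1 G2)).
      (push T P (prd F G1 G2) G1 (pr1 F G1 G2) \<theta>, \<phi>1) \<in> ob P G1 \<and>
      (push T P (prd F G1 G2) G2 (pr2 F G1 G2) \<theta>, \<phi>2) \<in> ob P G2}),
    cmp = (\<lambda>(G1, _) (G2, _) (G3, _). intrel_comp T P G1 G2 G3),
    idn = (\<lambda>(G, \<phi>). push T P G (prd F G G) (diag F G) \<phi>),
    leq = (\<lambda>(G1, _) (G2, _) \<theta> \<theta>'. (\<theta>, \<theta>') \<in> ob P (prd F G1 G2))\<rparr>)"

end

theory Submission
  imports Defs
begin

text \<open>Right adjointness of the laxators forces \<open>\<rho>(\<phi>, \<psi>) = \<pi>\<^sub>1\<^sup>* \<phi> \<and> \<pi>\<^sub>2\<^sup>* \<psi>\<close>, so a regular calculus is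
  a hyperdoctrine for regular logic: \<open>f\<^sub>! \<stileturn> f\<^sup>*\<close> with Beck--Chevalley and Frobenius. It therefore has a
  Kripke--Joyal semantics, in which an existential statement holds at a stage \<open>(\<Gamma>, \<chi>)\<close> iff it has a
  witness on some cover \<open>c : (\<Gamma>', \<chi>') \<rightarrow> (\<Gamma>, \<chi>)\<close>, that is, \<open>\<chi>' \<turnstile> c\<^sup>* \<chi>\<close> and \<open>\<chi> \<turnstile> c\<^sub>! \<chi>'\<close>. Arguing
  with generalized elements as for relations between sets, one sees that internal relations form an
  allegory with a unit, in which \<open>\<theta> \<in> P(\<Gamma>\<^sub>1 \<oplus> \<Gamma>\<^sub>2)\<close> is tabulated by the projections of the object
  \<open>(\<Gamma>\<^sub>1 \<oplus> \<Gamma>\<^sub>2, \<theta>)\<close>. In an allegory, the left adjoints are the maps (the right adjoint being the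
  converse relation), and the maps of a unitary tabular allegory form a regular category
  (Freyd--Scedrov).\<close>

section \<open>Relations in a category with finite products\<close>

text \<open>Morphisms of \<open>Rel\<close> are classes of monos, composed through arbitrary
  pullbacks and factorizations. Of these, only composites and tensors of graphs and cographs are
  evaluated: they give substitution and quantification all their laws, and rest on finite products,
  pullbacks and images alone. The base category is therefore kept abstract. Contexts return where
  the composition of internal relations, written with strictly associative products, is matched with
  a version written by tuples. Two features shape the rest. The identity of
  \<open>(\<Gamma>, \<phi>)\<close> is the diagonal cut down to \<open>\<phi>\<close>, so a relation
  obeys the unit laws because its elements satisfy the two predicates; the hom condition is
  accordingly restated for generalized elements. And one element of a poset lies in many hom-sets,
  so arrows are tagged with their source and target before calculating with them. The unit of the
  allegory is the empty context with the value of the nullary laxator, its greatest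
  predicate.\<close>

context category
begin

lemmas cat_simps [simp] = idn_in_hom cmp_in_hom cmp_idn_left cmp_idn_right cmp_assoc

end

text \<open>The composite of \<open>e\<close> with \<open>h\<close> equalizes the pair because
  \<open>e\<close> does, and its factorization through \<open>e\<close> is unique.\<close>

lemma (in category) regular_epi_cancel:
  assumes "regular_epi C y q e" "w \<in> obj C" "h \<in> hom C q w" "h' \<in> hom C q w"
    and "cmp C y q w e h = cmp C y q w e h'"
  shows "h = h'"
proof -
  obtain x u v where "coequalizer C x y u v q e"
    using assms(1) unfolding regular_epi_def by blast
  then have o: "x \<in> obj C" "y \<in> obj C" "q \<in> obj C" "u \<in> hom C x y" "v \<in> hom C x y" "e \<in> hom C y q"
    and e: "cmp C x y q u e = cmp C x y q v e"
    and un: "\<And>w g. w \<in> obj C \<Longrightarrow> g \<in> hom C y w \<Longrightarrow> cmp C x y w u g = cmp C x y w v g \<Longrightarrow>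
      (\<exists>!h. h \<in> hom C q w \<and> cmp C y q w e h = g)"
    unfolding coequalizer_def by blast+
  have "cmp C x y w u (cmp C y q w e h) = cmp C x y w v (cmp C y q w e h)"
    using o e assms(2-4) by (metis cmp_assoc)
  from un[OF assms(2) _ this] show ?thesis
    using o assms(2-5) by (metis cmp_in_hom)
qed

lemma (in category) regular_epi_idn:
  assumes "x \<in> obj C"
  shows "regular_epi C x x (idn C x)"
  unfolding regular_epi_def coequalizer_def
proof (intro exI[of _ x] exI[of _ "idn C x"] conjI ballI impI)
  fix w g assume w: "w \<in> obj C" "g \<in> hom C x w"
  show "\<exists>!h. h \<in> hom C x w \<and> cmp C x x w (idn C x) h = g"
    by (rule ex1I[of _ g]) (use w assms in auto)
qed (use assms in auto)

text \<open>Since \<open>u;f;m = u;e;g = v;e;g = v;f;m\<close> and \<open>m\<close> is monic,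
  \<open>f\<close> factors through \<open>e\<close>; cancelling \<open>e\<close> yields the lower
  triangle, the one used for comparing images.\<close>

lemma (in category) regular_epi_monic_diagonal:
  assumes "regular_epi C y q e" "monic C z w m" "f \<in> hom C y z" "g \<in> hom C q w"
    and "cmp C y q w e g = cmp C y z w f m"
  shows "\<exists>d\<in>hom C q z. cmp C q z w d m = g"
proof -
  obtain x u v where "coequalizer C x y u v q e"
    using assms(1) unfolding regular_epi_def by blast
  then have o: "x \<in> obj C" "y \<in> obj C" "q \<in> obj C" "u \<in> hom C x y" "v \<in> hom C x y" "e \<in> hom C y q"
    and e: "cmp C x y q u e = cmp C x y q v e"
    and un: "\<And>w g. w \<in> obj C \<Longrightarrow> g \<in> hom C y w \<Longrightarrow> cmp C x y w u g = cmp C x y w v g \<Longrightarrow>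
      (\<exists>!h. h \<in> hom C q w \<and> cmp C y q w e h = g)"
    unfolding coequalizer_def by blast+
  have m: "z \<in> obj C" "w \<in> obj C" "m \<in> hom C z w"
    and mono: "\<And>v a b. v \<in> obj C \<Longrightarrow> a \<in> hom C v z \<Longrightarrow> b \<in> hom C v z \<Longrightarrow>
      cmp C v z w a m = cmp C v z w b m \<Longrightarrow> a = b"
    using assms(2) unfolding monic_def by blast+
  have "cmp C x z w (cmp C x y z u f) m = cmp C x q w (cmp C x y q u e) g"
    using o m assms(3-5) by simp
  also have "\<dots> = cmp C x z w (cmp C x y z v f) m"
    unfolding e using o m assms(3-5) by simp
  finally have "cmp C x y z u f = cmp C x y z v f"
    by (rule mono[OF o(1), rotated 2]) (use o m assms(3) in auto)
  then obtain d where d: "d \<in> hom C q z" "cmp C y q z e d = f"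
    using un[OF m(1) assms(3)] by blast
  have "cmp C y q w e (cmp C q z w d m) = cmp C y q w e g"
    using o m d assms(4,5) by (metis cmp_assoc)
  then have "cmp C q z w d m = g"
    using regular_epi_cancel[OF assms(1) m(2)] o m d assms(4) by (meson cmp_in_hom)
  then show ?thesis using d by blast
qed

text \<open>Allows the mono of an image factorization to be replaced by another representative of
  its subobject.\<close>

lemma (in category) coequalizer_iso:
  assumes "coequalizer C x y u v q e" and "q' \<in> obj C" "i \<in> hom C q q'" "j \<in> hom C q' q"
    and ij: "cmp C q q' q i j = idn C q" and ji: "cmp C q' q q' j i = idn C q'"
  shows "coequalizer C x y u v q' (cmp C y q q' e i)"
proof -
  have o: "x \<in> obj C" "y \<in> obj C" "q \<in> obj C" "u \<in> hom C x y" "v \<in> hom C x y" "e \<in> hom C y q"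
    and e: "cmp C x y q u e = cmp C x y q v e"
    and un: "\<And>w g. w \<in> obj C \<Longrightarrow> g \<in> hom C y w \<Longrightarrow> cmp C x y w u g = cmp C x y w v g \<Longrightarrow>
      (\<exists>!h. h \<in> hom C q w \<and> cmp C y q w e h = g)"
    using assms(1) unfolding coequalizer_def by blast+
  show ?thesis
    unfolding coequalizer_def
  proof (intro conjI ballI impI)
    show "cmp C x y q' u (cmp C y q q' e i) = cmp C x y q' v (cmp C y q q' e i)"
      using o assms(2,3) e by (metis cmp_assoc)
    fix w g assume w: "w \<in> obj C" "g \<in> hom C y w" "cmp C x y w u g = cmp C x y w v g"
    then obtain h where h: "h \<in> hom C q w" "cmp C y q w e h = g"
      and hu: "\<And>h'. h' \<in> hom C q w \<Longrightarrow> cmp C y q w e h' = g \<Longrightarrow> h' = h"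
      using un by blast
    show "\<exists>!h. h \<in> hom C q' w \<and> cmp C y q' w (cmp C y q q' e i) h = g"
    proof (rule ex1I[of _ "cmp C q' q w j h"])
      have "cmp C q q' w i (cmp C q' q w j h) = h"
        using o w h assms(2-4) ij by (metis cmp_assoc cmp_idn_left)
      then show "cmp C q' q w j h \<in> hom C q' w \<and> cmp C y q' w (cmp C y q q' e i) (cmp C q' q w j h) = g"
        using o w h assms(2-4) by simp
      fix h' assume h': "h' \<in> hom C q' w \<and> cmp C y q' w (cmp C y q q' e i) h' = g"
      then have "cmp C q q' w i h' = h"
        using o w assms(2,3) by (intro hu) auto
      then show "h' = cmp C q' q w j h"
        using o w h' assms(2-4) ji by (metis cmp_assoc cmp_idn_left)
    qed
  qed (use o assms(2,3) in auto)
qed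

section \<open>Subobjects as classes of mutually factoring monos\<close>

context category
begin

lemma factors_refl: "x \<in> obj C \<Longrightarrow> y \<in> obj C \<Longrightarrow> m \<in> hom C x y \<Longrightarrow> factors C y (x, m) (x, m)"
  unfolding factors_def by (auto intro!: bexI[of _ "idn C x"])

lemma factors_trans:
  assumes "x \<in> obj C" "x' \<in> obj C" "x'' \<in> obj C" "y \<in> obj C" "m'' \<in> hom C x'' y"
    and "factors C y (x, m) (x', m')" "factors C y (x', m') (x'', m'')"
  shows "factors C y (x, m) (x'', m'')"
proof -
  obtain k k' where "k \<in> hom C x x'" "cmp C x x' y k m' = m" "k' \<in> hom C x' x''" "cmp C x' x'' y k' m'' = m'"
    using assms(6,7) unfolding factors_def by auto
  then show ?thesis
    using assms(1-5) unfolding factors_def by (auto intro!: bexI[of _ "cmp C x x' x'' k k'"])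
qed

lemma equiv_same_subobject: "equiv (monics C y) (same_subobject C y)"
proof (rule equivI)
  show "same_subobject C y \<subseteq> monics C y \<times> monics C y"
    unfolding same_subobject_def by auto
  show "refl_on (monics C y) (same_subobject C y)"
    unfolding refl_on_def same_subobject_def monics_def monic_def
    by (auto intro: factors_refl)
  show "sym (same_subobject C y)"
    unfolding sym_def same_subobject_def by auto
  show "trans (same_subobject C y)"
    unfolding trans_def same_subobject_def
    by (auto simp: monics_def monic_def intro: factors_trans)
qed

lemma mem_subobject_of:
  "(x', m') \<in> subobject_of C x y m \<longleftrightarrow> monic C x y m \<and> monic C x' y m' \<and>
    factors C y (x, m) (x', m') \<and> factors C y (x', m') (x, m)"
  unfolding subobject_of_def same_subobject_def monics_def by auto

lemma subobject_of_refl: "monic C x y m \<Longrightarrow> (x, m) \<in> subobject_of C x y m"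
  unfolding mem_subobject_of by (auto simp: monic_def intro: factors_refl)

lemma subobject_of_eq:
  "(x', m') \<in> subobject_of C x y m \<Longrightarrow> subobject_of C x y m = subobject_of C x' y m'"
  unfolding subobject_of_def using equiv_class_eq[OF equiv_same_subobject] by blast

lemma subobject_of_in: "monic C x y m \<Longrightarrow> subobject_of C x y m \<in> subobjects C y"
  unfolding subobject_of_def subobjects_def monics_def by (auto intro: quotientI)

lemma subobject_le_of:
  "monic C x y m \<Longrightarrow> monic C x' y m' \<Longrightarrow> factors C y (x, m) (x', m') \<Longrightarrow>
    subobject_le C y (subobject_of C x y m) (subobject_of C x' y m')"
  unfolding subobject_le_def using subobject_of_refl by blast

end

section \<open>Chosen finite products and the evaluation of composite relations\<close>

locale fp_category = category C
  for C :: "('o, 'm, 'z) fpcat_scheme" +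
  assumes one_obj [simp]: "one C \<in> obj C"
    and prd_obj [simp]: "x \<in> obj C \<Longrightarrow> y \<in> obj C \<Longrightarrow> prd C x y \<in> obj C"
    and pr1_hom [simp]: "x \<in> obj C \<Longrightarrow> y \<in> obj C \<Longrightarrow> pr1 C x y \<in> hom C (prd C x y) x"
    and pr2_hom [simp]: "x \<in> obj C \<Longrightarrow> y \<in> obj C \<Longrightarrow> pr2 C x y \<in> hom C (prd C x y) y"
    and one_terminal: "x \<in> obj C \<Longrightarrow> \<exists>!h. h \<in> hom C x (one C)"
    and prd_universal: "z \<in> obj C \<Longrightarrow> x \<in> obj C \<Longrightarrow> y \<in> obj C \<Longrightarrow> f \<in> hom C z x \<Longrightarrow> g \<in> hom C z y \<Longrightarrow>
      \<exists>!h. h \<in> hom C z (prd C x y) \<and>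
        cmp C z (prd C x y) x h (pr1 C x y) = f \<and> cmp C z (prd C x y) y h (pr2 C x y) = g"
begin

lemma bang_hom [simp]: "x \<in> obj C \<Longrightarrow> bang C x \<in> hom C x (one C)"
  unfolding bang_def by (rule theI') (rule one_terminal)

lemma into_one_unique: "x \<in> obj C \<Longrightarrow> f \<in> hom C x (one C) \<Longrightarrow> g \<in> hom C x (one C) \<Longrightarrow> f = g"
  using one_terminal by blast

lemma
  assumes "z \<in> obj C" "x \<in> obj C" "y \<in> obj C" "f \<in> hom C z x" "g \<in> hom C z y"
  shows tuple_hom [simp]: "tuple C z x y f g \<in> hom C z (prd C x y)"
    and tuple_pr1 [simp]: "cmp C z (prd C x y) x (tuple C z x y f g) (pr1 C x y) = f"
    and tuple_pr2 [simp]: "cmp C z (prd C x y) y (tuple C z x y f g) (pr2 C x y) = g"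
  using theI'[OF prd_universal[OF assms]] unfolding tuple_def by blast+

lemma into_prd_eqI:
  assumes "z \<in> obj C" "x \<in> obj C" "y \<in> obj C" "h \<in> hom C z (prd C x y)" "k \<in> hom C z (prd C x y)"
    and "cmp C z (prd C x y) x h (pr1 C x y) = cmp C z (prd C x y) x k (pr1 C x y)"
    and "cmp C z (prd C x y) y h (pr2 C x y) = cmp C z (prd C x y) y k (pr2 C x y)"
  shows "h = k"
  using prd_universal[of z x y "cmp C z (prd C x y) x k (pr1 C x y)" "cmp C z (prd C x y) y k (pr2 C x y)"]
    assms by auto

text \<open>Simplification brackets composites to the right, so a projection after a tuple usually
  has a further map behind it; this form of the projection law catches that case.\<close>

lemma tuple_pr1_cmp [simp]:
  assumes "z \<in> obj C" "x \<in> obj C" "y \<in> obj C" "w \<in> obj C" "f \<in> hom C z x" "g \<in> hom C z y" "h \<in> hom C x w"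
  shows "cmp C z (prd C x y) w (tuple C z x y f g) (cmp C (prd C x y) x w (pr1 C x y) h) = cmp C z x w f h"
  using assms by (simp flip: cmp_assoc)

lemma tuple_pr2_cmp [simp]:
  assumes "z \<in> obj C" "x \<in> obj C" "y \<in> obj C" "w \<in> obj C" "f \<in> hom C z x" "g \<in> hom C z y" "h \<in> hom C y w"
  shows "cmp C z (prd C x y) w (tuple C z x y f g) (cmp C (prd C x y) y w (pr2 C x y) h) = cmp C z y w g h"
  using assms by (simp flip: cmp_assoc)

lemma cmp_tuple:
  assumes "w \<in> obj C" "z \<in> obj C" "x \<in> obj C" "y \<in> obj C" "h \<in> hom C w z" "f \<in> hom C z x" "g \<in> hom C z y"
  shows "cmp C w z (prd C x y) h (tuple C z x y f g) = tuple C w x y (cmp C w z x h f) (cmp C w z y h g)"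
  by (rule into_prd_eqI[of _ x y]) (use assms in auto)

lemma tuple_expand:
  assumes "z \<in> obj C" "x \<in> obj C" "y \<in> obj C" "h \<in> hom C z (prd C x y)"
  shows "tuple C z x y (cmp C z (prd C x y) x h (pr1 C x y)) (cmp C z (prd C x y) y h (pr2 C x y)) = h"
  by (rule into_prd_eqI[of _ x y]) (use assms in auto)

lemma diag_hom [simp]: "x \<in> obj C \<Longrightarrow> diag C x \<in> hom C x (prd C x x)"
  unfolding diag_def by simp

lemma times_hom [simp]:
  assumes "x \<in> obj C" "y \<in> obj C" "x' \<in> obj C" "y' \<in> obj C" "f \<in> hom C x y" "g \<in> hom C x' y'"
  shows "times C x y x' y' f g \<in> hom C (prd C x x') (prd C y y')"
  using assms unfolding times_def by simp

lemma tuple_times: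
  assumes "z \<in> obj C" "x \<in> obj C" "y \<in> obj C" "x' \<in> obj C" "y' \<in> obj C" "f \<in> hom C x y" "g \<in> hom C x' y'"
    "h \<in> hom C z x" "k \<in> hom C z x'"
  shows "cmp C z (prd C x x') (prd C y y') (tuple C z x x' h k) (times C x y x' y' f g) =
    tuple C z y y' (cmp C z x y h f) (cmp C z x' y' k g)"
  using assms unfolding times_def by (simp add: cmp_tuple)

lemma monicI:
  assumes "x \<in> obj C" "y \<in> obj C" "m \<in> hom C x y"
    and "\<And>w a b. w \<in> obj C \<Longrightarrow> a \<in> hom C w x \<Longrightarrow> b \<in> hom C w x \<Longrightarrow>
      cmp C w x y a m = cmp C w x y b m \<Longrightarrow> a = b"
  shows "monic C x y m"
  using assms unfolding monic_def by blast

text \<open>Joint monicity of \<open>f\<close> and \<open>g\<close> is monicity of one map into the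
  product, the form in which spans become subobjects.\<close>

lemma monic_tupleI:
  assumes "p \<in> obj C" "x \<in> obj C" "y \<in> obj C" "f \<in> hom C p x" "g \<in> hom C p y"
    and "\<And>w a b. w \<in> obj C \<Longrightarrow> a \<in> hom C w p \<Longrightarrow> b \<in> hom C w p \<Longrightarrow>
      cmp C w p x a f = cmp C w p x b f \<Longrightarrow> cmp C w p y a g = cmp C w p y b g \<Longrightarrow> a = b"
  shows "monic C p (prd C x y) (tuple C p x y f g)"
proof (rule monicI)
  fix w a b
  assume w: "w \<in> obj C" "a \<in> hom C w p" "b \<in> hom C w p"
    "cmp C w p (prd C x y) a (tuple C p x y f g) = cmp C w p (prd C x y) b (tuple C p x y f g)"
  have "tuple C w x y (cmp C w p x a f) (cmp C w p y a g) = tuple C w x y (cmp C w p x b f) (cmp C w p y b g)"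
    using w assms(1-5) by (simp add: cmp_tuple)
  then have "cmp C w p x a f = cmp C w p x b f" "cmp C w p y a g = cmp C w p y b g"
    using w assms(1-5) by (metis tuple_pr1 cmp_in_hom, metis tuple_pr2 cmp_in_hom)
  with w assms(6) show "a = b" by blast
qed (use assms in auto)

lemma monic_graph:
  "x \<in> obj C \<Longrightarrow> y \<in> obj C \<Longrightarrow> f \<in> hom C x y \<Longrightarrow> monic C x (prd C x y) (tuple C x x y (idn C x) f)"
  by (rule monic_tupleI) auto

lemma monic_cograph:
  "x \<in> obj C \<Longrightarrow> y \<in> obj C \<Longrightarrow> f \<in> hom C x y \<Longrightarrow> monic C x (prd C y x) (tuple C x y x f (idn C x))"
  by (rule monic_tupleI) auto

lemma monic_pullback:
  assumes "pullback C x y z f g p p1 p2"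
  shows "monic C p (prd C x y) (tuple C p x y p1 p2)"
proof (rule monic_tupleI)
  fix w a b
  assume w: "w \<in> obj C" "a \<in> hom C w p" "b \<in> hom C w p"
    "cmp C w p x a p1 = cmp C w p x b p1" "cmp C w p y a p2 = cmp C w p y b p2"
  have o: "x \<in> obj C" "y \<in> obj C" "z \<in> obj C" "p \<in> obj C" "f \<in> hom C x z" "g \<in> hom C y z"
      "p1 \<in> hom C p x" "p2 \<in> hom C p y" "cmp C p x z p1 f = cmp C p y z p2 g"
    using assms unfolding pullback_def by auto
  have "cmp C w x z (cmp C w p x b p1) f = cmp C w y z (cmp C w p y b p2) g"
    using o w by simp
  moreover have "cmp C w p x b p1 \<in> hom C w x" "cmp C w p y b p2 \<in> hom C w y"
    using o w by auto
  ultimately have "\<exists>!h. h \<in> hom C w p \<and> cmp C w p x h p1 = cmp C w p x b p1 \<and> cmp C w p y h p2 = cmp C w p y b p2"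
    using assms w(1) unfolding pullback_def by blast
  with w show "a = b" by blast
qed (use assms in \<open>auto simp: pullback_def\<close>)

text \<open>Monotonicity of composition at the level of representatives. The factorizations
  \<open>k\<close> and \<open>l\<close> induce a map \<open>u\<close> between the pullbacks, and the
  diagonal fill-in of the regular epi \<open>e'\<close> against the mono \<open>m\<close> makes it
  descend to the images. Used in both directions, this shows that the image depends only on the two
  subobjects.\<close>

lemma rel_image_factors:
  assumes o: "r \<in> obj C" "s \<in> obj C" "t \<in> obj C"
    and a: "monic C x (prd C r s) a" and b: "monic C y (prd C s t) b"
    and a': "monic C x' (prd C r s) a'" and b': "monic C y' (prd C s t) b'"
    and fa: "factors C (prd C r s) (x', a') (x, a)" and fb: "factors C (prd C s t) (y', b') (y, b)"
    and pb: "pullback C x y s (cmp C x (prd C r s) s a (pr2 C r s)) (cmp C y (prd C s t) s b (pr1 C s t)) p p1 p2"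
    and pb': "pullback C x' y' s (cmp C x' (prd C r s) s a' (pr2 C r s)) (cmp C y' (prd C s t) s b' (pr1 C s t)) p' p1' p2'"
    and e: "e \<in> hom C p z" and e': "regular_epi C p' z' e'"
    and m: "monic C z (prd C r t) m" and m': "monic C z' (prd C r t) m'"
    and em: "cmp C p z (prd C r t) e m = tuple C p r t
        (cmp C p x r p1 (cmp C x (prd C r s) r a (pr1 C r s)))
        (cmp C p y t p2 (cmp C y (prd C s t) t b (pr2 C s t)))"
    and em': "cmp C p' z' (prd C r t) e' m' = tuple C p' r t
        (cmp C p' x' r p1' (cmp C x' (prd C r s) r a' (pr1 C r s)))
        (cmp C p' y' t p2' (cmp C y' (prd C s t) t b' (pr2 C s t)))"
  shows "factors C (prd C r t) (z', m') (z, m)"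
proof -
  obtain k where k: "k \<in> hom C x' x" "cmp C x' x (prd C r s) k a = a'"
    using fa unfolding factors_def by auto
  obtain l where l: "l \<in> hom C y' y" "cmp C y' y (prd C s t) l b = b'"
    using fb unfolding factors_def by auto
  have ms: "x \<in> obj C" "a \<in> hom C x (prd C r s)" "y \<in> obj C" "b \<in> hom C y (prd C s t)"
    "x' \<in> obj C" "y' \<in> obj C" "z \<in> obj C" "z' \<in> obj C" "m \<in> hom C z (prd C r t)" "m' \<in> hom C z' (prd C r t)"
    using a b a' b' m m' unfolding monic_def by auto
  have ps: "p \<in> obj C" "p' \<in> obj C" "p1 \<in> hom C p x" "p2 \<in> hom C p y" "p1' \<in> hom C p' x'" "p2' \<in> hom C p' y'"
    using pb pb' unfolding pullback_def by auto
  have e'h: "e' \<in> hom C p' z'"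
    using e' unfolding regular_epi_def coequalizer_def by auto
  have "cmp C p' x' s p1' (cmp C x' (prd C r s) s a' (pr2 C r s)) = cmp C p' y' s p2' (cmp C y' (prd C s t) s b' (pr1 C s t))"
    using pb' unfolding pullback_def by auto
  then have "cmp C p' x s (cmp C p' x' x p1' k) (cmp C x (prd C r s) s a (pr2 C r s)) =
      cmp C p' y s (cmp C p' y' y p2' l) (cmp C y (prd C s t) s b (pr1 C s t))"
    using o ms ps k(1) l(1) by (simp flip: k(2) l(2))
  moreover have "cmp C p' x' x p1' k \<in> hom C p' x" "cmp C p' y' y p2' l \<in> hom C p' y"
    using ms ps k(1) l(1) by auto
  ultimately obtain u where u: "u \<in> hom C p' p" "cmp C p' p x u p1 = cmp C p' x' x p1' k" "cmp C p' p y u p2 = cmp C p' y' y p2' l"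
    using pb ps(2) unfolding pullback_def by blast
  have u1: "cmp C p' p r u (cmp C p x r p1 h) = cmp C p' x' r p1' (cmp C x' x r k h)" if "h \<in> hom C x r" for h
    using that o ms ps u(1) k(1) by (simp add: u(2) flip: cmp_assoc)
  have u2: "cmp C p' p t u (cmp C p y t p2 h) = cmp C p' y' t p2' (cmp C y' y t l h)" if "h \<in> hom C y t" for h
    using that o ms ps u(1) l(1) by (simp add: u(3) flip: cmp_assoc)
  have "cmp C p' z (prd C r t) (cmp C p' p z u e) m = cmp C p' p (prd C r t) u (cmp C p z (prd C r t) e m)"
    using o ms ps u e by simp
  also have "\<dots> = cmp C p' z' (prd C r t) e' m'"
    unfolding em em' using o ms ps u(1) k(1) l(1)
    by (simp add: cmp_tuple u1 u2 flip: k(2) l(2))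
  finally have "cmp C p' z' (prd C r t) e' m' = cmp C p' z (prd C r t) (cmp C p' p z u e) m" by simp
  then show ?thesis
    using regular_epi_monic_diagonal[OF e' m, of "cmp C p' p z u e" m'] ms ps u e
    unfolding factors_def by auto
qed

text \<open>\<open>rel_comp\<close> collects the monos arising from all representatives, pullbacks
  and factorizations; this evaluates it from one choice of each. Two monos that arise factor through
  each other by the comparison of images, and conversely every mono equivalent to \<open>m\<close>
  arises by following \<open>e\<close> with an isomorphism.\<close>

lemma rel_comp_eq:
  assumes o: "r \<in> obj C" "s \<in> obj C" "t \<in> obj C"
    and a: "monic C x (prd C r s) a" and b: "monic C y (prd C s t) b"
    and pb: "pullback C x y s (cmp C x (prd C r s) s a (pr2 C r s)) (cmp C y (prd C s t) s b (pr1 C s t)) p p1 p2"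
    and e: "regular_epi C p z e" and m: "monic C z (prd C r t) m"
    and em: "cmp C p z (prd C r t) e m = tuple C p r t
        (cmp C p x r p1 (cmp C x (prd C r s) r a (pr1 C r s)))
        (cmp C p y t p2 (cmp C y (prd C s t) t b (pr2 C s t)))"
  shows "rel_comp C r s t (subobject_of C x (prd C r s) a) (subobject_of C y (prd C s t) b) = subobject_of C z (prd C r t) m"
proof -
  have eh: "e \<in> hom C p z" "p \<in> obj C" "z \<in> obj C"
    using e unfolding regular_epi_def coequalizer_def by auto
  have "(z', m') \<in> rel_comp C r s t (subobject_of C x (prd C r s) a) (subobject_of C y (prd C s t) b)
      \<longleftrightarrow> (z', m') \<in> subobject_of C z (prd C r t) m" (is "?L \<longleftrightarrow> ?R") for z' m'
  proof
    assume ?L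
    then obtain x' a' y' b' p' p1' p2' e' where m': "monic C z' (prd C r t) m'"
      and a'S: "(x', a') \<in> subobject_of C x (prd C r s) a" and b'S: "(y', b') \<in> subobject_of C y (prd C s t) b"
      and pb': "pullback C x' y' s (cmp C x' (prd C r s) s a' (pr2 C r s)) (cmp C y' (prd C s t) s b' (pr1 C s t)) p' p1' p2'"
      and e': "regular_epi C p' z' e'"
      and em': "cmp C p' z' (prd C r t) e' m' = tuple C p' r t
        (cmp C p' x' r p1' (cmp C x' (prd C r s) r a' (pr1 C r s)))
        (cmp C p' y' t p2' (cmp C y' (prd C s t) t b' (pr2 C s t)))"
      unfolding rel_comp_def by blast
    have a': "monic C x' (prd C r s) a'" "factors C (prd C r s) (x, a) (x', a')" "factors C (prd C r s) (x', a') (x, a)"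
      and b': "monic C y' (prd C s t) b'" "factors C (prd C s t) (y, b) (y', b')" "factors C (prd C s t) (y', b') (y, b)"
      using a'S b'S unfolding mem_subobject_of by auto
    have e'h: "e' \<in> hom C p' z'"
      using e' unfolding regular_epi_def coequalizer_def by auto
    show ?R
      unfolding mem_subobject_of
      using m m' rel_image_factors[OF o a b a'(1) b'(1) a'(3) b'(3) pb pb' eh(1) e' m m' em em']
        rel_image_factors[OF o a'(1) b'(1) a b a'(2) b'(2) pb' pb e'h e m' m em' em]
      by blast
  next
    assume ?R
    then have m': "monic C z' (prd C r t) m'" and f: "factors C (prd C r t) (z, m) (z', m')" "factors C (prd C r t) (z', m') (z, m)"
      unfolding mem_subobject_of by auto
    obtain i j where i: "i \<in> hom C z z'" "cmp C z z' (prd C r t) i m' = m"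
      and j: "j \<in> hom C z' z" "cmp C z' z (prd C r t) j m = m'"
      using f unfolding factors_def by auto
    have z': "z' \<in> obj C" "m' \<in> hom C z' (prd C r t)" using m' unfolding monic_def by auto
    have mh: "m \<in> hom C z (prd C r t)" using m unfolding monic_def by auto
    \<comment> \<open>Monos that factor through each other are isomorphic over their target, because
      they can be cancelled.\<close>
    have ij: "cmp C z z' z i j = idn C z"
    proof -
      have "cmp C z z (prd C r t) (cmp C z z' z i j) m = cmp C z z (prd C r t) (idn C z) m"
        using i j z' mh eh o by simp
      then show ?thesis using m i(1) j(1) z' eh unfolding monic_def by (meson cmp_in_hom idn_in_hom)
    qed
    have ji: "cmp C z' z z' j i = idn C z'"
    proof -
      have "cmp C z' z' (prd C r t) (cmp C z' z z' j i) m' = cmp C z' z' (prd C r t) (idn C z') m'"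
        using i j z' mh eh o by simp
      then show ?thesis using m' i(1) j(1) z' eh unfolding monic_def by (meson cmp_in_hom idn_in_hom)
    qed
    obtain q u v where "coequalizer C q p u v z e" using e unfolding regular_epi_def by blast
    from coequalizer_iso[OF this z'(1) i(1) j(1) ij ji]
    have "regular_epi C p z' (cmp C p z z' e i)" unfolding regular_epi_def by blast
    moreover have "cmp C p z' (prd C r t) (cmp C p z z' e i) m' = cmp C p z (prd C r t) e m"
      using eh i z' o by simp
    ultimately show ?L
      unfolding rel_comp_def using m' pb em subobject_of_refl[OF a] subobject_of_refl[OF b] by fastforce
  qed
  then show ?thesis by auto
qed

end

section \<open>Graphs, cographs, and their composites and tensors\<close>

context fp_category
begin

lemma graph_hom [simp]:
  "x \<in> obj C \<Longrightarrow> y \<in> obj C \<Longrightarrow> f \<in> hom C x y \<Longrightarrow> graph C x y f \<in> subobjects C (prd C x y)"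
  unfolding graph_def by (intro subobject_of_in monic_graph)

lemma cograph_hom [simp]:
  "x \<in> obj C \<Longrightarrow> y \<in> obj C \<Longrightarrow> f \<in> hom C x y \<Longrightarrow> cograph C x y f \<in> subobjects C (prd C y x)"
  unfolding cograph_def by (intro subobject_of_in monic_cograph)

lemma cograph_idn: "cograph C x x (idn C x) = graph C x x (idn C x)"
  unfolding graph_def cograph_def ..

lemma pullback_idn:
  assumes "x \<in> obj C" "y \<in> obj C" "f \<in> hom C x y"
  shows "pullback C y x y (idn C y) f x f (idn C x)"
  unfolding pullback_def
proof (intro conjI ballI impI)
  fix w a b
  assume w: "w \<in> obj C" "a \<in> hom C w y" "b \<in> hom C w x" "cmp C w y y a (idn C y) = cmp C w x y b f"
  then have "a = cmp C w x y b f" using assms by simp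
  show "\<exists>!h. h \<in> hom C w x \<and> cmp C w x y h f = a \<and> cmp C w x x h (idn C x) = b"
  proof (rule ex1I[of _ b])
    show "b \<in> hom C w x \<and> cmp C w x y b f = a \<and> cmp C w x x b (idn C x) = b"
      using \<open>a = _\<close> w assms by simp
    fix h assume "h \<in> hom C w x \<and> cmp C w x y h f = a \<and> cmp C w x x h (idn C x) = b"
    then show "h = b" using w(1) assms(1) by auto
  qed
qed (use assms in auto)

text \<open>The pairing of the two legs of a pullback is monic already, so its image factorization
  starts with an identity.\<close>

lemma rel_comp_graph_cograph:
  assumes "pullback C x y z f g p p1 p2"
  shows "rel_comp C x z y (graph C x z f) (cograph C y z g) = subobject_of C p (prd C x y) (tuple C p x y p1 p2)"
proof -
  have o: "x \<in> obj C" "y \<in> obj C" "z \<in> obj C" "p \<in> obj C" "f \<in> hom C x z" "g \<in> hom C y z"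
      "p1 \<in> hom C p x" "p2 \<in> hom C p y"
    using assms unfolding pullback_def by auto
  show ?thesis
    unfolding graph_def cograph_def
    by (rule rel_comp_eq[where p = p and ?p1.0 = p1 and ?p2.0 = p2 and e = "idn C p"])
      (use o assms monic_pullback[OF assms] in \<open>auto simp: monic_graph monic_cograph regular_epi_idn\<close>)
qed

text \<open>The pullback in the middle is that of identities on \<open>p\<close>, so the composite
  is just the image of \<open>\<langle>f, g\<rangle>\<close>.\<close>

lemma rel_comp_cograph_graph:
  assumes "p \<in> obj C" "q \<in> obj C" "x \<in> obj C" "y \<in> obj C" "f \<in> hom C p x" "g \<in> hom C p y"
    and "regular_epi C p q e" "monic C q (prd C x y) m"
    and "cmp C p q (prd C x y) e m = tuple C p x y f g"
  shows "rel_comp C x p y (cograph C p x f) (graph C p y g) = subobject_of C q (prd C x y) m"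
  unfolding graph_def cograph_def
  by (rule rel_comp_eq[where p = p and ?p1.0 = "idn C p" and ?p2.0 = "idn C p" and e = e])
    (use assms pullback_idn[of p p "idn C p"] in \<open>auto simp: monic_graph monic_cograph\<close>)

text \<open>Both composites are the subobject given by the two legs of the pullback.\<close>

lemma rel_comp_Beck_Chevalley:
  assumes "pullback C x y z f g p p1 p2"
  shows "rel_comp C x z y (graph C x z f) (cograph C y z g) = rel_comp C x p y (cograph C p x p1) (graph C p y p2)"
proof -
  have o: "x \<in> obj C" "y \<in> obj C" "p \<in> obj C" "p1 \<in> hom C p x" "p2 \<in> hom C p y"
    using assms unfolding pullback_def by auto
  have "rel_comp C x p y (cograph C p x p1) (graph C p y p2) = subobject_of C p (prd C x y) (tuple C p x y p1 p2)"
    by (rule rel_comp_cograph_graph[where e = "idn C p"])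
      (use o monic_pullback[OF assms] in \<open>auto simp: regular_epi_idn\<close>)
  then show ?thesis using rel_comp_graph_cograph[OF assms] by simp
qed

lemma rel_comp_cograph_cograph:
  assumes "x \<in> obj C" "y \<in> obj C" "z \<in> obj C" "f \<in> hom C x y" "g \<in> hom C y z"
  shows "rel_comp C z y x (cograph C y z g) (cograph C x y f) = cograph C x z (cmp C x y z f g)"
  unfolding cograph_def
  by (rule rel_comp_eq[where p = x and ?p1.0 = f and ?p2.0 = "idn C x" and e = "idn C x"])
    (use assms pullback_idn[of x y f] in \<open>auto simp: monic_cograph regular_epi_idn\<close>)

text \<open>The union over representatives consists of equal classes: each pairing is monic, since
  \<open>a\<close> and \<open>b\<close> can be cancelled after regrouping the four components, and
  factorizations of the representatives multiply to one of the pairings.\<close>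

lemma rel_tensor_eq:
  fixes r s r' s' :: 'o
  defines "T \<equiv> \<lambda>x a y b. tuple C (prd C x y) (prd C r r') (prd C s s')
    (times C x r y r' (cmp C x (prd C r s) r a (pr1 C r s)) (cmp C y (prd C r' s') r' b (pr1 C r' s')))
    (times C x s y s' (cmp C x (prd C r s) s a (pr2 C r s)) (cmp C y (prd C r' s') s' b (pr2 C r' s')))"
  assumes o: "r \<in> obj C" "s \<in> obj C" "r' \<in> obj C" "s' \<in> obj C"
    and a: "monic C x (prd C r s) a" and b: "monic C y (prd C r' s') b"
  shows "rel_tensor C r s r' s' (subobject_of C x (prd C r s) a) (subobject_of C y (prd C r' s') b) =
    subobject_of C (prd C x y) (prd C (prd C r r') (prd C s s')) (T x a y b)"
proof -
  let ?R = "prd C (prd C r r') (prd C s s')"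
  have T_hom: "T x a y b \<in> hom C (prd C x y) ?R"
    if "monic C x (prd C r s) a" "monic C y (prd C r' s') b" for x a y b
    using that o unfolding T_def monic_def by simp
  have T_eq: "T x a y b = tuple C (prd C x y) (prd C r r') (prd C s s')
      (tuple C (prd C x y) r r' (cmp C (prd C x y) x r (pr1 C x y) (cmp C x (prd C r s) r a (pr1 C r s)))
        (cmp C (prd C x y) y r' (pr2 C x y) (cmp C y (prd C r' s') r' b (pr1 C r' s'))))
      (tuple C (prd C x y) s s' (cmp C (prd C x y) x s (pr1 C x y) (cmp C x (prd C r s) s a (pr2 C r s)))
        (cmp C (prd C x y) y s' (pr2 C x y) (cmp C y (prd C r' s') s' b (pr2 C r' s'))))" for x a y b
    unfolding T_def times_def ..
  have T_monic: "monic C (prd C x y) ?R (T x a y b)"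
    if m: "monic C x (prd C r s) a" "monic C y (prd C r' s') b" for x a y b
  proof -
    have ms: "x \<in> obj C" "y \<in> obj C" "a \<in> hom C x (prd C r s)" "b \<in> hom C y (prd C r' s')"
      using m unfolding monic_def by auto
    show ?thesis
      unfolding T_eq
    proof (intro monic_tupleI)
      fix w h k
      let ?rr = "tuple C (prd C x y) r r' (cmp C (prd C x y) x r (pr1 C x y) (cmp C x (prd C r s) r a (pr1 C r s)))
        (cmp C (prd C x y) y r' (pr2 C x y) (cmp C y (prd C r' s') r' b (pr1 C r' s')))"
      let ?ss = "tuple C (prd C x y) s s' (cmp C (prd C x y) x s (pr1 C x y) (cmp C x (prd C r s) s a (pr2 C r s)))
        (cmp C (prd C x y) y s' (pr2 C x y) (cmp C y (prd C r' s') s' b (pr2 C r' s')))"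
      assume w: "w \<in> obj C" "h \<in> hom C w (prd C x y)" "k \<in> hom C w (prd C x y)"
        and rr: "cmp C w (prd C x y) (prd C r r') h ?rr = cmp C w (prd C x y) (prd C r r') k ?rr"
        and ss: "cmp C w (prd C x y) (prd C s s') h ?ss = cmp C w (prd C x y) (prd C s s') k ?ss"
      let ?h1 = "cmp C w (prd C x y) x h (pr1 C x y)" and ?k1 = "cmp C w (prd C x y) x k (pr1 C x y)"
      let ?h2 = "cmp C w (prd C x y) y h (pr2 C x y)" and ?k2 = "cmp C w (prd C x y) y k (pr2 C x y)"
      have "?h1 = ?k1"
      proof -
        have "cmp C w x (prd C r s) ?h1 a = cmp C w x (prd C r s) ?k1 a"
        proof (rule into_prd_eqI[of _ r s])
          show "cmp C w (prd C r s) r (cmp C w x (prd C r s) ?h1 a) (pr1 C r s) =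
              cmp C w (prd C r s) r (cmp C w x (prd C r s) ?k1 a) (pr1 C r s)"
            using arg_cong[OF rr, of "\<lambda>q. cmp C w (prd C r r') r q (pr1 C r r')"] w ms o by simp
          show "cmp C w (prd C r s) s (cmp C w x (prd C r s) ?h1 a) (pr2 C r s) =
              cmp C w (prd C r s) s (cmp C w x (prd C r s) ?k1 a) (pr2 C r s)"
            using arg_cong[OF ss, of "\<lambda>q. cmp C w (prd C s s') s q (pr1 C s s')"] w ms o by simp
        qed (use w ms o in auto)
        moreover have "?h1 \<in> hom C w x" "?k1 \<in> hom C w x" using w ms by auto
        ultimately show ?thesis using m(1) w(1) unfolding monic_def by blast
      qed
      moreover have "?h2 = ?k2"
      proof -
        have "cmp C w y (prd C r' s') ?h2 b = cmp C w y (prd C r' s') ?k2 b"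
        proof (rule into_prd_eqI[of _ r' s'])
          show "cmp C w (prd C r' s') r' (cmp C w y (prd C r' s') ?h2 b) (pr1 C r' s') =
              cmp C w (prd C r' s') r' (cmp C w y (prd C r' s') ?k2 b) (pr1 C r' s')"
            using arg_cong[OF rr, of "\<lambda>q. cmp C w (prd C r r') r' q (pr2 C r r')"] w ms o by simp
          show "cmp C w (prd C r' s') s' (cmp C w y (prd C r' s') ?h2 b) (pr2 C r' s') =
              cmp C w (prd C r' s') s' (cmp C w y (prd C r' s') ?k2 b) (pr2 C r' s')"
            using arg_cong[OF ss, of "\<lambda>q. cmp C w (prd C s s') s' q (pr2 C s s')"] w ms o by simp
        qed (use w ms o in auto)
        moreover have "?h2 \<in> hom C w y" "?k2 \<in> hom C w y" using w ms by auto
        ultimately show ?thesis using m(2) w(1) unfolding monic_def by blast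
      qed
      ultimately show "h = k" by (intro into_prd_eqI[OF w(1) ms(1,2) w(2,3)])
    qed (use ms o in auto)
  qed
  have T_factors: "factors C ?R (prd C x y, T x a y b) (prd C x' y', T x' a' y' b')"
    if m: "monic C x (prd C r s) a" "monic C y (prd C r' s') b" "monic C x' (prd C r s) a'" "monic C y' (prd C r' s') b'"
      and f: "factors C (prd C r s) (x, a) (x', a')" "factors C (prd C r' s') (y, b) (y', b')" for x a y b x' a' y' b'
  proof -
    have ms: "x \<in> obj C" "y \<in> obj C" "x' \<in> obj C" "y' \<in> obj C" "a' \<in> hom C x' (prd C r s)" "b' \<in> hom C y' (prd C r' s')"
      using m unfolding monic_def by auto
    obtain k where k: "k \<in> hom C x x'" "cmp C x x' (prd C r s) k a' = a"
      using f(1) unfolding factors_def by auto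
    obtain l where l: "l \<in> hom C y y'" "cmp C y y' (prd C r' s') l b' = b"
      using f(2) unfolding factors_def by auto
    have "cmp C (prd C x y) (prd C x' y') ?R (times C x x' y y' k l) (T x' a' y' b') = T x a y b"
      unfolding T_eq times_def using ms o k(1) l(1) by (simp add: cmp_tuple flip: k(2) l(2))
    then show ?thesis
      unfolding factors_def using ms k(1) l(1) by (auto intro!: bexI[of _ "times C x x' y y' k l"])
  qed
  have "subobject_of C (prd C x' y') ?R (T x' a' y' b') = subobject_of C (prd C x y) ?R (T x a y b)"
    if "(x', a') \<in> subobject_of C x (prd C r s) a" "(y', b') \<in> subobject_of C y (prd C r' s') b" for x' a' y' b'
    by (rule subobject_of_eq) (use that T_monic T_factors in \<open>auto simp: mem_subobject_of\<close>)
  moreover have "(x, a) \<in> subobject_of C x (prd C r s) a" "(y, b) \<in> subobject_of C y (prd C r' s') b"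
    using a b by (auto intro: subobject_of_refl)
  ultimately show ?thesis
    unfolding rel_tensor_def T_def by blast
qed

lemma rel_tensor_graph:
  assumes "x \<in> obj C" "y \<in> obj C" "x' \<in> obj C" "y' \<in> obj C" "f \<in> hom C x y" "g \<in> hom C x' y'"
  shows "rel_tensor C x y x' y' (graph C x y f) (graph C x' y' g) = graph C (prd C x x') (prd C y y') (times C x y x' y' f g)"
proof -
  have "times C x x x' x' (idn C x) (idn C x') = idn C (prd C x x')"
    unfolding times_def by (rule into_prd_eqI[of "prd C x x'" x x']) (use assms in auto)
  then show ?thesis
    unfolding graph_def using assms by (simp add: rel_tensor_eq monic_graph)
qed

lemma rel_tensor_cograph:
  assumes "x \<in> obj C" "y \<in> obj C" "x' \<in> obj C" "y' \<in> obj C" "f \<in> hom C x y" "g \<in> hom C x' y'"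
  shows "rel_tensor C y x y' x' (cograph C x y f) (cograph C x' y' g) = cograph C (prd C x x') (prd C y y') (times C x y x' y' f g)"
proof -
  have "times C x x x' x' (idn C x) (idn C x') = idn C (prd C x x')"
    unfolding times_def by (rule into_prd_eqI[of "prd C x x'" x x']) (use assms in auto)
  then show ?thesis
    unfolding cograph_def using assms by (simp add: rel_tensor_eq monic_cograph)
qed

text \<open>This square makes Frobenius reciprocity an instance of Beck--Chevalley: substitution
  along the diagonal of \<open>y\<close> forms meets, and \<open>f \<times> id\<close> acts on one
  argument only.\<close>

lemma pullback_graph_square:
  assumes "x \<in> obj C" "y \<in> obj C" "f \<in> hom C x y"
  shows "pullback C (prd C x y) y (prd C y y) (times C x y y y f (idn C y)) (diag C y)
    x (tuple C x x y (idn C x) f) f"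
  unfolding pullback_def
proof (intro conjI ballI impI)
  show "cmp C x (prd C x y) (prd C y y) (tuple C x x y (idn C x) f) (times C x y y y f (idn C y)) =
      cmp C x y (prd C y y) f (diag C y)"
    using assms by (simp add: tuple_times diag_def cmp_tuple)
  fix w a b
  assume w: "w \<in> obj C" "a \<in> hom C w (prd C x y)" "b \<in> hom C w y"
    and eq: "cmp C w (prd C x y) (prd C y y) a (times C x y y y f (idn C y)) = cmp C w y (prd C y y) b (diag C y)"
  let ?a1 = "cmp C w (prd C x y) x a (pr1 C x y)" and ?a2 = "cmp C w (prd C x y) y a (pr2 C x y)"
  have "cmp C w x y ?a1 f = b" and "?a2 = b"
    using arg_cong[OF eq, of "\<lambda>q. cmp C w (prd C y y) y q (pr1 C y y)"]
      arg_cong[OF eq, of "\<lambda>q. cmp C w (prd C y y) y q (pr2 C y y)"] w assms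
    by (simp_all add: times_def diag_def)
  moreover have "tuple C w x y ?a1 ?a2 = a"
    using w assms by (intro tuple_expand) auto
  ultimately have *: "tuple C w x y ?a1 b = a" "cmp C w x y ?a1 f = b" by simp_all
  show "\<exists>!h. h \<in> hom C w x \<and> cmp C w x (prd C x y) h (tuple C x x y (idn C x) f) = a \<and> cmp C w x y h f = b"
  proof (rule ex1I[of _ ?a1])
    have "cmp C w x (prd C x y) ?a1 (tuple C x x y (idn C x) f) = tuple C w x y ?a1 (cmp C w x y ?a1 f)"
      using w assms by (subst cmp_tuple) (auto simp del: cmp_assoc)
    then show "?a1 \<in> hom C w x \<and> cmp C w x (prd C x y) ?a1 (tuple C x x y (idn C x) f) = a \<and> cmp C w x y ?a1 f = b"
      using * w assms by (simp del: cmp_assoc)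
    fix h assume "h \<in> hom C w x \<and> cmp C w x (prd C x y) h (tuple C x x y (idn C x) f) = a \<and> cmp C w x y h f = b"
    then show "h = ?a1"
      using w(1) assms by auto
  qed
qed (use assms in auto)

text \<open>Under Beck--Chevalley, the trivial kernel pair of a mono makes substitution a left
  inverse of quantification along it.\<close>

lemma pullback_monic:
  assumes "monic C x y m"
  shows "pullback C x x y m m x (idn C x) (idn C x)"
  using assms unfolding monic_def pullback_def
  by (auto intro!: ex1I)

text \<open>For contexts, equalizers are what can be built by hand; together with the products they
  give pullbacks.\<close>

lemma pullback_if_equalizer:
  assumes "x \<in> obj C" "y \<in> obj C" "z \<in> obj C" "f \<in> hom C x z" "g \<in> hom C y z"
    and "p \<in> obj C" "e \<in> hom C p (prd C x y)"
    and eq: "cmp C p (prd C x y) z e (cmp C (prd C x y) x z (pr1 C x y) f) = cmp C p (prd C x y) z e (cmp C (prd C x y) y z (pr2 C x y) g)"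
    and un: "\<And>w h. w \<in> obj C \<Longrightarrow> h \<in> hom C w (prd C x y) \<Longrightarrow>
      cmp C w (prd C x y) z h (cmp C (prd C x y) x z (pr1 C x y) f) = cmp C w (prd C x y) z h (cmp C (prd C x y) y z (pr2 C x y) g) \<Longrightarrow>
      \<exists>!k. k \<in> hom C w p \<and> cmp C w p (prd C x y) k e = h"
  shows "pullback C x y z f g p (cmp C p (prd C x y) x e (pr1 C x y)) (cmp C p (prd C x y) y e (pr2 C x y))"
  unfolding pullback_def
proof (intro conjI ballI impI)
  fix w a b
  assume w: "w \<in> obj C" "a \<in> hom C w x" "b \<in> hom C w y" "cmp C w x z a f = cmp C w y z b g"
  have "\<exists>!k. k \<in> hom C w p \<and> cmp C w p (prd C x y) k e = tuple C w x y a b"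
    by (rule un) (use w assms(1-5) in auto)
  moreover have "(cmp C w p x k (cmp C p (prd C x y) x e (pr1 C x y)) = a \<and> cmp C w p y k (cmp C p (prd C x y) y e (pr2 C x y)) = b)
      \<longleftrightarrow> cmp C w p (prd C x y) k e = tuple C w x y a b" if k: "k \<in> hom C w p" for k
  proof
    assume "cmp C w p x k (cmp C p (prd C x y) x e (pr1 C x y)) = a \<and> cmp C w p y k (cmp C p (prd C x y) y e (pr2 C x y)) = b"
    then show "cmp C w p (prd C x y) k e = tuple C w x y a b"
      by - (rule into_prd_eqI[of w x y], use k w assms(1-7) in auto)
  next
    assume "cmp C w p (prd C x y) k e = tuple C w x y a b"
    then have "cmp C w (prd C x y) x (cmp C w p (prd C x y) k e) (pr1 C x y) = a"
      "cmp C w (prd C x y) y (cmp C w p (prd C x y) k e) (pr2 C x y) = b"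
      using w assms(1-7) by auto
    then show "cmp C w p x k (cmp C p (prd C x y) x e (pr1 C x y)) = a \<and> cmp C w p y k (cmp C p (prd C x y) y e (pr2 C x y)) = b"
      using k w assms(1-7) by simp
  qed
  ultimately show "\<exists>!h. h \<in> hom C w p \<and> cmp C w p x h (cmp C p (prd C x y) x e (pr1 C x y)) = a \<and> cmp C w p y h (cmp C p (prd C x y) y e (pr2 C x y)) = b"
    by metis
qed (use assms in auto)

end

section \<open>The adjunction between a graph and its cograph\<close>

locale regular_fp_category = fp_category C
  for C :: "('o, 'm, 'z) fpcat_scheme" +
  assumes pullback_exists: "\<lbrakk>x \<in> obj C; y \<in> obj C; z \<in> obj C; f \<in> hom C x z; g \<in> hom C y z\<rbrakk>
      \<Longrightarrow> \<exists>p p1 p2. pullback C x y z f g p p1 p2"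
    and image_exists: "\<lbrakk>x \<in> obj C; y \<in> obj C; f \<in> hom C x y\<rbrakk>
      \<Longrightarrow> \<exists>z e m. regular_epi C x z e \<and> monic C z y m \<and> cmp C x z y e m = f"
begin

text \<open>\<open>f\<close> followed by its converse is the kernel pair of \<open>f\<close>, which
  contains the diagonal.\<close>

lemma graph_cograph_unit:
  assumes "x \<in> obj C" "y \<in> obj C" "f \<in> hom C x y"
  shows "rel_comp C x y x (graph C x y f) (cograph C x y f) \<in> subobjects C (prd C x x)"
    and "subobject_le C (prd C x x) (graph C x x (idn C x)) (rel_comp C x y x (graph C x y f) (cograph C x y f))"
proof -
  obtain k k1 k2 where k: "pullback C x x y f f k k1 k2"
    using pullback_exists[OF assms(1,1,2,3,3)] by blast
  have o: "k \<in> obj C" "k1 \<in> hom C k x" "k2 \<in> hom C k x"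
    using k unfolding pullback_def by auto
  obtain d where d: "d \<in> hom C x k" "cmp C x k x d k1 = idn C x" "cmp C x k x d k2 = idn C x"
    using k idn_in_hom[OF assms(1)] assms(1) unfolding pullback_def by blast
  show "rel_comp C x y x (graph C x y f) (cograph C x y f) \<in> subobjects C (prd C x x)"
    unfolding rel_comp_graph_cograph[OF k] by (intro subobject_of_in monic_pullback[OF k])
  have "factors C (prd C x x) (x, tuple C x x x (idn C x) (idn C x)) (k, tuple C k x x k1 k2)"
    unfolding factors_def using d o assms by (auto intro!: bexI[of _ d] simp: cmp_tuple)
  then show "subobject_le C (prd C x x) (graph C x x (idn C x)) (rel_comp C x y x (graph C x y f) (cograph C x y f))"
    unfolding rel_comp_graph_cograph[OF k] unfolding graph_def
    by (intro subobject_le_of monic_pullback[OF k] monic_graph) (use assms in auto)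
qed

text \<open>The converse of \<open>f\<close> followed by \<open>f\<close> is the image of
  \<open>\<langle>f, f\<rangle>\<close>. If \<open>m\<close> is the image of \<open>f\<close>, this
  is \<open>\<langle>m, m\<rangle>\<close>, which factors through the diagonal by
  \<open>m\<close>.\<close>

lemma cograph_graph_counit:
  assumes "x \<in> obj C" "y \<in> obj C" "f \<in> hom C x y"
  shows "rel_comp C y x y (cograph C x y f) (graph C x y f) \<in> subobjects C (prd C y y)"
    and "subobject_le C (prd C y y) (rel_comp C y x y (cograph C x y f) (graph C x y f)) (graph C y y (idn C y))"
proof -
  obtain z e m where em: "regular_epi C x z e" "monic C z y m" "cmp C x z y e m = f"
    using image_exists[OF assms] by blast
  have o: "z \<in> obj C" "m \<in> hom C z y" "e \<in> hom C x z"
    using em unfolding monic_def regular_epi_def coequalizer_def by auto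
  have mm: "monic C z (prd C y y) (tuple C z y y m m)"
    by (rule monic_tupleI) (use em(2) o assms in \<open>auto simp: monic_def\<close>)
  have eq: "rel_comp C y x y (cograph C x y f) (graph C x y f) = subobject_of C z (prd C y y) (tuple C z y y m m)"
    by (rule rel_comp_cograph_graph[OF _ _ _ _ _ _ em(1) mm]) (use o assms em(3) in \<open>auto simp: cmp_tuple\<close>)
  show "rel_comp C y x y (cograph C x y f) (graph C x y f) \<in> subobjects C (prd C y y)"
    unfolding eq by (intro subobject_of_in mm)
  have "factors C (prd C y y) (z, tuple C z y y m m) (y, tuple C y y y (idn C y) (idn C y))"
    unfolding factors_def using o assms by (auto intro!: bexI[of _ m] simp: cmp_tuple)
  then show "subobject_le C (prd C y y) (rel_comp C y x y (cograph C x y f) (graph C x y f)) (graph C y y (idn C y))"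
    unfolding eq unfolding graph_def
    by (intro subobject_le_of mm monic_graph) (use assms in auto)
qed

end

section \<open>The category of contexts\<close>

lemma FRg_obj_iff [simp]: "(ts, S) \<in> obj (FRg T) \<longleftrightarrow> finite S \<and> S \<subseteq> T \<and> set ts \<subseteq> S"
  unfolding FRg_def by simp

lemma FRg_hom_iff [simp]: "f \<in> hom (FRg T) (ts, S) (ts', S') \<longleftrightarrow>
    S' \<subseteq> S \<and> f \<in> {..<length ts'} \<rightarrow>\<^sub>E {..<length ts} \<and> (\<forall>i<length ts'. ts ! f i = ts' ! i)"
  unfolding FRg_def by simp

lemma FRg_cmp [simp]: "cmp (FRg T) x y (ts, S) f g = compose {..<length ts} f g"
  unfolding FRg_def by simp

lemma FRg_idn [simp]: "idn (FRg T) (ts, S) = restrict id {..<length ts}"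
  unfolding FRg_def by simp

lemma FRg_prd [simp]:
  "one (FRg T) = ([], {})"
  "prd (FRg T) (ts, S) (ts', S') = (ts @ ts', S \<union> S')"
  "pr1 (FRg T) (ts, S) x = (\<lambda>i\<in>{..<length ts}. i)"
  "pr2 (FRg T) (ts, S) (ts', S') = (\<lambda>i\<in>{..<length ts'}. length ts + i)"
  unfolding FRg_def by simp_all

lemma category_FRg: "category (FRg T)"
proof
  fix x assume "x \<in> obj (FRg T)"
  then show "idn (FRg T) x \<in> hom (FRg T) x x"
    by (cases x) auto
next
  fix x y z f g
  assume "f \<in> hom (FRg T) x y" "g \<in> hom (FRg T) y z"
  then show "cmp (FRg T) x y z f g \<in> hom (FRg T) x z"
    by (cases x; cases y; cases z) (auto simp: compose_def PiE_iff)
next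
  fix x y f
  assume "f \<in> hom (FRg T) x y"
  then show "cmp (FRg T) x x y (idn (FRg T) x) f = f"
    by (cases x; cases y) (auto simp: compose_def PiE_iff fun_eq_iff extensional_def)
next
  fix x y f
  assume "f \<in> hom (FRg T) x y"
  then show "cmp (FRg T) x y y f (idn (FRg T) y) = f"
    by (cases x; cases y) (auto simp: compose_def PiE_iff fun_eq_iff extensional_def)
next
  fix w x y z f g h
  assume "f \<in> hom (FRg T) w x" "g \<in> hom (FRg T) x y" "h \<in> hom (FRg T) y z"
  then show "cmp (FRg T) w y z (cmp (FRg T) w x y f g) h = cmp (FRg T) w x z f (cmp (FRg T) x y z g h)"
    by (cases w; cases x; cases y; cases z) (auto simp: compose_def PiE_iff fun_eq_iff)
qed

text \<open>Functions point against the morphisms, so a tuple of morphisms is the copairing of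
  functions on concatenated lists. Uniqueness is stated for every extensional \<open>k\<close>, so
  that it also identifies the value of \<open>tuple\<close>.\<close>

lemma FRg_tuple_universal:
  assumes "f \<in> hom (FRg T) (tw, W) (ts, S)" "g \<in> hom (FRg T) (tw, W) (ts', S')"
  defines "h \<equiv> \<lambda>i\<in>{..<length ts + length ts'}. if i < length ts then f i else g (i - length ts)"
  shows "h \<in> hom (FRg T) (tw, W) (ts @ ts', S \<union> S')"
    and "compose {..<length ts} h (\<lambda>i\<in>{..<length ts}. i) = f"
    and "compose {..<length ts'} h (\<lambda>i\<in>{..<length ts'}. length ts + i) = g"
    and "\<And>k. k \<in> extensional {..<length ts + length ts'} \<Longrightarrow>
      compose {..<length ts} k (\<lambda>i\<in>{..<length ts}. i) = f \<Longrightarrow>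
      compose {..<length ts'} k (\<lambda>i\<in>{..<length ts'}. length ts + i) = g \<Longrightarrow> k = h"
proof -
  show "h \<in> hom (FRg T) (tw, W) (ts @ ts', S \<union> S')"
    using assms(1,2) by (auto simp: h_def PiE_iff nth_append)
  show "compose {..<length ts} h (\<lambda>i\<in>{..<length ts}. i) = f"
    using assms(1) by (auto simp: h_def compose_def PiE_iff fun_eq_iff extensional_def)
  show "compose {..<length ts'} h (\<lambda>i\<in>{..<length ts'}. length ts + i) = g"
    using assms(2) by (auto simp: h_def compose_def PiE_iff fun_eq_iff extensional_def)
  fix k assume k: "k \<in> extensional {..<length ts + length ts'}"
    "compose {..<length ts} k (\<lambda>i\<in>{..<length ts}. i) = f"
    "compose {..<length ts'} k (\<lambda>i\<in>{..<length ts'}. length ts + i) = g"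
  show "k = h"
  proof
    fix i
    consider "i < length ts" | "\<not> i < length ts" "i < length ts + length ts'" | "\<not> i < length ts + length ts'"
      by linarith
    then show "k i = h i"
    proof cases
      case 1
      then show ?thesis using fun_cong[OF k(2), of i] by (simp add: h_def compose_def)
    next
      case 2
      then obtain j where "i = length ts + j" "j < length ts'"
        by (metis add_less_cancel_left le_Suc_ex not_less)
      then show ?thesis using fun_cong[OF k(3), of j] by (simp add: h_def compose_def)
    next
      case 3
      then show ?thesis using k(1) by (simp add: h_def extensional_def)
    qed
  qed
qed

lemma fp_category_FRg: "fp_category (FRg T)"
proof -
  interpret category "FRg T" by (rule category_FRg)
  show ?thesis
  proof
    fix x assume "x \<in> obj (FRg T)"
    show "\<exists>!h. h \<in> hom (FRg T) x (one (FRg T))"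
      by (cases x) auto
  next
    fix z x y f g
    assume f: "f \<in> hom (FRg T) z x" and g: "g \<in> hom (FRg T) z y"
    obtain tw W ts S ts' S' where [simp]: "z = (tw, W)" "x = (ts, S)" "y = (ts', S')"
      by (cases z; cases x; cases y) auto
    let ?h = "\<lambda>i\<in>{..<length ts + length ts'}. if i < length ts then f i else g (i - length ts)"
    have f': "f \<in> hom (FRg T) (tw, W) (ts, S)" and g': "g \<in> hom (FRg T) (tw, W) (ts', S')"
      using f g by auto
    note u = FRg_tuple_universal[OF f' g']
    show "\<exists>!h. h \<in> hom (FRg T) z (prd (FRg T) x y) \<and>
        cmp (FRg T) z (prd (FRg T) x y) x h (pr1 (FRg T) x y) = f \<and>
        cmp (FRg T) z (prd (FRg T) x y) y h (pr2 (FRg T) x y) = g"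
    proof (rule ex1I[of _ ?h])
      fix k assume "k \<in> hom (FRg T) z (prd (FRg T) x y) \<and>
        cmp (FRg T) z (prd (FRg T) x y) x k (pr1 (FRg T) x y) = f \<and>
        cmp (FRg T) z (prd (FRg T) x y) y k (pr2 (FRg T) x y) = g"
      then show "k = ?h" by (intro u(4)) (auto simp: PiE_iff)
    qed (use u in simp)
  next
    fix x y assume "x \<in> obj (FRg T)" "y \<in> obj (FRg T)"
    then show "prd (FRg T) x y \<in> obj (FRg T)" "pr1 (FRg T) x y \<in> hom (FRg T) (prd (FRg T) x y) x"
      "pr2 (FRg T) x y \<in> hom (FRg T) (prd (FRg T) x y) y"
      by (cases x; cases y; auto simp: nth_append)+
  qed simp
qed

lemma FRg_tuple:
  assumes "f \<in> hom (FRg T) z (ts, S)" "g \<in> hom (FRg T) z (ts', S')"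
    "z \<in> obj (FRg T)" "(ts, S) \<in> obj (FRg T)" "(ts', S') \<in> obj (FRg T)"
  shows "tuple (FRg T) z (ts, S) (ts', S') f g =
    (\<lambda>i\<in>{..<length ts + length ts'}. if i < length ts then f i else g (i - length ts))"
proof -
  interpret fp_category "FRg T" by (rule fp_category_FRg)
  obtain tw W where z [simp]: "z = (tw, W)" by (cases z)
  note u = FRg_tuple_universal[OF assms(1,2)[unfolded z]]
  have "tuple (FRg T) z (ts, S) (ts', S') f g \<in> hom (FRg T) z (prd (FRg T) (ts, S) (ts', S'))"
    using assms by (intro tuple_hom) auto
  moreover have "cmp (FRg T) z (prd (FRg T) (ts, S) (ts', S')) (ts, S) (tuple (FRg T) z (ts, S) (ts', S') f g) (pr1 (FRg T) (ts, S) (ts', S')) = f"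
    "cmp (FRg T) z (prd (FRg T) (ts, S) (ts', S')) (ts', S') (tuple (FRg T) z (ts, S) (ts', S') f g) (pr2 (FRg T) (ts, S) (ts', S')) = g"
    using assms by (intro tuple_pr1 tuple_pr2; simp)+
  ultimately show ?thesis
    by (intro u(4)) (auto simp: PiE_iff)
qed

text \<open>Contexts number their positions, so a quotient of positions has to be renumbered:
  \<open>q\<close> projects onto \<open>K\<close> classes and \<open>s\<close> picks a
  representative of each.\<close>

lemma finite_quotient:
  fixes n :: nat
  assumes "equiv {..<n} r"
  obtains K :: nat and q s where "q \<in> {..<n} \<rightarrow> {..<K}" "s \<in> {..<K} \<rightarrow> {..<n}" "\<And>k. k < K \<Longrightarrow> q (s k) = k"
    "\<And>i j. i < n \<Longrightarrow> j < n \<Longrightarrow> q i = q j \<longleftrightarrow> (i, j) \<in> r"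
proof -
  have "finite ({..<n} // r)"
    using assms by (intro finite_quotient) (auto simp: equiv_def)
  then obtain b where b: "bij_betw b ({..<n} // r) {..<card ({..<n} // r)}"
    using ex_bij_betw_finite_nat[of "{..<n} // r"] by (auto simp: atLeast0LessThan)
  let ?K = "card ({..<n} // r)" and ?q = "\<lambda>i. b (r `` {i})"
  have "\<exists>i<n. ?q i = k" if "k < ?K" for k
  proof -
    obtain X where "X \<in> {..<n} // r" "b X = k"
      using b \<open>k < ?K\<close> unfolding bij_betw_def by (metis imageE lessThan_iff)
    then show ?thesis by (auto elim: quotientE)
  qed
  then obtain s where "\<And>k. k < ?K \<Longrightarrow> s k < n \<and> ?q (s k) = k" by metis
  moreover have "?q i = ?q j \<longleftrightarrow> (i, j) \<in> r" if "i < n" "j < n" for i j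
  proof -
    have "?q i = ?q j \<longleftrightarrow> r `` {i} = r `` {j}"
      using inj_on_eq_iff[OF bij_betw_imp_inj_on[OF b]] that by (simp add: quotientI)
    then show ?thesis using eq_equiv_class_iff[OF assms] that by simp
  qed
  moreover have "?q \<in> {..<n} \<rightarrow> {..<?K}"
    using b by (auto simp: bij_betw_def intro!: quotientI)
  ultimately show ?thesis by (intro that[of ?q ?K s]) auto
qed

text \<open>As functions point backwards, an equalizer of contexts is a coequalizer of position
  maps: the positions of \<open>x\<close> are divided by the identifications of \<open>u k\<close>
  with \<open>v k\<close>, and the sorts \<open>S\<close> are kept.\<close>

lemma FRg_equalizer:
  assumes x: "x \<in> obj (FRg T)" and y: "y \<in> obj (FRg T)"
    and u: "u \<in> hom (FRg T) x y" and v: "v \<in> hom (FRg T) x y"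
  obtains p e where "p \<in> obj (FRg T)" "e \<in> hom (FRg T) p x" "cmp (FRg T) p x y e u = cmp (FRg T) p x y e v"
    "\<And>w h. h \<in> hom (FRg T) w x \<Longrightarrow> cmp (FRg T) w x y h u = cmp (FRg T) w x y h v \<Longrightarrow>
      \<exists>!k. k \<in> hom (FRg T) w p \<and> cmp (FRg T) w p x k e = h"
proof -
  obtain ts S ts' S' where [simp]: "x = (ts, S)" "y = (ts', S')" by (cases x; cases y) auto
  let ?n = "length ts" and ?m = "length ts'"
  \<comment> \<open>The relation is given by its universal property instead of a generated closure:
    any function merging each \<open>u k\<close> with \<open>v k\<close> merges related positions by
    definition. The clause on types lets a class inherit a type; it holds for \<open>u k\<close> and
    \<open>v k\<close>, both of type \<open>ts' ! k\<close>.\<close>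
  define r where "r = {(i, j). i < ?n \<and> j < ?n \<and> ts ! i = ts ! j \<and>
    (\<forall>h::nat \<Rightarrow> nat. (\<forall>k<?m. h (u k) = h (v k)) \<longrightarrow> h i = h j)}"
  have "equiv {..<?n} r"
  proof (rule equivI)
    show "sym r" unfolding sym_def r_def by clarsimp metis
    show "trans r" unfolding trans_def r_def by clarsimp metis
  qed (auto simp: r_def refl_on_def)
  then obtain K :: nat and q s where q: "q \<in> {..<?n} \<rightarrow> {..<K}" and s: "s \<in> {..<K} \<rightarrow> {..<?n}"
    and qs: "\<And>k. k < K \<Longrightarrow> q (s k) = k" and qr: "\<And>i j. i < ?n \<Longrightarrow> j < ?n \<Longrightarrow> q i = q j \<longleftrightarrow> (i, j) \<in> r"
    by (rule finite_quotient) blast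
  have sq: "(s (q i), i) \<in> r" if "i < ?n" for i
    using that q s qs[of "q i"] qr[of "s (q i)" i] by auto
  let ?p = "(map (\<lambda>k. ts ! s k) [0..<K], S)" and ?e = "restrict q {..<?n}"
  show ?thesis
  proof (rule that[of ?p ?e])
    show "?p \<in> obj (FRg T)"
      using x s by (auto simp: subset_iff Pi_iff)
    show "?e \<in> hom (FRg T) ?p x"
      using q sq by (auto simp: r_def Pi_iff)
    show "cmp (FRg T) ?p x y ?e u = cmp (FRg T) ?p x y ?e v"
    proof -
      have "q (u k) = q (v k)" if "k < ?m" for k
        using u v that by (subst qr) (auto simp: r_def PiE_iff)
      then show ?thesis
        using u v by (auto simp: compose_def fun_eq_iff PiE_iff)
    qed
    fix w h
    assume h: "h \<in> hom (FRg T) w x" and eq: "cmp (FRg T) w x y h u = cmp (FRg T) w x y h v"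
    obtain tw W where [simp]: "w = (tw, W)" by (cases w)
    have "h (u k) = h (v k)" if "k < ?m" for k
      using fun_cong[OF eq, of k] that by (simp add: compose_def)
    then have hsq: "h (s (q i)) = h i" if "i < ?n" for i
      using sq[OF that] unfolding r_def by blast
    show "\<exists>!k. k \<in> hom (FRg T) w ?p \<and> cmp (FRg T) w ?p x k ?e = h"
    proof (rule ex1I[of _ "\<lambda>j\<in>{..<K}. h (s j)"])
      show "(\<lambda>j\<in>{..<K}. h (s j)) \<in> hom (FRg T) w ?p \<and> cmp (FRg T) w ?p x (\<lambda>j\<in>{..<K}. h (s j)) ?e = h"
        using h s q hsq by (auto simp: PiE_iff Pi_iff compose_def fun_eq_iff extensional_def)
      fix k assume k: "k \<in> hom (FRg T) w ?p \<and> cmp (FRg T) w ?p x k ?e = h"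
      show "k = (\<lambda>j\<in>{..<K}. h (s j))"
      proof
        fix j show "k j = (\<lambda>j\<in>{..<K}. h (s j)) j"
          using k s qs[of j] by (auto simp: PiE_iff Pi_iff compose_def extensional_def)
      qed
    qed
  qed
qed

text \<open>A morphism is factored through the range of its function: \<open>?e\<close> is the
  inclusion of the range, with unchanged sorts, and \<open>?m'\<close> the corestriction onto it.
  The latter is surjective on positions, hence monic as a morphism.\<close>

lemma FRg_image:
  assumes x: "x \<in> obj (FRg T)" and y: "y \<in> obj (FRg T)" and f: "f \<in> hom (FRg T) x y"
  shows "\<exists>z e m. regular_epi (FRg T) x z e \<and> monic (FRg T) z y m \<and> cmp (FRg T) x z y e m = f"
proof -
  obtain ts S ts' S' where [simp]: "x = (ts, S)" "y = (ts', S')" by (cases x; cases y) auto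
  let ?n = "length ts" and ?m = "length ts'"
  let ?R = "f ` {..<?m}"
  obtain b where b: "bij_betw b {..<card ?R} ?R"
    using ex_bij_betw_nat_finite[of ?R] by (auto simp: atLeast0LessThan)
  let ?K = "card ?R" and ?c = "the_inv_into {..<card ?R} b"
  have fn: "f i < ?n" "ts ! f i = ts' ! i" if "i < ?m" for i using f that by auto
  have bR: "b k \<in> ?R" if "k < ?K" for k using b that by (auto simp: bij_betw_def)
  then have bn: "b k < ?n" if "k < ?K" for k using that fn by fastforce
  have cb: "?c (b k) = k" if "k < ?K" for k
    using b that by (auto simp: bij_betw_def the_inv_into_f_f)
  have bc: "b (?c i) = i" and cK: "?c i < ?K" if "i \<in> ?R" for i
    using b that f_the_inv_into_f[of b "{..<?K}" i] the_inv_into_into[of b "{..<?K}" i "{..<?K}"]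
    by (auto simp: bij_betw_def)
  let ?z = "(map (\<lambda>k. ts ! b k) [0..<?K], S)"
  let ?e = "restrict b {..<?K}" and ?m' = "\<lambda>i\<in>{..<?m}. ?c (f i)"
  \<comment> \<open>The pair coequalized by \<open>?e\<close> doubles the context: \<open>?u\<close>
    and \<open>?v\<close> agree on positions in the range and send every other position to different
    copies. A function on which they agree therefore takes its values in the range.\<close>
  let ?w = "(ts @ ts, S)" and ?u = "\<lambda>i\<in>{..<?n}. i" and ?v = "\<lambda>i\<in>{..<?n}. if i \<in> ?R then i else ?n + i"
  have z: "?z \<in> obj (FRg T)" using x bn by (auto simp: subset_iff)
  have e: "?e \<in> hom (FRg T) x ?z" using bn by auto
  have "coequalizer (FRg T) ?w x ?u ?v ?z ?e"
    unfolding coequalizer_def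
  proof (intro conjI ballI impI)
    show "?u \<in> hom (FRg T) ?w x" "?v \<in> hom (FRg T) ?w x"
      by (auto simp: nth_append)
    show "cmp (FRg T) ?w x ?z ?u ?e = cmp (FRg T) ?w x ?z ?v ?e"
      using bn bR by (auto simp: compose_def fun_eq_iff)
    fix w g assume "w \<in> obj (FRg T)" and g: "g \<in> hom (FRg T) x w"
      and eq: "cmp (FRg T) ?w x w ?u g = cmp (FRg T) ?w x w ?v g"
    obtain tw W where [simp]: "w = (tw, W)" by (cases w)
    have gR: "g i \<in> ?R" if "i < length tw" for i
    proof -
      have "g i < ?n" using g that by auto
      then show ?thesis
        using fun_cong[OF eq, of i] that by (auto simp: compose_def split: if_splits)
    qed
    show "\<exists>!h. h \<in> hom (FRg T) ?z w \<and> cmp (FRg T) x ?z w ?e h = g"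
    proof (rule ex1I[of _ "\<lambda>i\<in>{..<length tw}. ?c (g i)"])
      show "(\<lambda>i\<in>{..<length tw}. ?c (g i)) \<in> hom (FRg T) ?z w \<and> cmp (FRg T) x ?z w ?e (\<lambda>i\<in>{..<length tw}. ?c (g i)) = g"
        using g gR cK bc by (auto simp: compose_def fun_eq_iff PiE_iff extensional_def)
      fix h assume h: "h \<in> hom (FRg T) ?z w \<and> cmp (FRg T) x ?z w ?e h = g"
      show "h = (\<lambda>i\<in>{..<length tw}. ?c (g i))"
      proof
        fix i show "h i = (\<lambda>i\<in>{..<length tw}. ?c (g i)) i"
          using h cb[of "h i"] by (auto simp: PiE_iff compose_def extensional_def)
      qed
    qed
  qed (use x z e in auto)
  moreover have "monic (FRg T) ?z y ?m'"
    unfolding monic_def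
  proof (intro conjI ballI impI)
    show "?m' \<in> hom (FRg T) ?z y"
      using f cK bc fn(2) by auto
    fix w a a'
    assume a: "a \<in> hom (FRg T) w ?z" and a': "a' \<in> hom (FRg T) w ?z"
      and eq: "cmp (FRg T) w ?z y a ?m' = cmp (FRg T) w ?z y a' ?m'"
    obtain tw W where [simp]: "w = (tw, W)" by (cases w)
    show "a = a'"
    proof
      fix k
      show "a k = a' k"
      proof (cases "k < ?K")
        case True
        then obtain i where i: "i < ?m" "b k = f i" using bR by auto
        then have "?c (f i) = k" using cb[OF True] by simp
        then show ?thesis using fun_cong[OF eq, of i] i(1) by (simp add: compose_def)
      qed (use a a' in \<open>auto simp: PiE_iff extensional_def\<close>)
    qed
  qed (use z y in auto)
  moreover have "cmp (FRg T) x ?z y ?e ?m' = f"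
    using f bc cK by (auto simp: compose_def fun_eq_iff PiE_iff extensional_def)
  ultimately show ?thesis unfolding regular_epi_def by blast
qed

lemma regular_fp_category_FRg: "regular_fp_category (FRg T)"
proof -
  interpret fp_category "FRg T" by (rule fp_category_FRg)
  show ?thesis
  proof
    fix x y z f g
    assume o: "x \<in> obj (FRg T)" "y \<in> obj (FRg T)" "z \<in> obj (FRg T)" "f \<in> hom (FRg T) x z" "g \<in> hom (FRg T) y z"
    let ?xy = "prd (FRg T) x y"
    obtain p e where "p \<in> obj (FRg T)" "e \<in> hom (FRg T) p ?xy"
      "cmp (FRg T) p ?xy z e (cmp (FRg T) ?xy x z (pr1 (FRg T) x y) f) =
        cmp (FRg T) p ?xy z e (cmp (FRg T) ?xy y z (pr2 (FRg T) x y) g)"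
      "\<And>w h. h \<in> hom (FRg T) w ?xy \<Longrightarrow>
        cmp (FRg T) w ?xy z h (cmp (FRg T) ?xy x z (pr1 (FRg T) x y) f) =
        cmp (FRg T) w ?xy z h (cmp (FRg T) ?xy y z (pr2 (FRg T) x y) g) \<Longrightarrow>
        \<exists>!k. k \<in> hom (FRg T) w p \<and> cmp (FRg T) w p ?xy k e = h"
      using FRg_equalizer[of ?xy T z "cmp (FRg T) ?xy x z (pr1 (FRg T) x y) f" "cmp (FRg T) ?xy y z (pr2 (FRg T) x y) g"] o
      by (metis cmp_in_hom pr1_hom pr2_hom prd_obj)
    from pullback_if_equalizer[OF o this]
    show "\<exists>p p1 p2. pullback (FRg T) x y z f g p p1 p2" by blast
  next
    fix x y f
    assume "x \<in> obj (FRg T)" "y \<in> obj (FRg T)" "f \<in> hom (FRg T) x y"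
    then show "\<exists>z e m. regular_epi (FRg T) x z e \<and> monic (FRg T) z y m \<and> cmp (FRg T) x z y e m = f"
      by (rule FRg_image)
  qed
qed

section \<open>Regular calculi as hyperdoctrines\<close>

lemma Rel_simps [simp]:
  "obj (Rel C) = obj C" "hom (Rel C) x y = subobjects C (prd C x y)" "cmp (Rel C) = rel_comp C"
  "idn (Rel C) x = graph C x x (idn C x)" "leq (Rel C) x y = subobject_le C (prd C x y)"
  "munit (Rel C) = one C" "tens (Rel C) = prd C" "tensm (Rel C) = rel_tensor C"
  "mrunit (Rel C) x = graph C (prd C x (one C)) x (pr1 C x (one C))"
  unfolding Rel_def by simp_all

locale doctrine = regular_fp_category C + ajax_po_functor "Rel C" P
  for C :: "('o, 'm, 'z) fpcat_scheme" and P :: "('o, ('o \<times> 'm) set, 'p, 'y) lax_data_scheme"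
begin

abbreviation pred :: "'o \<Rightarrow> 'p set"
  where "pred x \<equiv> Field (ob P x)"

text \<open>\<open>pb\<close> is substitution \<open>f^*\<close>; \<open>im\<close> below is
  existential quantification \<open>f_!\<close>.\<close>

definition pb :: "'o \<Rightarrow> 'o \<Rightarrow> 'm \<Rightarrow> 'p \<Rightarrow> 'p"
  where "pb x y f = mor P y x (cograph C x y f)"

definition im :: "'o \<Rightarrow> 'o \<Rightarrow> 'm \<Rightarrow> 'p \<Rightarrow> 'p"
  where "im x y f = mor P x y (graph C x y f)"

lemma le_pred: "(a, b) \<in> ob P x \<Longrightarrow> a \<in> pred x" "(a, b) \<in> ob P x \<Longrightarrow> b \<in> pred x"
  by (auto intro: FieldI1 FieldI2)

lemma ob_order: "x \<in> obj C \<Longrightarrow> Partial_order (ob P x)"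
  using po_functor unfolding po_functor_def is_functor_def Poset_def by auto

lemma le_refl [simp]: "x \<in> obj C \<Longrightarrow> a \<in> pred x \<Longrightarrow> (a, a) \<in> ob P x"
  using ob_order unfolding order_on_defs refl_on_def by blast

lemma le_trans: "x \<in> obj C \<Longrightarrow> (a, b) \<in> ob P x \<Longrightarrow> (b, c) \<in> ob P x \<Longrightarrow> (a, c) \<in> ob P x"
  using ob_order unfolding order_on_defs by (meson transD)

lemma le_antisym: "x \<in> obj C \<Longrightarrow> (a, b) \<in> ob P x \<Longrightarrow> (b, a) \<in> ob P x \<Longrightarrow> a = b"
  using ob_order unfolding order_on_defs by (meson antisymD)

lemma mor_monotone:
  assumes "x \<in> obj C" "y \<in> obj C" "A \<in> subobjects C (prd C x y)"
  shows "monotone_map (ob P x) (ob P y) (mor P x y A)"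
  using po_functor assms unfolding po_functor_def is_functor_def Poset_def by auto

lemma mor_idn: "x \<in> obj C \<Longrightarrow> a \<in> pred x \<Longrightarrow> mor P x x (graph C x x (idn C x)) a = a"
  using po_functor unfolding po_functor_def is_functor_def Poset_def by auto

lemma mor_comp:
  assumes "x \<in> obj C" "y \<in> obj C" "z \<in> obj C" "A \<in> subobjects C (prd C x y)" "B \<in> subobjects C (prd C y z)" "a \<in> pred x"
  shows "mor P x z (rel_comp C x y z A B) a = mor P y z B (mor P x y A a)"
proof -
  have "mor P x z (rel_comp C x y z A B) = compose (pred x) (mor P y z B) (mor P x y A)"
    using po_functor assms unfolding po_functor_def is_functor_def Poset_def by auto
  then show ?thesis using assms(6) by (simp add: compose_def)
qed

lemma mor_le:
  assumes "x \<in> obj C" "y \<in> obj C" "A \<in> subobjects C (prd C x y)" "B \<in> subobjects C (prd C x y)"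
    "subobject_le C (prd C x y) A B" "a \<in> pred x"
  shows "(mor P x y A a, mor P x y B a) \<in> ob P y"
  using po_functor assms unfolding po_functor_def is_functor_def Poset_def by auto

lemma pb_pred [simp]: "x \<in> obj C \<Longrightarrow> y \<in> obj C \<Longrightarrow> f \<in> hom C x y \<Longrightarrow> a \<in> pred y \<Longrightarrow> pb x y f a \<in> pred x"
  using mor_monotone[of y x "cograph C x y f"] unfolding pb_def monotone_map_def by auto

lemma im_pred [simp]: "x \<in> obj C \<Longrightarrow> y \<in> obj C \<Longrightarrow> f \<in> hom C x y \<Longrightarrow> a \<in> pred x \<Longrightarrow> im x y f a \<in> pred y"
  using mor_monotone[of x y "graph C x y f"] unfolding im_def monotone_map_def by auto

lemma pb_mono: "x \<in> obj C \<Longrightarrow> y \<in> obj C \<Longrightarrow> f \<in> hom C x y \<Longrightarrow> (a, b) \<in> ob P y \<Longrightarrow> (pb x y f a, pb x y f b) \<in> ob P x"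
  using mor_monotone[of y x "cograph C x y f"] unfolding pb_def monotone_map_def by auto

lemma im_mono: "x \<in> obj C \<Longrightarrow> y \<in> obj C \<Longrightarrow> f \<in> hom C x y \<Longrightarrow> (a, b) \<in> ob P x \<Longrightarrow> (im x y f a, im x y f b) \<in> ob P y"
  using mor_monotone[of x y "graph C x y f"] unfolding im_def monotone_map_def by auto

lemma pb_idn: "x \<in> obj C \<Longrightarrow> a \<in> pred x \<Longrightarrow> pb x x (idn C x) a = a"
  unfolding pb_def cograph_idn by (rule mor_idn)

lemma im_idn: "x \<in> obj C \<Longrightarrow> a \<in> pred x \<Longrightarrow> im x x (idn C x) a = a"
  unfolding im_def by (rule mor_idn)

lemma pb_cmp:
  assumes "x \<in> obj C" "y \<in> obj C" "z \<in> obj C" "f \<in> hom C x y" "g \<in> hom C y z" "a \<in> pred z"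
  shows "pb x z (cmp C x y z f g) a = pb x y f (pb y z g a)"
  unfolding pb_def rel_comp_cograph_cograph[OF assms(1-5), symmetric] by (rule mor_comp) (use assms in auto)

lemma im_pb_unit:
  assumes "x \<in> obj C" "y \<in> obj C" "f \<in> hom C x y" "a \<in> pred x"
  shows "(a, pb x y f (im x y f a)) \<in> ob P x"
proof -
  have "(mor P x x (graph C x x (idn C x)) a, mor P x x (rel_comp C x y x (graph C x y f) (cograph C x y f)) a) \<in> ob P x"
    by (rule mor_le) (use assms graph_cograph_unit in auto)
  then show ?thesis using assms unfolding pb_def im_def by (simp add: mor_idn mor_comp)
qed

lemma im_pb_counit:
  assumes "x \<in> obj C" "y \<in> obj C" "f \<in> hom C x y" "b \<in> pred y"
  shows "(im x y f (pb x y f b), b) \<in> ob P y"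
proof -
  have "(mor P y y (rel_comp C y x y (cograph C x y f) (graph C x y f)) b, mor P y y (graph C y y (idn C y)) b) \<in> ob P y"
    by (rule mor_le) (use assms cograph_graph_counit in auto)
  then show ?thesis using assms unfolding pb_def im_def by (simp add: mor_idn mor_comp)
qed

text \<open>The functor preserves order and composites, so it turns the adjunction between a graph
  and its cograph into one between \<open>im\<close> and \<open>pb\<close>.\<close>

lemma im_le_iff:
  assumes "x \<in> obj C" "y \<in> obj C" "f \<in> hom C x y" "a \<in> pred x" "b \<in> pred y"
  shows "(im x y f a, b) \<in> ob P y \<longleftrightarrow> (a, pb x y f b) \<in> ob P x"
proof
  assume "(im x y f a, b) \<in> ob P y"
  then show "(a, pb x y f b) \<in> ob P x"
    using assms by (blast intro: le_trans[OF _ im_pb_unit] pb_mono)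
next
  assume "(a, pb x y f b) \<in> ob P x"
  then show "(im x y f a, b) \<in> ob P y"
    using assms by (blast intro: le_trans[OF _ _ im_pb_counit] im_mono)
qed

lemma Beck_Chevalley:
  assumes "pullback C x y z f g p p1 p2" "a \<in> pred x"
  shows "pb y z g (im x z f a) = im p y p2 (pb p x p1 a)"
proof -
  have "x \<in> obj C" "y \<in> obj C" "z \<in> obj C" "p \<in> obj C" "f \<in> hom C x z" "g \<in> hom C y z" "p1 \<in> hom C p x" "p2 \<in> hom C p y"
    using assms unfolding pullback_def by auto
  then show ?thesis
    using arg_cong[OF rel_comp_Beck_Chevalley[OF assms(1)], of "\<lambda>A. mor P x y A a"] assms(2)
    unfolding pb_def im_def by (simp add: mor_comp)
qed

lemma pb_im_monic:
  assumes "monic C x y m" "a \<in> pred x"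
  shows "pb x y m (im x y m a) = a"
  using Beck_Chevalley[OF pullback_monic[OF assms(1)] assms(2)] assms
  by (simp add: im_idn pb_idn monic_def)

text \<open>A right adjoint out of the one-point poset picks out a greatest element.\<close>

lemma lax0_top: "a \<in> pred (one C) \<Longrightarrow> (a, lax0 P ()) \<in> ob P (one C)" and lax0_pred: "lax0 P () \<in> pred (one C)"
  using lax0_right_adjoint unfolding is_right_adjoint_map_def monotone_map_def unit_order_def
  by (auto simp: Field_def)

lemma Field_product_order [simp]: "Field (product_order r s) = Field r \<times> Field s" 
  if "Partial_order r" "Partial_order s"
proof -
  have "refl_on (Field r) r" "refl_on (Field s) s" using that by (auto simp: order_on_defs)
  then have "((a, b), (a, b)) \<in> product_order r s" if "a \<in> Field r" "b \<in> Field s" for a b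
    using that unfolding product_order_def refl_on_def by blast
  then show ?thesis
    by (auto intro: FieldI1) (auto simp: Field_def product_order_def)
qed

lemma lax_pred [simp]:
  assumes "x \<in> obj C" "y \<in> obj C" "a \<in> pred x" "b \<in> pred y"
  shows "lax P x y (a, b) \<in> pred (prd C x y)"
  using lax_monotone[of x y] assms unfolding monotone_map_def by (auto simp: ob_order)

text \<open>The left adjoint \<open>L\<close> of the laxator sends \<open>c\<close> below
  \<open>(a, b')\<close> and below \<open>(a', b)\<close>. Taking the first component from one bound
  and the second from the other puts \<open>L c\<close> below \<open>(a, b)\<close>. With
  \<open>a'\<close> and \<open>b'\<close> greatest, this is preservation of a binary meet.\<close>

lemma lax_le_cases:
  assumes "x \<in> obj C" "y \<in> obj C" "a \<in> pred x" "b \<in> pred y" "a' \<in> pred x" "b' \<in> pred y"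
    and "(c, lax P x y (a, b')) \<in> ob P (prd C x y)" "(c, lax P x y (a', b)) \<in> ob P (prd C x y)"
  shows "(c, lax P x y (a, b)) \<in> ob P (prd C x y)"
proof -
  let ?pr = "product_order (ob P x) (ob P y)"
  obtain L where Lm: "monotone_map (ob P (prd C x y)) ?pr L"
    and un: "\<And>c. c \<in> pred (prd C x y) \<Longrightarrow> (c, lax P x y (L c)) \<in> ob P (prd C x y)"
    and co: "\<And>q. q \<in> Field ?pr \<Longrightarrow> (L (lax P x y q), q) \<in> ?pr"
    using lax_right_adjoint[of x y] assms(1,2) unfolding is_right_adjoint_map_def by auto
  have "(L c, L (lax P x y (a, b'))) \<in> ?pr" "(L c, L (lax P x y (a', b))) \<in> ?pr"
    using Lm assms(7,8) unfolding monotone_map_def by auto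
  moreover have "(L (lax P x y (a, b')), (a, b')) \<in> ?pr" "(L (lax P x y (a', b)), (a', b)) \<in> ?pr"
    using assms by (intro co; simp add: ob_order)+
  ultimately have "(L c, (a, b)) \<in> ?pr"
    using assms(1,2) unfolding product_order_def by (cases "L c") (auto intro: le_trans)
  then have "(lax P x y (L c), lax P x y (a, b)) \<in> ob P (prd C x y)"
    using lax_monotone[of x y] assms(1,2) unfolding monotone_map_def by (metis Rel_simps(1,7))
  then show ?thesis
    using un[of c] le_pred(1)[OF assms(7)] assms(1,2) le_trans by (meson prd_obj)
qed

lemma lax_mono:
  assumes "x \<in> obj C" "y \<in> obj C" "(a, a') \<in> ob P x" "(b, b') \<in> ob P y"
  shows "(lax P x y (a, b), lax P x y (a', b')) \<in> ob P (prd C x y)"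
  using lax_monotone[of x y] assms unfolding monotone_map_def product_order_def by auto

lemma pb_bang_top:
  assumes "x \<in> obj C" "a \<in> pred x"
  shows "(a, pb x (one C) (bang C x) (lax0 P ())) \<in> ob P x"
  using assms by (subst im_le_iff[symmetric]) (auto intro: lax0_pred lax0_top)

text \<open>Unitality of the laxator says that \<open>im\<close> along this projection takes the
  right-hand side to \<open>a\<close>. The projection \<open>x \<times> 1 \<rightarrow> x\<close> is
  monic, so \<open>pb\<close> undoes \<open>im\<close>.\<close>

lemma pb_pr1_one:
  assumes "x \<in> obj C" "a \<in> pred x"
  shows "pb (prd C x (one C)) x (pr1 C x (one C)) a = lax P x (one C) (a, lax0 P ())"
proof -
  have m: "monic C (prd C x (one C)) x (pr1 C x (one C))"
  proof (rule monicI)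
    fix w h k assume "w \<in> obj C" "h \<in> hom C w (prd C x (one C))" "k \<in> hom C w (prd C x (one C))"
      "cmp C w (prd C x (one C)) x h (pr1 C x (one C)) = cmp C w (prd C x (one C)) x k (pr1 C x (one C))"
    then show "h = k"
      by - (rule into_prd_eqI[of w x "one C"], use assms in \<open>auto intro: into_one_unique\<close>)
  qed (use assms in auto)
  have "im (prd C x (one C)) x (pr1 C x (one C)) (lax P x (one C) (a, lax0 P ())) = a"
    using lax_runit[of x a] assms unfolding im_def by simp
  then show ?thesis
    using pb_im_monic[OF m, of "lax P x (one C) (a, lax0 P ())"] assms lax0_pred by simp
qed

lemma pb_pr2_one:
  assumes "x \<in> obj C" "a \<in> pred x"
  shows "pb (prd C (one C) x) x (pr2 C (one C) x) a = lax P (one C) x (lax0 P (), a)"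
proof -
  have m: "monic C (prd C (one C) x) x (pr2 C (one C) x)"
  proof (rule monicI)
    fix w h k assume "w \<in> obj C" "h \<in> hom C w (prd C (one C) x)" "k \<in> hom C w (prd C (one C) x)"
      "cmp C w (prd C (one C) x) x h (pr2 C (one C) x) = cmp C w (prd C (one C) x) x k (pr2 C (one C) x)"
    then show "h = k"
      by - (rule into_prd_eqI[of w "one C" x], use assms in \<open>auto intro: into_one_unique\<close>)
  qed (use assms in auto)
  have "im (prd C (one C) x) x (pr2 C (one C) x) (lax P (one C) x (lax0 P (), a)) = a"
    using lax_lunit[of x a] assms unfolding im_def by (simp add: Rel_def)
  then show ?thesis
    using pb_im_monic[OF m, of "lax P (one C) x (lax0 P (), a)"] assms lax0_pred by simp
qed

lemma pb_times_lax:
  assumes "x \<in> obj C" "y \<in> obj C" "x' \<in> obj C" "y' \<in> obj C" "f \<in> hom C x y" "g \<in> hom C x' y'"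
    and "a \<in> pred y" "b \<in> pred y'"
  shows "pb (prd C x x') (prd C y y') (times C x y x' y' f g) (lax P y y' (a, b)) = lax P x x' (pb x y f a, pb x' y' g b)"
  using lax_natural[of y y' x x' "cograph C x y f" "cograph C x' y' g" a b] assms
  unfolding pb_def by (simp add: rel_tensor_cograph)

lemma im_times_lax:
  assumes "x \<in> obj C" "y \<in> obj C" "x' \<in> obj C" "y' \<in> obj C" "f \<in> hom C x y" "g \<in> hom C x' y'"
    and "a \<in> pred x" "b \<in> pred x'"
  shows "im (prd C x x') (prd C y y') (times C x y x' y' f g) (lax P x x' (a, b)) = lax P y y' (im x y f a, im x' y' g b)"
  using lax_natural[of x x' y y' "graph C x y f" "graph C x' y' g" a b] assms
  unfolding im_def by (simp add: rel_tensor_graph)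

text \<open>The projection factors through \<open>x \<times> 1\<close> by discarding
  \<open>y\<close>; naturality of the laxator at the corresponding cographs reduces the claim to the
  case of the unit.\<close>

lemma pb_pr1:
  assumes "x \<in> obj C" "y \<in> obj C" "a \<in> pred x"
  shows "pb (prd C x y) x (pr1 C x y) a = lax P x y (a, pb y (one C) (bang C y) (lax0 P ()))"
proof -
  have "pr1 C x y = cmp C (prd C x y) (prd C x (one C)) x (times C x x y (one C) (idn C x) (bang C y)) (pr1 C x (one C))"
    using assms unfolding times_def by simp
  then have "pb (prd C x y) x (pr1 C x y) a = pb (prd C x y) (prd C x (one C)) (times C x x y (one C) (idn C x) (bang C y)) (lax P x (one C) (a, lax0 P ()))"
    using assms by (simp add: pb_cmp pb_pr1_one)
  then show ?thesis using assms by (simp add: pb_times_lax pb_idn lax0_pred)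
qed

lemma pb_pr2:
  assumes "x \<in> obj C" "y \<in> obj C" "b \<in> pred y"
  shows "pb (prd C x y) y (pr2 C x y) b = lax P x y (pb x (one C) (bang C x) (lax0 P ()), b)"
proof -
  have "pr2 C x y = cmp C (prd C x y) (prd C (one C) y) y (times C x (one C) y y (bang C x) (idn C y)) (pr2 C (one C) y)"
    using assms unfolding times_def by simp
  then have "pb (prd C x y) y (pr2 C x y) b = pb (prd C x y) (prd C (one C) y) (times C x (one C) y y (bang C x) (idn C y)) (lax P (one C) y (lax0 P (), b))"
    using assms by (simp add: pb_cmp pb_pr2_one)
  then show ?thesis using assms by (simp add: pb_times_lax pb_idn lax0_pred)
qed

text \<open>The laxators are determined by substitution: being right adjoints, they preserve the binary meet
  \<open>(a, b) = (a, \<top>) \<sqinter> (\<top>, b)\<close>, and \<open>\<rho>(a, \<top>)\<close> is the pullback of \<open>a\<close> along the projection.\<close>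

lemma le_lax_iff:
  assumes "x \<in> obj C" "y \<in> obj C" "a \<in> pred x" "b \<in> pred y"
  shows "(c, lax P x y (a, b)) \<in> ob P (prd C x y) \<longleftrightarrow>
    (c, pb (prd C x y) x (pr1 C x y) a) \<in> ob P (prd C x y) \<and> (c, pb (prd C x y) y (pr2 C x y) b) \<in> ob P (prd C x y)"
  (is "?L \<longleftrightarrow> ?R")
proof
  assume ?L
  moreover have "(lax P x y (a, b), pb (prd C x y) x (pr1 C x y) a) \<in> ob P (prd C x y)"
    "(lax P x y (a, b), pb (prd C x y) y (pr2 C x y) b) \<in> ob P (prd C x y)"
    using assms by (auto simp: pb_pr1 pb_pr2 intro!: lax_mono pb_bang_top)
  ultimately show ?R using assms le_trans by (meson prd_obj)
next
  assume ?R
  then show ?L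
    by - (rule lax_le_cases[where a' = "pb x (one C) (bang C x) (lax0 P ())" and b' = "pb y (one C) (bang C y) (lax0 P ())"],
      use assms in \<open>auto simp: pb_pr1 pb_pr2 lax0_pred\<close>)
qed

text \<open>Quantifying along \<open>h\<close> moves the stage to the product, where the description
  of the laxator applies; adjointness moves it back.\<close>

lemma le_pb_lax_iff:
  assumes "w \<in> obj C" "x \<in> obj C" "y \<in> obj C" "a \<in> pred x" "b \<in> pred y" "h \<in> hom C w (prd C x y)" "c \<in> pred w"
  shows "(c, pb w (prd C x y) h (lax P x y (a, b))) \<in> ob P w \<longleftrightarrow>
    (c, pb w x (cmp C w (prd C x y) x h (pr1 C x y)) a) \<in> ob P w \<and> (c, pb w y (cmp C w (prd C x y) y h (pr2 C x y)) b) \<in> ob P w"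
  using assms by (simp add: pb_cmp le_lax_iff flip: im_le_iff)

text \<open>Substitution along the diagonal turns the external conjunction given by the laxator into
  a binary meet of predicates on \<open>x\<close>.\<close>

definition meet :: "'o \<Rightarrow> 'p \<Rightarrow> 'p \<Rightarrow> 'p"
  where "meet x a b = pb x (prd C x x) (diag C x) (lax P x x (a, b))"

lemma meet_pred [simp]: "x \<in> obj C \<Longrightarrow> a \<in> pred x \<Longrightarrow> b \<in> pred x \<Longrightarrow> meet x a b \<in> pred x"
  unfolding meet_def by simp

lemma le_meet_iff:
  assumes "x \<in> obj C" "a \<in> pred x" "b \<in> pred x" "c \<in> pred x"
  shows "(c, meet x a b) \<in> ob P x \<longleftrightarrow> (c, a) \<in> ob P x \<and> (c, b) \<in> ob P x"
  using assms unfolding meet_def by (simp add: le_pb_lax_iff) (simp add: diag_def pb_idn)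

text \<open>By naturality, pairing \<open>im x y f a\<close> with \<open>b\<close> is quantification
  along \<open>f \<times> id\<close> of the pair \<open>(a, b)\<close>; Beck--Chevalley for the
  graph square then moves the quantifier outside the meet. This is the half of reciprocity that is
  not formal.\<close>

lemma Frobenius:
  assumes "x \<in> obj C" "y \<in> obj C" "f \<in> hom C x y" "a \<in> pred x" "b \<in> pred y"
  shows "(meet y (im x y f a) b, im x y f (meet x a (pb x y f b))) \<in> ob P y"
proof -
  let ?g = "tuple C x x y (idn C x) f"
  have "meet y (im x y f a) b = pb y (prd C y y) (diag C y)
      (im (prd C x y) (prd C y y) (times C x y y y f (idn C y)) (lax P x y (a, b)))"
    using assms unfolding meet_def by (simp add: im_times_lax im_idn)
  also have "\<dots> = im x y f (pb x (prd C x y) ?g (lax P x y (a, b)))"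
    using assms by (intro Beck_Chevalley pullback_graph_square) auto
  finally have eq: "meet y (im x y f a) b = im x y f (pb x (prd C x y) ?g (lax P x y (a, b)))" .
  have p: "pb x (prd C x y) ?g (lax P x y (a, b)) \<in> pred x" using assms by simp
  have "(pb x (prd C x y) ?g (lax P x y (a, b)), pb x (prd C x y) ?g (lax P x y (a, b))) \<in> ob P x"
    using assms p by simp
  then have "(pb x (prd C x y) ?g (lax P x y (a, b)), meet x a (pb x y f b)) \<in> ob P x"
    using assms p by (subst (asm) le_pb_lax_iff) (auto simp: le_meet_iff pb_idn)
  then show ?thesis unfolding eq using assms by (intro im_mono)
qed

text \<open>Surjectivity is measured by the predicates; \<open>c\<close> itself may be any
  morphism.\<close>

definition cover :: "'o \<Rightarrow> 'p \<Rightarrow> 'o \<Rightarrow> 'p \<Rightarrow> 'm \<Rightarrow> bool"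
  where "cover p \<chi>' x \<chi> c \<longleftrightarrow> p \<in> obj C \<and> c \<in> hom C p x \<and> \<chi>' \<in> pred p \<and>
    (\<chi>', pb p x c \<chi>) \<in> ob P p \<and> (\<chi>, im p x c \<chi>') \<in> ob P x"

text \<open>The witness lives on the pullback of \<open>f\<close> along \<open>g\<close>: its legs
  are \<open>h\<close> and \<open>c\<close>, and Beck--Chevalley moves the quantifier to it.\<close>

lemma exists_elim:
  assumes "x \<in> obj C" "\<chi> \<in> pred x" "y \<in> obj C" "z \<in> obj C" "f \<in> hom C y z" "g \<in> hom C x z" "\<psi> \<in> pred y"
    and "(\<chi>, pb x z g (im y z f \<psi>)) \<in> ob P x"
  obtains p \<chi>' c h where "cover p \<chi>' x \<chi> c" "h \<in> hom C p y" "cmp C p y z h f = cmp C p x z c g"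
    "(\<chi>', pb p y h \<psi>) \<in> ob P p"
proof -
  obtain p h c where pb: "pullback C y x z f g p h c"
    using pullback_exists assms(1,3-6) by blast
  then have o: "p \<in> obj C" "h \<in> hom C p y" "c \<in> hom C p x" "cmp C p y z h f = cmp C p x z c g"
    unfolding pullback_def by auto
  let ?\<psi> = "pb p y h \<psi>"
  \<comment> \<open>The new stage keeps both the substituted \<open>\<psi>\<close> and the
    restriction of \<open>\<chi>\<close>. Frobenius ensures that \<open>c\<close> still covers after
    this conjunction.\<close>
  let ?\<chi> = "meet p ?\<psi> (pb p x c \<chi>)"
  have \<psi>: "?\<psi> \<in> pred p" using o assms by simp
  have "(\<chi>, im p x c ?\<psi>) \<in> ob P x"
    using assms(8) Beck_Chevalley[OF pb assms(7)] by simp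
  then have "(\<chi>, meet x (im p x c ?\<psi>) \<chi>) \<in> ob P x"
    using assms o by (simp add: le_meet_iff)
  then have le: "(\<chi>, im p x c ?\<chi>) \<in> ob P x"
    using Frobenius[OF o(1) assms(1) o(3) \<psi> assms(2)] le_trans[OF assms(1)] by blast
  have "?\<chi> \<in> pred p" using o assms by simp
  then have "(?\<chi>, ?\<psi>) \<in> ob P p" "(?\<chi>, pb p x c \<chi>) \<in> ob P p"
    using le_refl[of p ?\<chi>] le_meet_iff[of p ?\<psi> "pb p x c \<chi>" ?\<chi>] o assms \<psi> by auto
  with o le \<open>?\<chi> \<in> pred p\<close> show thesis
    by (intro that[of p ?\<chi> c h]) (auto simp: cover_def)
qed

lemma exists_intro:
  assumes "x \<in> obj C" "y \<in> obj C" "z \<in> obj C" "f \<in> hom C y z" "h \<in> hom C x y" "\<psi> \<in> pred y"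
    and "(\<chi>, pb x y h \<psi>) \<in> ob P x"
  shows "(\<chi>, pb x z (cmp C x y z h f) (im y z f \<psi>)) \<in> ob P x"
proof -
  have "(pb x y h \<psi>, pb x y h (pb y z f (im y z f \<psi>))) \<in> ob P x"
    using assms by (intro pb_mono im_pb_unit)
  then show ?thesis using assms by (auto simp: pb_cmp intro: le_trans)
qed

end

section \<open>Maps in a tabular allegory\<close>

text \<open>All operations are total on the single sort \<open>A\<close>, so the laws must also hold
  for arguments that do not compose. In the intended model such composites are a zero, which is why
  \<open>one_mult\<close> and \<open>mult_one\<close> are inequalities and the equations are left to
  \<open>typedD\<close>.\<close>

locale one_sorted_allegory =
  fixes A :: "'q set" and mult :: "'q \<Rightarrow> 'q \<Rightarrow> 'q" (infixl "\<cdot>" 70) and conv :: "'q \<Rightarrow> 'q" ("_\<degree>" [1000] 1000)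
    and meet :: "'q \<Rightarrow> 'q \<Rightarrow> 'q" (infixl "\<sqinter>" 65) and le :: "'q \<Rightarrow> 'q \<Rightarrow> bool" (infix "\<preceq>" 50)
    and one :: "'o \<Rightarrow> 'q" and Ob :: "'o set"
    and typed :: "'q \<Rightarrow> 'o \<Rightarrow> 'o \<Rightarrow> bool"
  assumes mult_in [simp, intro]: "x \<in> A \<Longrightarrow> y \<in> A \<Longrightarrow> x \<cdot> y \<in> A"
    and conv_in [simp, intro]: "x \<in> A \<Longrightarrow> x\<degree> \<in> A"
    and meet_in [simp, intro]: "x \<in> A \<Longrightarrow> y \<in> A \<Longrightarrow> x \<sqinter> y \<in> A"
    and one_in [simp, intro]: "a \<in> Ob \<Longrightarrow> one a \<in> A"
    and assoc: "x \<in> A \<Longrightarrow> y \<in> A \<Longrightarrow> z \<in> A \<Longrightarrow> (x \<cdot> y) \<cdot> z = x \<cdot> (y \<cdot> z)"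
    and refl [simp, intro]: "x \<in> A \<Longrightarrow> x \<preceq> x"
    and trans [trans]: "x \<preceq> y \<Longrightarrow> y \<preceq> z \<Longrightarrow> x \<preceq> z"
    and antisym: "x \<preceq> y \<Longrightarrow> y \<preceq> x \<Longrightarrow> x = y"
    and mult_mono: "x \<preceq> x' \<Longrightarrow> y \<preceq> y' \<Longrightarrow> x \<cdot> y \<preceq> x' \<cdot> y'"
    and conv_conv [simp]: "x \<in> A \<Longrightarrow> x\<degree>\<degree> = x"
    and conv_mult [simp]: "x \<in> A \<Longrightarrow> y \<in> A \<Longrightarrow> (x \<cdot> y)\<degree> = y\<degree> \<cdot> x\<degree>"
    and conv_mono: "x \<preceq> y \<Longrightarrow> x\<degree> \<preceq> y\<degree>"
    and conv_one [simp]: "a \<in> Ob \<Longrightarrow> (one a)\<degree> = one a"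
    and meet_le1: "x \<in> A \<Longrightarrow> y \<in> A \<Longrightarrow> x \<sqinter> y \<preceq> x"
    and meet_le2: "x \<in> A \<Longrightarrow> y \<in> A \<Longrightarrow> x \<sqinter> y \<preceq> y"
    and meet_greatest: "z \<preceq> x \<Longrightarrow> z \<preceq> y \<Longrightarrow> z \<preceq> x \<sqinter> y"
    and modular_right: "x \<in> A \<Longrightarrow> y \<in> A \<Longrightarrow> z \<in> A \<Longrightarrow> x \<cdot> y \<sqinter> z \<preceq> (x \<sqinter> z \<cdot> y\<degree>) \<cdot> y"
    and one_mult: "a \<in> Ob \<Longrightarrow> x \<in> A \<Longrightarrow> one a \<cdot> x \<preceq> x"
    and mult_one: "a \<in> Ob \<Longrightarrow> x \<in> A \<Longrightarrow> x \<cdot> one a \<preceq> x"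
    and typedD: "typed f a b \<Longrightarrow> a \<in> Ob \<and> b \<in> Ob \<and> f \<in> A \<and> one a \<cdot> f = f \<and> f \<cdot> one b = f"
    and typed_one: "a \<in> Ob \<Longrightarrow> typed (one a) a a"
    and typed_conv: "typed f a b \<Longrightarrow> typed f\<degree> b a"
    and typed_mult: "typed f a b \<Longrightarrow> typed g b c \<Longrightarrow> typed (f \<cdot> g) a c"
    and typed_meet: "typed f a b \<Longrightarrow> typed g a b \<Longrightarrow> typed (f \<sqinter> g) a b"
begin

lemma one_one [simp]: "a \<in> Ob \<Longrightarrow> one a \<cdot> one a = one a"
  using typedD[OF typed_one] by blast

definition map :: "'q \<Rightarrow> 'o \<Rightarrow> 'o \<Rightarrow> bool"
  where "map f a b \<longleftrightarrow> typed f a b \<and> one a \<preceq> f \<cdot> f\<degree> \<and> f\<degree> \<cdot> f \<preceq> one b"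

lemma mapD:
  "map f a b \<Longrightarrow> a \<in> Ob \<and> b \<in> Ob \<and> f \<in> A \<and> one a \<cdot> f = f \<and> f \<cdot> one b = f \<and> one a \<preceq> f \<cdot> f\<degree> \<and> f\<degree> \<cdot> f \<preceq> one b"
  unfolding map_def by (auto dest: typedD)

lemma map_in: "map f a b \<Longrightarrow> f \<in> A" and map_typed: "map f a b \<Longrightarrow> typed f a b"
  unfolding map_def by (auto dest: typedD)

lemma mult_left: "x \<preceq> y \<Longrightarrow> z \<in> A \<Longrightarrow> z \<cdot> x \<preceq> z \<cdot> y"
  by (simp add: mult_mono)

lemma mult_right: "x \<preceq> y \<Longrightarrow> z \<in> A \<Longrightarrow> x \<cdot> z \<preceq> y \<cdot> z"
  by (simp add: mult_mono)

lemma conv_meet: "x \<in> A \<Longrightarrow> y \<in> A \<Longrightarrow> (x \<sqinter> y)\<degree> = x\<degree> \<sqinter> y\<degree>"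
proof (rule antisym)
  assume A: "x \<in> A" "y \<in> A"
  show "(x \<sqinter> y)\<degree> \<preceq> x\<degree> \<sqinter> y\<degree>"
    using A by (intro meet_greatest conv_mono meet_le1 meet_le2)
  have "(x\<degree> \<sqinter> y\<degree>)\<degree> \<preceq> x \<sqinter> y"
    using A conv_mono[OF meet_le1[of "x\<degree>" "y\<degree>"]] conv_mono[OF meet_le2[of "x\<degree>" "y\<degree>"]]
    by (intro meet_greatest) auto
  then have "(x\<degree> \<sqinter> y\<degree>)\<degree>\<degree> \<preceq> (x \<sqinter> y)\<degree>" by (rule conv_mono)
  then show "x\<degree> \<sqinter> y\<degree> \<preceq> (x \<sqinter> y)\<degree>" using A by simp
qed

lemma modular_left:
  assumes "x \<in> A" "y \<in> A" "z \<in> A"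
  shows "x \<cdot> y \<sqinter> z \<preceq> x \<cdot> (y \<sqinter> x\<degree> \<cdot> z)"
proof -
  have "(y\<degree> \<cdot> x\<degree> \<sqinter> z\<degree>)\<degree> \<preceq> ((y\<degree> \<sqinter> z\<degree> \<cdot> x\<degree>\<degree>) \<cdot> x\<degree>)\<degree>"
    using assms by (intro conv_mono modular_right) auto
  then show ?thesis using assms by (simp add: conv_meet)
qed

lemma map_one: "a \<in> Ob \<Longrightarrow> map (one a) a a"
  unfolding map_def by (auto intro: typed_one)

lemma map_expand_left:
  assumes "map f a b" "typed g a c"
  shows "g \<preceq> f \<cdot> (f\<degree> \<cdot> g)"
proof -
  note D = mapD[OF assms(1)] typedD[OF assms(2)]
  have "one a \<cdot> g \<preceq> (f \<cdot> f\<degree>) \<cdot> g" using D by (intro mult_right) auto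
  then show ?thesis using D by (simp add: assoc)
qed

lemma map_expand_right:
  assumes "map f a b" "typed g c a"
  shows "g \<preceq> g \<cdot> (f \<cdot> f\<degree>)"
  using mapD[OF assms(1)] typedD[OF assms(2)] mult_left by metis

lemma map_contract_left:
  assumes "map f a b" "g \<in> A"
  shows "f\<degree> \<cdot> (f \<cdot> g) \<preceq> g"
proof -
  note D = mapD[OF assms(1)]
  have "(f\<degree> \<cdot> f) \<cdot> g \<preceq> one b \<cdot> g" using D assms by (intro mult_right) auto
  also have "\<dots> \<preceq> g" using D assms by (auto intro: one_mult)
  finally show ?thesis using D assms by (simp add: assoc)
qed

lemma map_contract_right:
  assumes "map f a b" "g \<in> A"
  shows "g \<cdot> (f\<degree> \<cdot> f) \<preceq> g"
proof -
  note D = mapD[OF assms(1)]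
  have "g \<cdot> (f\<degree> \<cdot> f) \<preceq> g \<cdot> one b" using D assms by (intro mult_left) auto
  also have "\<dots> \<preceq> g" using D assms by (auto intro: mult_one)
  finally show ?thesis .
qed

lemma map_mult:
  assumes "map f a b" "map g b c"
  shows "map (f \<cdot> g) a c"
proof -
  note D = mapD[OF assms(1)] mapD[OF assms(2)]
  have "f \<cdot> f\<degree> \<preceq> f \<cdot> (g \<cdot> (g\<degree> \<cdot> f\<degree>))"
    using D by (intro mult_left map_expand_left[OF assms(2) typed_conv[OF map_typed[OF assms(1)]]]) auto
  moreover have "g\<degree> \<cdot> (f\<degree> \<cdot> (f \<cdot> g)) \<preceq> g\<degree> \<cdot> g"
    using D by (intro mult_left map_contract_left[OF assms(1)]) auto
  ultimately show ?thesis
    using D typed_mult[OF map_typed[OF assms(1)] map_typed[OF assms(2)]]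
    unfolding map_def by (auto simp: assoc intro: trans)
qed

text \<open>The order is discrete on maps: \<open>g \<preceq> f \<cdot> (f\<degree> \<cdot> g)
  \<preceq> f \<cdot> (g\<degree> \<cdot> g) \<preceq> f\<close>. An equation between maps thus
  follows from a single inequality.\<close>

lemma map_eqI:
  assumes "map f a b" "map g a b" "f \<preceq> g"
  shows "f = g"
proof (rule antisym[OF assms(3)])
  note D = mapD[OF assms(1)] mapD[OF assms(2)]
  have "g \<preceq> f \<cdot> (f\<degree> \<cdot> g)" by (rule map_expand_left[OF assms(1) map_typed[OF assms(2)]])
  also have "\<dots> \<preceq> f \<cdot> (g\<degree> \<cdot> g)"
    using D by (intro mult_left mult_right conv_mono assms(3)) auto
  also have "\<dots> \<preceq> f" using D by (intro map_contract_right[OF assms(2)]) auto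
  finally show "g \<preceq> f" .
qed

text \<open>The hypothesis gives every element a value common to \<open>r\<close> and
  \<open>s\<close>. The modular law, applied once on each side, replaces first \<open>r\<close> and
  then \<open>s\<degree>\<close> by the meet.\<close>

lemma meet_total:
  assumes "typed r a b" "typed s a b" "one a \<preceq> r \<cdot> s\<degree>"
  shows "one a \<preceq> (r \<sqinter> s) \<cdot> (r \<sqinter> s)\<degree>"
proof -
  note D = typedD[OF assms(1)] typedD[OF assms(2)]
  have s: "one a \<cdot> s\<degree>\<degree> = s" and t: "(r \<sqinter> s)\<degree> \<cdot> one a = (r \<sqinter> s)\<degree>"
    using D typedD[OF typed_conv[OF typed_meet[OF assms(1,2)]]] by auto
  have "one a \<preceq> r \<cdot> s\<degree> \<sqinter> one a" using D assms(3) by (intro meet_greatest) auto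
  also have "\<dots> \<preceq> (r \<sqinter> s) \<cdot> s\<degree>"
    using modular_right[of r "s\<degree>" "one a"] D s by simp
  finally have "one a \<preceq> (r \<sqinter> s) \<cdot> s\<degree> \<sqinter> one a" using D by (intro meet_greatest) auto
  also have "\<dots> \<preceq> (r \<sqinter> s) \<cdot> (s\<degree> \<sqinter> (r \<sqinter> s)\<degree>)"
    using modular_left[of "r \<sqinter> s" "s\<degree>" "one a"] D t by simp
  also have "\<dots> \<preceq> (r \<sqinter> s) \<cdot> (r \<sqinter> s)\<degree>"
    using D by (intro mult_left meet_le2) auto
  finally show ?thesis .
qed

text \<open>The modular law bounds the unit by \<open>(l \<sqinter> r\<degree>) \<cdot> r\<close>.
  Composing with \<open>l\<close> and using the counit gives \<open>l \<preceq> r\<degree>\<close>,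
  and the mirror image gives \<open>r \<preceq> l\<degree>\<close>.\<close>

lemma adjoint_imp_conv:
  assumes "typed l a b" "typed r b a" "one a \<preceq> l \<cdot> r" "r \<cdot> l \<preceq> one b"
  shows "r = l\<degree>"
proof (rule antisym)
  note D = typedD[OF assms(1)] typedD[OF assms(2)] typedD[OF typed_conv[OF assms(1)]] typedD[OF typed_conv[OF assms(2)]]
  have u: "one a \<preceq> l \<cdot> r \<sqinter> one a" using D assms(3) by (intro meet_greatest) auto
  have "one a \<preceq> (l \<sqinter> r\<degree>) \<cdot> r"
    using trans[OF u modular_right[of l r "one a"]] D by simp
  then have "one a \<cdot> l \<preceq> ((l \<sqinter> r\<degree>) \<cdot> r) \<cdot> l" using D by (intro mult_right) auto
  also have "\<dots> = (l \<sqinter> r\<degree>) \<cdot> (r \<cdot> l)" using D by (simp add: assoc)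
  also have "\<dots> \<preceq> (l \<sqinter> r\<degree>) \<cdot> one b" using D assms(4) by (intro mult_left) auto
  also have "\<dots> \<preceq> l \<sqinter> r\<degree>" using D by (intro mult_one) auto
  also have "\<dots> \<preceq> r\<degree>" using D by (intro meet_le2) auto
  finally have "l \<preceq> r\<degree>" using D by simp
  then have "l\<degree> \<preceq> r\<degree>\<degree>" by (rule conv_mono)
  then show "l\<degree> \<preceq> r" using D by simp
  have "one a \<preceq> l \<cdot> (r \<sqinter> l\<degree>)"
    using trans[OF u modular_left[of l r "one a"]] D by simp
  then have "r \<cdot> one a \<preceq> r \<cdot> (l \<cdot> (r \<sqinter> l\<degree>))" using D by (intro mult_left) auto
  also have "\<dots> = (r \<cdot> l) \<cdot> (r \<sqinter> l\<degree>)" using D by (simp add: assoc)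
  also have "\<dots> \<preceq> one b \<cdot> (r \<sqinter> l\<degree>)" using D assms(4) by (intro mult_right) auto
  also have "\<dots> \<preceq> r \<sqinter> l\<degree>" using D by (intro one_mult) auto
  also have "\<dots> \<preceq> l\<degree>" using D by (intro meet_le2) auto
  finally show "r \<preceq> l\<degree>" using D by simp
qed

text \<open>The last condition is joint monicity of the two legs, stated without generalized
  elements.\<close>

definition tabulates :: "'q \<Rightarrow> 'o \<Rightarrow> 'o \<Rightarrow> 'o \<Rightarrow> 'q \<Rightarrow> 'q \<Rightarrow> bool"
  where "tabulates r a b t f g \<longleftrightarrow> map f t a \<and> map g t b \<and> f\<degree> \<cdot> g = r \<and> f \<cdot> f\<degree> \<sqinter> g \<cdot> g\<degree> \<preceq> one t"

text \<open>The mediating map relates a point of \<open>w\<close> to the points of \<open>t\<close>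
  whose coordinates are prescribed by \<open>x\<close> and \<open>y\<close>. It is total because
  \<open>x\<degree> \<cdot> y\<close> lies below \<open>f\<degree> \<cdot> g\<close>, single-valued
  by joint monicity, and makes the triangles commute because the order on maps is discrete.\<close>

lemma tabulates_universal:
  assumes tab: "tabulates r a b t f g" and x: "map x w a" and y: "map y w b" and xy: "x\<degree> \<cdot> y \<preceq> r"
  shows "\<exists>!h. map h w t \<and> h \<cdot> f = x \<and> h \<cdot> g = y"
proof -
  have f: "map f t a" and g: "map g t b" and fg: "f\<degree> \<cdot> g = r" and jm: "f \<cdot> f\<degree> \<sqinter> g \<cdot> g\<degree> \<preceq> one t"
    using tab unfolding tabulates_def by auto
  note D = mapD[OF f] mapD[OF g] mapD[OF x] mapD[OF y]
  let ?h = "x \<cdot> f\<degree> \<sqinter> y \<cdot> g\<degree>"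
  have tx: "typed (x \<cdot> f\<degree>) w t" and ty: "typed (y \<cdot> g\<degree>) w t"
    using x y f g by (auto intro: typed_mult typed_conv map_typed)
  have h1: "?h \<preceq> x \<cdot> f\<degree>" and h2: "?h \<preceq> y \<cdot> g\<degree>"
    using D by (auto intro: meet_le1 meet_le2)
  have "one w \<preceq> x \<cdot> x\<degree>" using D by auto
  also have "\<dots> \<preceq> x \<cdot> (x\<degree> \<cdot> (y \<cdot> y\<degree>))"
    using D x y by (intro mult_left map_expand_right typed_conv map_typed) auto
  also have "\<dots> = x \<cdot> ((x\<degree> \<cdot> y) \<cdot> y\<degree>)" using D by (simp add: assoc)
  also have "\<dots> \<preceq> x \<cdot> (r \<cdot> y\<degree>)" using D xy by (intro mult_left mult_right) auto
  also have "\<dots> = (x \<cdot> f\<degree>) \<cdot> (y \<cdot> g\<degree>)\<degree>" using D by (simp add: assoc flip: fg)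
  finally have tot: "one w \<preceq> ?h \<cdot> ?h\<degree>" by (rule meet_total[OF tx ty])
  have "?h\<degree> \<cdot> ?h \<preceq> (x \<cdot> f\<degree>)\<degree> \<cdot> (x \<cdot> f\<degree>)" by (intro mult_mono conv_mono h1)
  also have "\<dots> = f \<cdot> (x\<degree> \<cdot> (x \<cdot> f\<degree>))" using D by (simp add: assoc)
  also have "\<dots> \<preceq> f \<cdot> f\<degree>" using D by (intro mult_left map_contract_left[OF x]) auto
  finally have 1: "?h\<degree> \<cdot> ?h \<preceq> f \<cdot> f\<degree>" .
  have "?h\<degree> \<cdot> ?h \<preceq> (y \<cdot> g\<degree>)\<degree> \<cdot> (y \<cdot> g\<degree>)" by (intro mult_mono conv_mono h2)
  also have "\<dots> = g \<cdot> (y\<degree> \<cdot> (y \<cdot> g\<degree>))" using D by (simp add: assoc)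
  also have "\<dots> \<preceq> g \<cdot> g\<degree>" using D by (intro mult_left map_contract_left[OF y]) auto
  finally have 2: "?h\<degree> \<cdot> ?h \<preceq> g \<cdot> g\<degree>" .
  have h: "map ?h w t"
    unfolding map_def using typed_meet[OF tx ty] tot trans[OF meet_greatest[OF 1 2] jm] by simp
  have "?h \<cdot> f \<preceq> (x \<cdot> f\<degree>) \<cdot> f" using D by (intro mult_right h1) auto
  also have "\<dots> \<preceq> x" using D map_contract_right[OF f] by (simp add: assoc)
  finally have hf: "?h \<cdot> f = x" by (rule map_eqI[OF map_mult[OF h f] x])
  have "?h \<cdot> g \<preceq> (y \<cdot> g\<degree>) \<cdot> g" using D by (intro mult_right h2) auto
  also have "\<dots> \<preceq> y" using D map_contract_right[OF g] by (simp add: assoc)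
  finally have hg: "?h \<cdot> g = y" by (rule map_eqI[OF map_mult[OF h g] y])
  show ?thesis
  proof (rule ex1I[of _ ?h])
    fix k assume k: "map k w t \<and> k \<cdot> f = x \<and> k \<cdot> g = y"
    then have tk: "typed k w t" "k \<in> A" by (auto intro: map_typed map_in)
    have "k \<preceq> x \<cdot> f\<degree>" "k \<preceq> y \<cdot> g\<degree>"
      using map_expand_right[OF f tk(1)] map_expand_right[OF g tk(1)] k D tk(2) by (auto simp flip: assoc)
    then show "k = ?h"
      using k by (intro map_eqI[OF _ h] meet_greatest) auto
  qed (use h hf hg in auto)
qed

text \<open>In terms of elements, both sides say that \<open>f\<close> and \<open>g\<close> agree on
  the values that \<open>x\<close> and \<open>y\<close> take at a common argument. This translates
  commuting squares into inequalities, and so cones over a cospan into maps through a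
  tabulation.\<close>

lemma le_span_iff:
  assumes x: "map x w a" and y: "map y w b" and f: "map f a c" and g: "map g b c"
  shows "x\<degree> \<cdot> y \<preceq> f \<cdot> g\<degree> \<longleftrightarrow> x \<cdot> f = y \<cdot> g"
proof
  note D = mapD[OF f] mapD[OF g] mapD[OF x] mapD[OF y]
  assume le: "x\<degree> \<cdot> y \<preceq> f \<cdot> g\<degree>"
  have "y \<cdot> g \<preceq> x \<cdot> (x\<degree> \<cdot> (y \<cdot> g))"
    by (rule map_expand_left[OF x typed_mult[OF map_typed[OF y] map_typed[OF g]]])
  also have "\<dots> = x \<cdot> ((x\<degree> \<cdot> y) \<cdot> g)" using D by (simp add: assoc)
  also have "\<dots> \<preceq> x \<cdot> ((f \<cdot> g\<degree>) \<cdot> g)" using D le by (intro mult_left mult_right) auto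
  also have "\<dots> \<preceq> x \<cdot> f" using D map_contract_right[OF g, of f] by (intro mult_left) (auto simp: assoc)
  finally show "x \<cdot> f = y \<cdot> g"
    using map_eqI[OF map_mult[OF y g] map_mult[OF x f]] by simp
next
  note D = mapD[OF f] mapD[OF g] mapD[OF x] mapD[OF y]
  assume eq: "x \<cdot> f = y \<cdot> g"
  have "x\<degree> \<cdot> y \<preceq> (x\<degree> \<cdot> y) \<cdot> (g \<cdot> g\<degree>)"
    by (rule map_expand_right[OF g]) (use x y in \<open>auto intro: typed_mult typed_conv map_typed\<close>)
  also have "\<dots> = x\<degree> \<cdot> ((y \<cdot> g) \<cdot> g\<degree>)" using D by (simp add: assoc)
  also have "\<dots> = x\<degree> \<cdot> (x \<cdot> (f \<cdot> g\<degree>))" unfolding eq[symmetric] using D by (simp add: assoc)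
  also have "\<dots> \<preceq> f \<cdot> g\<degree>" using D by (intro map_contract_left[OF x]) auto
  finally show "x\<degree> \<cdot> y \<preceq> f \<cdot> g\<degree>" .
qed

definition is_pullback :: "'o \<Rightarrow> 'o \<Rightarrow> 'o \<Rightarrow> 'q \<Rightarrow> 'q \<Rightarrow> 'o \<Rightarrow> 'q \<Rightarrow> 'q \<Rightarrow> bool"
  where "is_pullback x y z f g p p1 p2 \<longleftrightarrow> map f x z \<and> map g y z \<and> map p1 p x \<and> map p2 p y \<and> p1 \<cdot> f = p2 \<cdot> g \<and>
    (\<forall>w a b. map a w x \<longrightarrow> map b w y \<longrightarrow> a \<cdot> f = b \<cdot> g \<longrightarrow> (\<exists>!h. map h w p \<and> h \<cdot> p1 = a \<and> h \<cdot> p2 = b))"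

definition is_coequalizer :: "'o \<Rightarrow> 'o \<Rightarrow> 'q \<Rightarrow> 'q \<Rightarrow> 'o \<Rightarrow> 'q \<Rightarrow> bool"
  where "is_coequalizer x y u v q e \<longleftrightarrow> map u x y \<and> map v x y \<and> map e y q \<and> u \<cdot> e = v \<cdot> e \<and>
    (\<forall>w g. map g y w \<longrightarrow> u \<cdot> g = v \<cdot> g \<longrightarrow> (\<exists>!h. map h q w \<and> e \<cdot> h = g))"

lemma tabulates_pullback:
  assumes "tabulates (f \<cdot> g\<degree>) x y p p1 p2" "map f x z" "map g y z"
  shows "is_pullback x y z f g p p1 p2"
proof -
  have p: "map p1 p x" "map p2 p y" "p1\<degree> \<cdot> p2 = f \<cdot> g\<degree>"
    using assms(1) unfolding tabulates_def by auto
  have "f \<cdot> g\<degree> \<in> A" using assms(2,3) map_in by auto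
  then have "p1 \<cdot> f = p2 \<cdot> g" using le_span_iff[OF p(1,2) assms(2,3)] p(3) by auto
  then show ?thesis
    unfolding is_pullback_def using p assms le_span_iff[OF _ _ assms(2,3)] tabulates_universal[OF assms(1)] by auto
qed

end

section \<open>Limits, images and coequalizers of maps, from tabulations\<close>

locale one_sorted_tabular_allegory = one_sorted_allegory A mult conv meet le one Ob typed
  for A :: "'q set" and mult (infixl "\<cdot>" 70) and conv ("_\<degree>" [1000] 1000) and meet (infixl "\<sqinter>" 65)
    and le (infix "\<preceq>" 50) and one :: "'o \<Rightarrow> 'q" and Ob :: "'o set" and typed :: "'q \<Rightarrow> 'o \<Rightarrow> 'o \<Rightarrow> bool" +
  fixes U :: 'o
  assumes tabulation: "typed r a b \<Longrightarrow> \<exists>t f g. tabulates r a b t f g"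
    and U: "U \<in> Ob" and into_U_le: "typed r U U \<Longrightarrow> r \<preceq> one U"
    and total_into_U: "a \<in> Ob \<Longrightarrow> \<exists>f. typed f a U \<and> one a \<preceq> f \<cdot> f\<degree>"
begin

text \<open>A total arrow into the unit is automatically single-valued, because
  \<open>f\<degree> \<cdot> f\<close> is an endomorphism of \<open>U\<close>; the same bound makes
  any two maps into \<open>U\<close> comparable, hence equal.\<close>

lemma terminal_U:
  assumes "a \<in> Ob"
  shows "\<exists>!f. map f a U"
proof -
  obtain f where f: "typed f a U" "one a \<preceq> f \<cdot> f\<degree>" using total_into_U[OF assms] by blast
  have mf: "map f a U"
    unfolding map_def using f into_U_le[OF typed_mult[OF typed_conv[OF f(1)] f(1)]] by simp
  moreover have "g = f" if g: "map g a U" for g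
  proof (rule map_eqI[OF g mf])
    note D = mapD[OF mf] mapD[OF g]
    have "g \<preceq> f \<cdot> (f\<degree> \<cdot> g)" by (rule map_expand_left[OF mf map_typed[OF g]])
    also have "\<dots> \<preceq> f \<cdot> one U"
      using D into_U_le[OF typed_mult[OF typed_conv[OF f(1)] map_typed[OF g]]] by (intro mult_left) auto
    finally show "g \<preceq> f" using D by simp
  qed
  ultimately show ?thesis by blast
qed

text \<open>A product is a pullback over the terminal object, where every square commutes.\<close>

lemma binary_products:
  assumes "a \<in> Ob" "b \<in> Ob"
  shows "\<exists>t f g. map f t a \<and> map g t b \<and> (\<forall>w x y. map x w a \<longrightarrow> map y w b \<longrightarrow> (\<exists>!h. map h w t \<and> h \<cdot> f = x \<and> h \<cdot> g = y))"
proof -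
  obtain f g where f: "map f a U" and g: "map g b U" using terminal_U assms by blast
  obtain t p q where t: "tabulates (f \<cdot> g\<degree>) a b t p q"
    using tabulation[OF typed_mult[OF map_typed[OF f] typed_conv[OF map_typed[OF g]]]] by blast
  have pb: "is_pullback a b U f g t p q" by (rule tabulates_pullback[OF t f g])
  have "x \<cdot> f = y \<cdot> g" if "map x w a" "map y w b" for x y w
    using map_mult[OF that(1) f] map_mult[OF that(2) g] terminal_U[of w] mapD[OF that(1)] by blast
  then have "\<exists>!h. map h w t \<and> h \<cdot> p = x \<and> h \<cdot> q = y" if "map x w a" "map y w b" for x y w
    using pb that unfolding is_pullback_def by simp
  then show ?thesis using pb unfolding is_pullback_def by (intro exI[of _ t] exI[of _ p] exI[of _ q]) simp
qed

lemma pullbacks: "map f x z \<Longrightarrow> map g y z \<Longrightarrow> \<exists>p p1 p2. is_pullback x y z f g p p1 p2 \<and> p1\<degree> \<cdot> p2 = f \<cdot> g\<degree>"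
  using tabulation[OF typed_mult[OF map_typed typed_conv[OF map_typed]], of f x z g y] tabulates_pullback
  unfolding tabulates_def by blast

text \<open>Tabulating pullbacks have this property by construction. An arbitrary one inherits it
  through the map \<open>h\<close> from a tabulating one, since \<open>h\<degree> \<cdot> h\<close>
  lies below the identity.\<close>

lemma pullback_span:
  assumes "is_pullback x y z f g p p1 p2"
  shows "p1\<degree> \<cdot> p2 = f \<cdot> g\<degree>"
proof (rule antisym)
  have D: "map f x z" "map g y z" "map p1 p x" "map p2 p y" "p1 \<cdot> f = p2 \<cdot> g"
    using assms unfolding is_pullback_def by auto
  show "p1\<degree> \<cdot> p2 \<preceq> f \<cdot> g\<degree>" using le_span_iff[OF D(3,4,1,2)] D(5) by simp
  obtain t t1 t2 where t: "is_pullback x y z f g t t1 t2" "t1\<degree> \<cdot> t2 = f \<cdot> g\<degree>"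
    using pullbacks[OF D(1,2)] by blast
  then obtain h where h: "map h t p" "h \<cdot> p1 = t1" "h \<cdot> p2 = t2"
    using assms unfolding is_pullback_def by metis
  have "(h \<cdot> p1)\<degree> \<cdot> (h \<cdot> p2) = p1\<degree> \<cdot> (h\<degree> \<cdot> (h \<cdot> p2))"
    using map_in[OF D(3)] map_in[OF D(4)] map_in[OF h(1)] by (simp add: assoc)
  also have "\<dots> \<preceq> p1\<degree> \<cdot> p2"
    using D map_in by (intro mult_left map_contract_left[OF h(1)]) auto
  finally show "f \<cdot> g\<degree> \<preceq> p1\<degree> \<cdot> p2" using h t by simp
qed

text \<open>\<open>one a \<sqinter> f \<cdot> g\<degree>\<close> is the part of the diagonal on
  which \<open>f\<close> and \<open>g\<close> agree; being below the identity, it is tabulated by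
  two equal legs.\<close>

lemma equalizers:
  assumes f: "map f a b" and g: "map g a b"
  shows "\<exists>t e. map e t a \<and> e \<cdot> f = e \<cdot> g \<and> (\<forall>w x. map x w a \<longrightarrow> x \<cdot> f = x \<cdot> g \<longrightarrow> (\<exists>!h. map h w t \<and> h \<cdot> e = x))"
proof -
  note D = mapD[OF f] mapD[OF g]
  let ?r = "one a \<sqinter> f \<cdot> g\<degree>"
  have "typed ?r a a"
    using f g D by (intro typed_meet typed_one typed_mult[of f a b] typed_conv map_typed) auto
  then obtain t e e' where t: "tabulates ?r a a t e e'" using tabulation by blast
  then have e: "map e t a" "map e' t a" "e\<degree> \<cdot> e' = ?r" unfolding tabulates_def by auto
  note E = mapD[OF e(1)] mapD[OF e(2)]
  have r: "?r \<preceq> one a" "?r \<preceq> f \<cdot> g\<degree>" using D by (auto intro: meet_le1 meet_le2)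
  \<comment> \<open>The inclusion of the relation in \<open>one a\<close> is read as a commuting
    square over the identity, which identifies the two legs.\<close>
  have "one a \<cdot> (one a)\<degree> = one a" using D by simp
  then have "e \<cdot> one a = e' \<cdot> one a" using le_span_iff[OF e(1,2) map_one map_one] D e(3) r by metis
  then have ee: "e' = e" using E by simp
  have "x \<cdot> f = x \<cdot> g \<Longrightarrow> x\<degree> \<cdot> x \<preceq> ?r" if x: "map x w a" for x w
    using le_span_iff[OF x x f g] mapD[OF x] by (intro meet_greatest) auto
  moreover have "e \<cdot> f = e \<cdot> g" using le_span_iff[OF e(1,1) f g] e(3) r ee by metis
  moreover have "\<exists>!h. map h w t \<and> h \<cdot> e = x" if "map x w a" "x\<degree> \<cdot> x \<preceq> ?r" for x w
    using tabulates_universal[OF t that(1) that(1) that(2)] unfolding ee by simp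
  ultimately show ?thesis using e(1) by (intro exI[of _ t] exI[of _ e]) simp
qed

text \<open>\<open>e\<degree> \<cdot> e = one q\<close> says that \<open>e\<close> is onto. A map
  \<open>g\<close> coequalizes the kernel pair iff
  \<open>e \<cdot> e\<degree> \<preceq> g \<cdot> g\<degree>\<close>, and then
  \<open>e\<degree> \<cdot> g\<close> is the induced map: this inequality makes it single-valued
  and, as \<open>e\<close> is onto, total.\<close>

lemma cover_coequalizer:
  assumes e: "map e y q" and cov: "e\<degree> \<cdot> e = one q" and k: "map k1 k y" "map k2 k y" and ke: "k1\<degree> \<cdot> k2 = e \<cdot> e\<degree>"
  shows "is_coequalizer k y k1 k2 q e"
  unfolding is_coequalizer_def
proof (intro conjI allI impI)
  note D = mapD[OF e] mapD[OF k(1)] mapD[OF k(2)]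
  show "k1 \<cdot> e = k2 \<cdot> e" using le_span_iff[OF k e e] ke D by auto
  fix w g assume g: "map g y w" and eq: "k1 \<cdot> g = k2 \<cdot> g"
  note G = mapD[OF g]
  have le: "e \<cdot> e\<degree> \<preceq> g \<cdot> g\<degree>" using le_span_iff[OF k g g] eq ke by simp
  have t: "typed (e\<degree> \<cdot> g) q w" using e g by (auto intro: typed_mult typed_conv map_typed)
  have "one q = e\<degree> \<cdot> e \<cdot> (e\<degree> \<cdot> e)" using D by (simp add: cov)
  also have "\<dots> = e\<degree> \<cdot> ((e \<cdot> e\<degree>) \<cdot> e)" using D by (simp add: assoc)
  also have "\<dots> \<preceq> e\<degree> \<cdot> ((g \<cdot> g\<degree>) \<cdot> e)" using D le by (intro mult_left mult_right) auto
  also have "\<dots> = (e\<degree> \<cdot> g) \<cdot> (e\<degree> \<cdot> g)\<degree>" using D G by (simp add: assoc)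
  finally have "one q \<preceq> (e\<degree> \<cdot> g) \<cdot> (e\<degree> \<cdot> g)\<degree>" .
  moreover have "(e\<degree> \<cdot> g)\<degree> \<cdot> (e\<degree> \<cdot> g) \<preceq> one w"
  proof -
    have "(e\<degree> \<cdot> g)\<degree> \<cdot> (e\<degree> \<cdot> g) = g\<degree> \<cdot> ((e \<cdot> e\<degree>) \<cdot> g)" using D G by (simp add: assoc)
    also have "\<dots> \<preceq> g\<degree> \<cdot> ((g \<cdot> g\<degree>) \<cdot> g)" using G le by (intro mult_left mult_right) auto
    also have "\<dots> = g\<degree> \<cdot> (g \<cdot> (g\<degree> \<cdot> g))" using G by (simp add: assoc)
    also have "\<dots> \<preceq> g\<degree> \<cdot> g" using G by (intro map_contract_left[OF g]) auto
    also have "\<dots> \<preceq> one w" using G by simp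
    finally show ?thesis .
  qed
  ultimately have h: "map (e\<degree> \<cdot> g) q w" using t unfolding map_def by simp
  have "e \<cdot> (e\<degree> \<cdot> g) = (e \<cdot> e\<degree>) \<cdot> g" using D G by (simp add: assoc)
  also have "\<dots> \<preceq> (g \<cdot> g\<degree>) \<cdot> g" using G le by (intro mult_right) auto
  also have "\<dots> \<preceq> g" using G map_contract_right[OF g, of g] by (simp add: assoc)
  finally have "e \<cdot> (e\<degree> \<cdot> g) = g" using map_eqI[OF map_mult[OF e h] g] by simp
  moreover have "h' = e\<degree> \<cdot> g" if "map h' q w" "e \<cdot> h' = g" for h'
    using that(2) mapD[OF that(1)] D by (simp add: cov flip: that(2) assoc)
  ultimately show "\<exists>!h. map h q w \<and> e \<cdot> h = g" using h by blast
qed (use assms in auto)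

text \<open>Tabulating the range \<open>f\<degree> \<cdot> f\<close>, which lies below the identity,
  gives two equal legs \<open>m\<close>, monic by joint monicity; \<open>e\<close> is the mediating
  map of the pair \<open>(f, f)\<close>. The equality of the kernels of \<open>e\<close> and
  \<open>f\<close> is recorded for use with kernel pairs.\<close>

lemma image_factorization:
  assumes f: "map f x y"
  shows "\<exists>q e m. map e x q \<and> map m q y \<and> e \<cdot> m = f \<and> e\<degree> \<cdot> e = one q \<and> m \<cdot> m\<degree> = one q \<and> e \<cdot> e\<degree> = f \<cdot> f\<degree>"
proof -
  note D = mapD[OF f]
  have "typed (f\<degree> \<cdot> f) y y" using f by (auto intro: typed_mult typed_conv map_typed)
  then obtain q m m' where t: "tabulates (f\<degree> \<cdot> f) y y q m m'" using tabulation by blast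
  then have m: "map m q y" "map m' q y" "m\<degree> \<cdot> m' = f\<degree> \<cdot> f" "m \<cdot> m\<degree> \<sqinter> m' \<cdot> m'\<degree> \<preceq> one q"
    unfolding tabulates_def by auto
  note E = mapD[OF m(1)] mapD[OF m(2)]
  have "one y \<cdot> (one y)\<degree> = one y" using D by simp
  then have "m \<cdot> one y = m' \<cdot> one y" using le_span_iff[OF m(1,2) map_one map_one] D m(3) by metis
  then have mm: "m' = m" using E by simp
  have "m \<cdot> m\<degree> \<preceq> m \<cdot> m\<degree> \<sqinter> m' \<cdot> m'\<degree>" unfolding mm using E by (intro meet_greatest) auto
  then have mon: "m \<cdot> m\<degree> = one q" using antisym[OF trans[OF _ m(4)]] E by blast
  obtain e where e: "map e x q" "e \<cdot> m = f"
    using tabulates_universal[OF t f f] D by auto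
  note F = mapD[OF e(1)]
  \<comment> \<open>Solving \<open>e \<cdot> m = f\<close> for \<open>e\<close>, which
    \<open>m \<cdot> m\<degree> = one q\<close> allows, reduces the remaining equations to
    calculations with \<open>f\<close> and \<open>m\<close>.\<close>
  have e': "e = f \<cdot> m\<degree>" using F E by (simp add: assoc mon flip: e(2))
  have fm: "f\<degree> \<cdot> f = m\<degree> \<cdot> m" using m(3) mm by simp
  have "e\<degree> \<cdot> e = m \<cdot> ((f\<degree> \<cdot> f) \<cdot> m\<degree>)" unfolding e' using D E by (simp add: assoc)
  also have "\<dots> = (m \<cdot> m\<degree>) \<cdot> (m \<cdot> m\<degree>)" unfolding fm using E by (simp add: assoc)
  also have "\<dots> = one q" using E by (simp add: mon)
  finally have "e\<degree> \<cdot> e = one q" .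
  moreover have "e \<cdot> e\<degree> = f \<cdot> f\<degree>"
  proof (rule antisym)
    have "e \<cdot> e\<degree> = f \<cdot> ((m\<degree> \<cdot> m) \<cdot> f\<degree>)" unfolding e' using D E by (simp add: assoc)
    also have "\<dots> = (f \<cdot> f\<degree>) \<cdot> (f \<cdot> f\<degree>)" unfolding fm[symmetric] using D by (simp add: assoc)
    finally have eq: "e \<cdot> e\<degree> = (f \<cdot> f\<degree>) \<cdot> (f \<cdot> f\<degree>)" .
    have "f \<cdot> (f\<degree> \<cdot> (f \<cdot> f\<degree>)) \<preceq> f \<cdot> f\<degree>"
      using D by (intro mult_left map_contract_left[OF f]) auto
    then show "e \<cdot> e\<degree> \<preceq> f \<cdot> f\<degree>" unfolding eq using D by (simp add: assoc)
    have "f \<cdot> f\<degree> \<preceq> f \<cdot> (f\<degree> \<cdot> (f \<cdot> f\<degree>))"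
      by (rule map_expand_left[OF f]) (use f in \<open>auto intro: typed_mult typed_conv map_typed\<close>)
    then show "f \<cdot> f\<degree> \<preceq> e \<cdot> e\<degree>" unfolding eq using D by (simp add: assoc)
  qed
  ultimately show ?thesis using e m(1) mon by blast
qed

text \<open>The onto part of the image factorization has the same kernel as \<open>f\<close>, so it
  coequalizes the kernel pair of \<open>f\<close>.\<close>

lemma kernel_pair_coequalizer:
  assumes "is_pullback x x y f f k k1 k2"
  shows "\<exists>q e. is_coequalizer k x k1 k2 q e"
proof -
  have f: "map f x y" "map k1 k x" "map k2 k x" using assms unfolding is_pullback_def by auto
  obtain q e m where "map e x q" "e\<degree> \<cdot> e = one q" "e \<cdot> e\<degree> = f \<cdot> f\<degree>"
    using image_factorization[OF f(1)] by blast
  then show ?thesis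
    using cover_coequalizer[of e x q k1 k k2] f pullback_span[OF assms] by auto
qed

text \<open>With the image factorization \<open>e = c \<cdot> m\<close>, the map \<open>c\<close>
  equalizes the pair as well, so \<open>c = e \<cdot> h\<close>. Uniqueness gives
  \<open>h \<cdot> m = one q\<close>: the mono \<open>m\<close> has a section and is therefore onto,
  and with it \<open>e\<close>.\<close>

lemma coequalizer_cover:
  assumes "is_coequalizer x y u v q e"
  shows "e\<degree> \<cdot> e = one q"
proof -
  have uv: "map u x y" "map v x y" and e: "map e y q" and eq: "u \<cdot> e = v \<cdot> e"
    and un: "\<And>w g. map g y w \<Longrightarrow> u \<cdot> g = v \<cdot> g \<Longrightarrow> \<exists>!h. map h q w \<and> e \<cdot> h = g"
    using assms unfolding is_coequalizer_def by auto
  obtain r c m where c: "map c y r" "map m r q" "c \<cdot> m = e" "c\<degree> \<cdot> c = one r" "m \<cdot> m\<degree> = one r"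
    using image_factorization[OF e] by blast
  note D = mapD[OF e] mapD[OF uv(1)] mapD[OF uv(2)] mapD[OF c(1)] mapD[OF c(2)]
  have cm: "c = e \<cdot> m\<degree>" using D by (simp add: assoc c(5) flip: c(3))
  have "u \<cdot> c = (u \<cdot> e) \<cdot> m\<degree>" unfolding cm using D by (simp add: assoc)
  also have "\<dots> = v \<cdot> c" unfolding eq cm using D by (simp add: assoc)
  finally obtain h where h: "map h q r" "e \<cdot> h = c" using un[OF c(1)] by blast
  note H = mapD[OF h(1)]
  have "e \<cdot> (h \<cdot> m) = e" using D H c h by (metis assoc)
  then have hm: "h \<cdot> m = one q"
    using un[OF e eq] map_mult[OF h(1) c(2)] map_one[of q] D by metis
  have "one q = (h \<cdot> m)\<degree> \<cdot> (h \<cdot> m)" unfolding hm using D by simp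
  also have "\<dots> = m\<degree> \<cdot> (h\<degree> \<cdot> (h \<cdot> m))" using D H by (simp add: assoc)
  also have "\<dots> \<preceq> m\<degree> \<cdot> m" using D by (intro mult_left map_contract_left[OF h(1)]) auto
  finally have mm: "m\<degree> \<cdot> m = one q" using D by (auto intro: antisym)
  have "e\<degree> \<cdot> e = m\<degree> \<cdot> ((c\<degree> \<cdot> c) \<cdot> m)" using D by (simp add: assoc flip: c(3))
  then show ?thesis using D mm c(4) by simp
qed

text \<open>The pullback spans \<open>f \<cdot> g\<degree>\<close>. As \<open>f\<close> is onto,
  \<open>g \<cdot> g\<degree> = (g \<cdot> f\<degree>) \<cdot> (f \<cdot> g\<degree>)\<close>, which
  contains the identity and can be rewritten with \<open>p2\<degree>\<close> in front; the modular
  law then extracts \<open>p2\<degree> \<cdot> p2\<close>.\<close>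

lemma cover_stable:
  assumes pb: "is_pullback x y z f g p p1 p2" and cov: "f\<degree> \<cdot> f = one z"
  shows "p2\<degree> \<cdot> p2 = one y"
proof (rule antisym)
  have f: "map f x z" "map g y z" "map p1 p x" "map p2 p y"
    using pb unfolding is_pullback_def by auto
  note D = mapD[OF f(1)] mapD[OF f(2)] mapD[OF f(3)] mapD[OF f(4)]
  show "p2\<degree> \<cdot> p2 \<preceq> one y" using D by simp
  have r: "p1\<degree> \<cdot> p2 = f \<cdot> g\<degree>" by (rule pullback_span[OF pb])
  have p2: "p2\<degree> \<cdot> p1 = g \<cdot> f\<degree>" using arg_cong[OF r, of conv] D by simp
  let ?r = "f \<cdot> g\<degree>"
  have "(g \<cdot> f\<degree>) \<cdot> (f \<cdot> g\<degree>) = (g \<cdot> (f\<degree> \<cdot> f)) \<cdot> g\<degree>" using D by (simp add: assoc)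
  also have "\<dots> = g \<cdot> g\<degree>" unfolding cov using D by simp
  finally have "one y \<preceq> (g \<cdot> f\<degree>) \<cdot> (f \<cdot> g\<degree>)" using D by simp
  also have "(g \<cdot> f\<degree>) \<cdot> (f \<cdot> g\<degree>) = p2\<degree> \<cdot> (p1 \<cdot> ?r)" using D by (simp add: assoc flip: p2)
  finally have "one y \<preceq> p2\<degree> \<cdot> (p1 \<cdot> ?r) \<sqinter> one y" using D by (intro meet_greatest) auto
  also have "\<dots> \<preceq> p2\<degree> \<cdot> (p1 \<cdot> ?r \<sqinter> p2)"
    using modular_left[of "p2\<degree>" "p1 \<cdot> ?r" "one y"] D by simp
  also have "\<dots> \<preceq> p2\<degree> \<cdot> p2" using D by (intro mult_left meet_le2) auto
  finally show "one y \<preceq> p2\<degree> \<cdot> p2" .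
qed

text \<open>Regular epis are onto, and onto maps are the coequalizers of their kernel pairs, so
  stability reduces to that of being onto.\<close>

lemma regular_epi_stable:
  assumes pb: "is_pullback x y z f g p p1 p2" and "is_coequalizer a x u v z f"
  shows "\<exists>k k1 k2. is_coequalizer k p k1 k2 y p2"
proof -
  have cov: "p2\<degree> \<cdot> p2 = one y" by (rule cover_stable[OF pb coequalizer_cover[OF assms(2)]])
  have p2: "map p2 p y" using pb unfolding is_pullback_def by simp
  obtain k k1 k2 where "is_pullback p p y p2 p2 k k1 k2" "k1\<degree> \<cdot> k2 = p2 \<cdot> p2\<degree>"
    using pullbacks[OF p2 p2] by blast
  then show ?thesis using cover_coequalizer[OF p2 cov] unfolding is_pullback_def by blast
qed

end

section \<open>Finite limits from terminal object, products and equalizers\<close>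

context category
begin

lemma finite_products:
  assumes terminal: "\<exists>u\<in>obj C. \<forall>a\<in>obj C. \<exists>!f. f \<in> hom C a u"
    and products: "\<And>a b. a \<in> obj C \<Longrightarrow> b \<in> obj C \<Longrightarrow> \<exists>t\<in>obj C. \<exists>f\<in>hom C t a. \<exists>g\<in>hom C t b.
      \<forall>w\<in>obj C. \<forall>x\<in>hom C w a. \<forall>y\<in>hom C w b. \<exists>!h. h \<in> hom C w t \<and> cmp C w t a h f = x \<and> cmp C w t b h g = y"
    and "finite I" "\<forall>i\<in>I. D i \<in> obj C"
  shows "\<exists>v\<in>obj C. \<exists>leg. (\<forall>i\<in>I. leg i \<in> hom C v (D i)) \<and>
    (\<forall>w\<in>obj C. \<forall>l. (\<forall>i\<in>I. l i \<in> hom C w (D i)) \<longrightarrow> (\<exists>!h. h \<in> hom C w v \<and> (\<forall>i\<in>I. cmp C w v (D i) h (leg i) = l i)))"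
  using assms(3,4)
proof induction
  case empty
  then show ?case using terminal by auto
next
  case (insert k I)
  then obtain v leg where v: "v \<in> obj C" "\<forall>i\<in>I. leg i \<in> hom C v (D i)"
    and un0: "\<forall>w\<in>obj C. \<forall>l. (\<forall>i\<in>I. l i \<in> hom C w (D i)) \<longrightarrow>
      (\<exists>!h. h \<in> hom C w v \<and> (\<forall>i\<in>I. cmp C w v (D i) h (leg i) = l i))"
    by auto
  have un: "\<exists>!h. h \<in> hom C w v \<and> (\<forall>i\<in>I. cmp C w v (D i) h (leg i) = l i)"
    if "w \<in> obj C" "\<forall>i\<in>I. l i \<in> hom C w (D i)" for w l
    using un0 that by simp
  have D: "D k \<in> obj C" "\<And>i. i \<in> I \<Longrightarrow> D i \<in> obj C" using insert.prems by auto
  obtain t f g where t: "t \<in> obj C" "f \<in> hom C t v" "g \<in> hom C t (D k)"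
    and tun0: "\<forall>w\<in>obj C. \<forall>x\<in>hom C w v. \<forall>y\<in>hom C w (D k).
      \<exists>!h. h \<in> hom C w t \<and> cmp C w t v h f = x \<and> cmp C w t (D k) h g = y"
    using products[OF v(1) D(1)] by blast
  have tun: "\<exists>!h. h \<in> hom C w t \<and> cmp C w t v h f = x \<and> cmp C w t (D k) h g = y"
    if "w \<in> obj C" "x \<in> hom C w v" "y \<in> hom C w (D k)" for w x y
    using tun0 that by simp
  let ?leg = "\<lambda>i. if i = k then g else cmp C t v (D i) f (leg i)"
  show ?case
  proof (intro bexI[of _ t] exI[of _ ?leg] conjI ballI allI impI)
    show "?leg i \<in> hom C t (D i)" if "i \<in> insert k I" for i
      using that t v D by auto
    fix w l assume w: "w \<in> obj C" and l: "\<forall>i\<in>insert k I. l i \<in> hom C w (D i)"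
    then obtain h where h: "h \<in> hom C w v" "\<And>i. i \<in> I \<Longrightarrow> cmp C w v (D i) h (leg i) = l i"
      and hu: "\<And>h'. h' \<in> hom C w v \<Longrightarrow> (\<forall>i\<in>I. cmp C w v (D i) h' (leg i) = l i) \<Longrightarrow> h' = h"
      using un[OF w, of l] by blast
    obtain q where q: "q \<in> hom C w t" "cmp C w t v q f = h" "cmp C w t (D k) q g = l k"
      and qu: "\<And>q'. q' \<in> hom C w t \<Longrightarrow> cmp C w t v q' f = h \<Longrightarrow> cmp C w t (D k) q' g = l k \<Longrightarrow> q' = q"
      using tun[OF w h(1), of "l k"] l by blast
    show "\<exists>!q. q \<in> hom C w t \<and> (\<forall>i\<in>insert k I. cmp C w t (D i) q (?leg i) = l i)"
    proof (rule ex1I[of _ q])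
      show "q \<in> hom C w t \<and> (\<forall>i\<in>insert k I. cmp C w t (D i) q (?leg i) = l i)"
        using w t v D q h by (auto simp flip: cmp_assoc)
      fix q' assume q': "q' \<in> hom C w t \<and> (\<forall>i\<in>insert k I. cmp C w t (D i) q' (?leg i) = l i)"
      have "cmp C w v (D i) (cmp C w t v q' f) (leg i) = l i" if "i \<in> I" for i
        using q' insert.hyps(2) that w t v D by (auto split: if_splits)
      then have "cmp C w t v q' f = h"
        using q' w t v by (intro hu) auto
      then show "q' = q" using q' by (intro qu) auto
    qed
  qed (use t in auto)
qed

text \<open>The limit is carved out of the product of the objects of the diagram by one equalizer
  per arrow, so that no product indexed by arrows is formed.\<close>

lemma has_finite_limitsI:
  assumes terminal: "\<exists>u\<in>obj C. \<forall>a\<in>obj C. \<exists>!f. f \<in> hom C a u"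
    and products: "\<And>a b. a \<in> obj C \<Longrightarrow> b \<in> obj C \<Longrightarrow> \<exists>t\<in>obj C. \<exists>f\<in>hom C t a. \<exists>g\<in>hom C t b.
      \<forall>w\<in>obj C. \<forall>x\<in>hom C w a. \<forall>y\<in>hom C w b. \<exists>!h. h \<in> hom C w t \<and> cmp C w t a h f = x \<and> cmp C w t b h g = y"
    and equalizers: "\<And>a b f g. a \<in> obj C \<Longrightarrow> b \<in> obj C \<Longrightarrow> f \<in> hom C a b \<Longrightarrow> g \<in> hom C a b \<Longrightarrow>
      \<exists>t\<in>obj C. \<exists>e\<in>hom C t a. cmp C t a b e f = cmp C t a b e g \<and>
        (\<forall>w\<in>obj C. \<forall>x\<in>hom C w a. cmp C w a b x f = cmp C w a b x g \<longrightarrow> (\<exists>!h. h \<in> hom C w t \<and> cmp C w t a h e = x))"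
  shows "has_finite_limits C"
  unfolding has_finite_limits_def
proof (intro allI impI, elim conjE)
  fix J :: "(nat, nat) cat" and DO DM
  assume J: "finite (obj J)" "\<forall>i\<in>obj J. \<forall>j\<in>obj J. finite (hom J i j)" "is_functor J C DO DM"
  have DO: "\<And>i. i \<in> obj J \<Longrightarrow> DO i \<in> obj C"
    and DM: "\<And>i j f. i \<in> obj J \<Longrightarrow> j \<in> obj J \<Longrightarrow> f \<in> hom J i j \<Longrightarrow> DM i j f \<in> hom C (DO i) (DO j)"
    using J(3) unfolding is_functor_def by auto
  \<comment> \<open>\<open>M\<close> is the set of arrows whose triangles already commute; induction
    adds one arrow at a time.\<close>
  have equalized: "\<exists>v\<in>obj C. \<exists>leg. (\<forall>i\<in>obj J. leg i \<in> hom C v (DO i)) \<and>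
      (\<forall>(i, j, f)\<in>M. cmp C v (DO i) (DO j) (leg i) (DM i j f) = leg j) \<and>
      (\<forall>w\<in>obj C. \<forall>l. (\<forall>i\<in>obj J. l i \<in> hom C w (DO i)) \<longrightarrow>
        (\<forall>(i, j, f)\<in>M. cmp C w (DO i) (DO j) (l i) (DM i j f) = l j) \<longrightarrow>
        (\<exists>!h. h \<in> hom C w v \<and> (\<forall>i\<in>obj J. cmp C w v (DO i) h (leg i) = l i)))"
    if "finite M" "M \<subseteq> {(i, j, f). i \<in> obj J \<and> j \<in> obj J \<and> f \<in> hom J i j}" for M
    using that
  proof induction
    case empty
    then show ?case using finite_products[OF terminal products J(1)] DO by simp
  next
    case (insert t M)
    obtain i j f where t: "t = (i, j, f)" by (cases t)
    with insert.prems have ij: "i \<in> obj J" "j \<in> obj J" "f \<in> hom J i j" by auto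
    have "M \<subseteq> {(i, j, f). i \<in> obj J \<and> j \<in> obj J \<and> f \<in> hom J i j}" using insert.prems by blast
    with insert.IH obtain v leg where v: "v \<in> obj C" "\<forall>i\<in>obj J. leg i \<in> hom C v (DO i)"
      and com0: "\<forall>(i, j, f)\<in>M. cmp C v (DO i) (DO j) (leg i) (DM i j f) = leg j"
      and un0: "\<forall>w\<in>obj C. \<forall>l. (\<forall>i\<in>obj J. l i \<in> hom C w (DO i)) \<longrightarrow>
        (\<forall>(i, j, f)\<in>M. cmp C w (DO i) (DO j) (l i) (DM i j f) = l j) \<longrightarrow>
        (\<exists>!h. h \<in> hom C w v \<and> (\<forall>i\<in>obj J. cmp C w v (DO i) h (leg i) = l i))"
      by blast
    have com: "cmp C v (DO i) (DO j) (leg i) (DM i j f) = leg j" if "(i, j, f) \<in> M" for i j f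
      using com0 that by blast
    have un: "\<exists>!h. h \<in> hom C w v \<and> (\<forall>i\<in>obj J. cmp C w v (DO i) h (leg i) = l i)"
      if "w \<in> obj C" "\<forall>i\<in>obj J. l i \<in> hom C w (DO i)" "\<forall>(i, j, f)\<in>M. cmp C w (DO i) (DO j) (l i) (DM i j f) = l j" for w l
      using un0 that by simp
    have "cmp C v (DO i) (DO j) (leg i) (DM i j f) \<in> hom C v (DO j)"
      using ij v DO DM by simp
    \<comment> \<open>The new arrow is enforced by equalizing the two sides of its triangle: the leg
      at \<open>i\<close> followed by the arrow, and the leg at \<open>j\<close>.\<close>
    from equalizers[OF v(1) DO[OF ij(2)] this bspec[OF v(2) ij(2)]]
    obtain s e where s: "s \<in> obj C" "e \<in> hom C s v"
      and se: "cmp C s v (DO j) e (cmp C v (DO i) (DO j) (leg i) (DM i j f)) = cmp C s v (DO j) e (leg j)"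
      and sun: "\<And>w x. w \<in> obj C \<Longrightarrow> x \<in> hom C w v \<Longrightarrow>
        cmp C w v (DO j) x (cmp C v (DO i) (DO j) (leg i) (DM i j f)) = cmp C w v (DO j) x (leg j) \<Longrightarrow>
        \<exists>!h. h \<in> hom C w s \<and> cmp C w s v h e = x"
      by auto
    show ?case
    proof (intro bexI[of _ s] exI[of _ "\<lambda>i. cmp C s v (DO i) e (leg i)"] conjI allI impI)
      show "\<forall>i\<in>obj J. cmp C s v (DO i) e (leg i) \<in> hom C s (DO i)"
        using s v DO by auto
      have "cmp C s (DO a) (DO b) (cmp C s v (DO a) e (leg a)) (DM a b c) = cmp C s v (DO b) e (leg b)"
        if "(a, b, c) \<in> insert t M" for a b c
      proof -
        have "a \<in> obj J" "b \<in> obj J" "c \<in> hom J a b" using that insert.prems by auto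
        then show ?thesis using that s v DO DM se com t by auto
      qed
      then show "\<forall>(a, b, c)\<in>insert t M. cmp C s (DO a) (DO b) (cmp C s v (DO a) e (leg a)) (DM a b c) = cmp C s v (DO b) e (leg b)"
        by blast
      show "\<forall>w\<in>obj C. \<forall>l. (\<forall>i\<in>obj J. l i \<in> hom C w (DO i)) \<longrightarrow>
          (\<forall>(i, j, f)\<in>insert t M. cmp C w (DO i) (DO j) (l i) (DM i j f) = l j) \<longrightarrow>
          (\<exists>!h. h \<in> hom C w s \<and> (\<forall>i\<in>obj J. cmp C w s (DO i) h (cmp C s v (DO i) e (leg i)) = l i))"
      proof (intro ballI allI impI)
        fix w l assume w: "w \<in> obj C" and l: "\<forall>i\<in>obj J. l i \<in> hom C w (DO i)"
          and lM: "\<forall>(i, j, f)\<in>insert t M. cmp C w (DO i) (DO j) (l i) (DM i j f) = l j"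
        have lM': "\<forall>(i, j, f)\<in>M. cmp C w (DO i) (DO j) (l i) (DM i j f) = l j" using lM by blast
        have lt: "cmp C w (DO i) (DO j) (l i) (DM i j f) = l j" using lM t by auto
        obtain h where h: "h \<in> hom C w v" "\<And>i. i \<in> obj J \<Longrightarrow> cmp C w v (DO i) h (leg i) = l i"
          and hu: "\<And>h'. h' \<in> hom C w v \<Longrightarrow> (\<forall>i\<in>obj J. cmp C w v (DO i) h' (leg i) = l i) \<Longrightarrow> h' = h"
          using un[OF w l lM'] by blast
        have "cmp C w v (DO j) h (cmp C v (DO i) (DO j) (leg i) (DM i j f)) = cmp C w v (DO j) h (leg j)"
          using w v h ij DO DM lt by (simp flip: cmp_assoc)
        then obtain q where q: "q \<in> hom C w s" "cmp C w s v q e = h"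
          and qu: "\<And>q'. q' \<in> hom C w s \<Longrightarrow> cmp C w s v q' e = h \<Longrightarrow> q' = q"
          using sun[OF w h(1)] by blast
        show "\<exists>!h. h \<in> hom C w s \<and> (\<forall>i\<in>obj J. cmp C w s (DO i) h (cmp C s v (DO i) e (leg i)) = l i)"
        proof (rule ex1I[of _ q])
          show "q \<in> hom C w s \<and> (\<forall>i\<in>obj J. cmp C w s (DO i) q (cmp C s v (DO i) e (leg i)) = l i)"
            using w s v DO q h by (simp flip: cmp_assoc)
          fix q' assume q': "q' \<in> hom C w s \<and> (\<forall>i\<in>obj J. cmp C w s (DO i) q' (cmp C s v (DO i) e (leg i)) = l i)"
          then have "cmp C w s v q' e = h"
            using w s v DO by (intro hu) auto
          then show "q' = q" using q' by (intro qu) auto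
        qed
      qed
    qed (use s in auto)
  qed
  define M where "M = {(i, j, f). i \<in> obj J \<and> j \<in> obj J \<and> f \<in> hom J i j}"
  have "M = (SIGMA i:obj J. SIGMA j:obj J. hom J i j)" unfolding M_def by auto
  then have "finite M" using J by (auto intro!: finite_SigmaI)
  from equalized[OF this] obtain v leg where "v \<in> obj C" "\<forall>i\<in>obj J. leg i \<in> hom C v (DO i)"
      "\<forall>(i, j, f)\<in>M. cmp C v (DO i) (DO j) (leg i) (DM i j f) = leg j"
      "\<forall>w\<in>obj C. \<forall>l. (\<forall>i\<in>obj J. l i \<in> hom C w (DO i)) \<longrightarrow>
        (\<forall>(i, j, f)\<in>M. cmp C w (DO i) (DO j) (l i) (DM i j f) = l j) \<longrightarrow>
        (\<exists>!h. h \<in> hom C w v \<and> (\<forall>i\<in>obj J. cmp C w v (DO i) h (leg i) = l i))"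
    unfolding M_def by blast
  then have "limit_cone J C DO DM v leg"
    unfolding limit_cone_def cone_def M_def by simp
  then show "\<exists>v leg. limit_cone J C DO DM v leg" by blast
qed

end

section \<open>Regularity of the category of maps\<close>

text \<open>\<open>dag\<close> and \<open>meet\<close> take the objects as arguments because one
  arrow may belong to several hom-sets. \<open>tabulating_maps\<close> is the notion of tabulation
  above with the map conditions written out.\<close>

locale tabular_allegory = category C
  for C :: "('o, 'm, 'z) pocat_scheme" +
  fixes dag :: "'o \<Rightarrow> 'o \<Rightarrow> 'm \<Rightarrow> 'm" and meet :: "'o \<Rightarrow> 'o \<Rightarrow> 'm \<Rightarrow> 'm \<Rightarrow> 'm" and U :: 'o
  assumes leq_refl: "\<lbrakk>a \<in> obj C; b \<in> obj C; f \<in> hom C a b\<rbrakk> \<Longrightarrow> leq C a b f f"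
    and leq_trans: "\<lbrakk>a \<in> obj C; b \<in> obj C; f \<in> hom C a b; g \<in> hom C a b; h \<in> hom C a b; leq C a b f g; leq C a b g h\<rbrakk>
      \<Longrightarrow> leq C a b f h"
    and leq_antisym: "\<lbrakk>a \<in> obj C; b \<in> obj C; f \<in> hom C a b; g \<in> hom C a b; leq C a b f g; leq C a b g f\<rbrakk> \<Longrightarrow> f = g"
    and cmp_mono: "\<lbrakk>a \<in> obj C; b \<in> obj C; c \<in> obj C; f \<in> hom C a b; f' \<in> hom C a b; g \<in> hom C b c; g' \<in> hom C b c;
        leq C a b f f'; leq C b c g g'\<rbrakk> \<Longrightarrow> leq C a c (cmp C a b c f g) (cmp C a b c f' g')"
    and dag_hom [simp]: "\<lbrakk>a \<in> obj C; b \<in> obj C; f \<in> hom C a b\<rbrakk> \<Longrightarrow> dag a b f \<in> hom C b a"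
    and dag_dag [simp]: "\<lbrakk>a \<in> obj C; b \<in> obj C; f \<in> hom C a b\<rbrakk> \<Longrightarrow> dag b a (dag a b f) = f"
    and dag_cmp: "\<lbrakk>a \<in> obj C; b \<in> obj C; c \<in> obj C; f \<in> hom C a b; g \<in> hom C b c\<rbrakk>
      \<Longrightarrow> dag a c (cmp C a b c f g) = cmp C c b a (dag b c g) (dag a b f)"
    and dag_idn: "a \<in> obj C \<Longrightarrow> dag a a (idn C a) = idn C a"
    and dag_mono: "\<lbrakk>a \<in> obj C; b \<in> obj C; f \<in> hom C a b; g \<in> hom C a b; leq C a b f g\<rbrakk>
      \<Longrightarrow> leq C b a (dag a b f) (dag a b g)"
    and meet_hom [simp]: "\<lbrakk>a \<in> obj C; b \<in> obj C; f \<in> hom C a b; g \<in> hom C a b\<rbrakk> \<Longrightarrow> meet a b f g \<in> hom C a b"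
    and leq_meet_iff: "\<lbrakk>a \<in> obj C; b \<in> obj C; f \<in> hom C a b; g \<in> hom C a b; h \<in> hom C a b\<rbrakk>
      \<Longrightarrow> leq C a b h (meet a b f g) \<longleftrightarrow> leq C a b h f \<and> leq C a b h g"
    and modular_law: "\<lbrakk>a \<in> obj C; b \<in> obj C; c \<in> obj C; f \<in> hom C a b; g \<in> hom C b c; h \<in> hom C a c\<rbrakk>
      \<Longrightarrow> leq C a c (meet a c (cmp C a b c f g) h)
        (cmp C a b c (meet a b f (cmp C a c b h (dag b c g))) g)"
    and tabulating_maps: "\<lbrakk>a \<in> obj C; b \<in> obj C; r \<in> hom C a b\<rbrakk> \<Longrightarrow>
      \<exists>t\<in>obj C. \<exists>f\<in>hom C t a. \<exists>g\<in>hom C t b.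
        leq C t t (idn C t) (cmp C t a t f (dag t a f)) \<and> leq C a a (cmp C a t a (dag t a f) f) (idn C a) \<and>
        leq C t t (idn C t) (cmp C t b t g (dag t b g)) \<and> leq C b b (cmp C b t b (dag t b g) g) (idn C b) \<and>
        cmp C a t b (dag t a f) g = r \<and>
        leq C t t (meet t t (cmp C t a t f (dag t a f)) (cmp C t b t g (dag t b g))) (idn C t)"
    and U_obj: "U \<in> obj C"
    and U_leq: "f \<in> hom C U U \<Longrightarrow> leq C U U f (idn C U)"
    and U_total: "a \<in> obj C \<Longrightarrow> \<exists>f\<in>hom C a U. leq C a a (idn C a) (cmp C a U a f (dag a U f))"
begin

text \<open>Adjoining a zero \<open>None\<close>, the value of all ill-typed operations, turns the arrows into a single
  sort in which the laws hold without typing conditions.\<close>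

definition arr :: "('o \<times> 'o \<times> 'm) option set"
  where "arr = insert None {Some (a, b, f) | a b f. a \<in> obj C \<and> b \<in> obj C \<and> f \<in> hom C a b}"

definition Mult :: "('o \<times> 'o \<times> 'm) option \<Rightarrow> ('o \<times> 'o \<times> 'm) option \<Rightarrow> ('o \<times> 'o \<times> 'm) option"
  where "Mult p q = (case (p, q) of (Some (a, b, f), Some (b', c, g)) \<Rightarrow>
    if b = b' then Some (a, c, cmp C a b c f g) else None | _ \<Rightarrow> None)"

definition Conv :: "('o \<times> 'o \<times> 'm) option \<Rightarrow> ('o \<times> 'o \<times> 'm) option"
  where "Conv = map_option (\<lambda>(a, b, f). (b, a, dag a b f))"

definition Meet :: "('o \<times> 'o \<times> 'm) option \<Rightarrow> ('o \<times> 'o \<times> 'm) option \<Rightarrow> ('o \<times> 'o \<times> 'm) option"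
  where "Meet p q = (case (p, q) of (Some (a, b, f), Some (a', b', g)) \<Rightarrow>
    if a = a' \<and> b = b' then Some (a, b, meet a b f g) else None | _ \<Rightarrow> None)"

text \<open>Membership in \<open>arr\<close> is part of the order because transitivity, antisymmetry
  and monotonicity in the one-sorted setting carry no membership hypotheses.\<close>

definition Le :: "('o \<times> 'o \<times> 'm) option \<Rightarrow> ('o \<times> 'o \<times> 'm) option \<Rightarrow> bool"
  where "Le p q \<longleftrightarrow> p \<in> arr \<and> q \<in> arr \<and>
    (p = None \<or> (\<exists>a b f g. p = Some (a, b, f) \<and> q = Some (a, b, g) \<and> leq C a b f g))"

definition One :: "'o \<Rightarrow> ('o \<times> 'o \<times> 'm) option"
  where "One a = Some (a, a, idn C a)"

lemma arr_simps [simp]: "None \<in> arr" "Some (a, b, f) \<in> arr \<longleftrightarrow> a \<in> obj C \<and> b \<in> obj C \<and> f \<in> hom C a b"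
  unfolding arr_def by auto

lemma arr_cases:
  assumes "p \<in> arr"
  obtains "p = None" | a b f where "p = Some (a, b, f)" "a \<in> obj C" "b \<in> obj C" "f \<in> hom C a b"
  using assms unfolding arr_def by auto

lemma Mult_simps [simp]: "Mult None q = None" "Mult p None = None"
  "Mult (Some (a, b, f)) (Some (b', c, g)) = (if b = b' then Some (a, c, cmp C a b c f g) else None)"
  unfolding Mult_def by (auto split: option.splits)

lemma Meet_simps [simp]: "Meet None q = None" "Meet p None = None"
  "Meet (Some (a, b, f)) (Some (a', b', g)) = (if a = a' \<and> b = b' then Some (a, b, meet a b f g) else None)"
  unfolding Meet_def by (auto split: option.splits)

lemma Conv_simps [simp]: "Conv None = None" "Conv (Some (a, b, f)) = Some (b, a, dag a b f)"
  unfolding Conv_def by auto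

lemma Le_simps [simp]: "Le None q \<longleftrightarrow> q \<in> arr"
  "Le (Some (a, b, f)) q \<longleftrightarrow> a \<in> obj C \<and> b \<in> obj C \<and> f \<in> hom C a b \<and> (\<exists>g\<in>hom C a b. q = Some (a, b, g) \<and> leq C a b f g)"
  unfolding Le_def by auto

lemma meet_leq:
  assumes "a \<in> obj C" "b \<in> obj C" "f \<in> hom C a b" "g \<in> hom C a b"
  shows "leq C a b (meet a b f g) f" "leq C a b (meet a b f g) g"
  using leq_meet_iff[of a b f g "meet a b f g"] leq_refl assms by auto

definition Typed :: "('o \<times> 'o \<times> 'm) option \<Rightarrow> 'o \<Rightarrow> 'o \<Rightarrow> bool"
  where "Typed p a b \<longleftrightarrow> a \<in> obj C \<and> b \<in> obj C \<and> (\<exists>f\<in>hom C a b. p = Some (a, b, f))"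

text \<open>When all arguments compose, each law is its typed version; otherwise both sides of an
  equation, or the smaller side of an inequality, are the zero.\<close>

lemma one_sorted: "one_sorted_allegory arr Mult Conv Meet Le One (obj C) Typed"
proof
  show "Mult x y \<in> arr" if "x \<in> arr" "y \<in> arr" for x y
    using that by (elim arr_cases) auto
  show "Conv x \<in> arr" if "x \<in> arr" for x
    using that by (elim arr_cases) auto
  show "Meet x y \<in> arr" if "x \<in> arr" "y \<in> arr" for x y
    using that by (elim arr_cases) auto
  show "One a \<in> arr" if "a \<in> obj C" for a
    using that unfolding One_def by auto
  show "Mult (Mult x y) z = Mult x (Mult y z)" if "x \<in> arr" "y \<in> arr" "z \<in> arr" for x y z
    using that by (elim arr_cases) auto
  show "Le x x" if "x \<in> arr" for x
    using that by (elim arr_cases) (auto intro: leq_refl)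
  show "Le x z" if "Le x y" "Le y z" for x y z
    using that unfolding Le_def by (auto intro: leq_trans)
  show "x = y" if "Le x y" "Le y x" for x y
    using that unfolding Le_def by (auto intro: leq_antisym)
  show "Le (Mult x y) (Mult x' y')" if "Le x x'" "Le y y'" for x y x' y'
  proof -
    have "x' \<in> arr" "y' \<in> arr" "x \<in> arr" "y \<in> arr" using that unfolding Le_def by auto
    then show ?thesis using that by (elim arr_cases) (auto intro: cmp_mono)
  qed
  show "Conv (Conv x) = x" if "x \<in> arr" for x
    using that by (elim arr_cases) auto
  show "Conv (Mult x y) = Mult (Conv y) (Conv x)" if "x \<in> arr" "y \<in> arr" for x y
    using that by (elim arr_cases) (auto simp: dag_cmp)
  show "Le (Conv x) (Conv y)" if "Le x y" for x y
  proof -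
    have "x \<in> arr" "y \<in> arr" using that unfolding Le_def by auto
    then show ?thesis using that by (elim arr_cases) (auto intro: dag_mono)
  qed
  show "Conv (One a) = One a" if "a \<in> obj C" for a
    using that unfolding One_def by (simp add: dag_idn)
  show "Le (Meet x y) x" "Le (Meet x y) y" if "x \<in> arr" "y \<in> arr" for x y
    using that by (elim arr_cases; auto intro: meet_leq)+
  show "Le z (Meet x y)" if "Le z x" "Le z y" for x y z
  proof -
    have "x \<in> arr" "y \<in> arr" "z \<in> arr" using that unfolding Le_def by auto
    then show ?thesis using that by (elim arr_cases) (auto simp: leq_meet_iff)
  qed
  show "Le (Meet (Mult x y) z) (Mult (Meet x (Mult z (Conv y))) y)" if "x \<in> arr" "y \<in> arr" "z \<in> arr" for x y z
    using that by (elim arr_cases) (auto intro: modular_law)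
  show "Le (Mult (One a) x) x" "Le (Mult x (One a)) x" if "a \<in> obj C" "x \<in> arr" for a x
    using that unfolding One_def by (elim arr_cases; auto intro: leq_refl)+
  show "a \<in> obj C \<and> b \<in> obj C \<and> p \<in> arr \<and> Mult (One a) p = p \<and> Mult p (One b) = p" if "Typed p a b" for p a b
    using that unfolding Typed_def One_def by auto
  show "Typed (One a) a a" if "a \<in> obj C" for a
    using that unfolding Typed_def One_def by simp
  show "Typed (Conv p) b a" if "Typed p a b" for p a b
    using that unfolding Typed_def by auto
  show "Typed (Mult p q) a c" if "Typed p a b" "Typed q b c" for p q a b c
    using that unfolding Typed_def by auto
  show "Typed (Meet p q) a b" if "Typed p a b" "Typed q a b" for p q a b
    using that unfolding Typed_def by auto
qed

interpretation os: one_sorted_allegory arr Mult Conv Meet Le One "obj C" Typed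
  by (rule one_sorted)

lemma map_Some_iff:
  assumes "a \<in> obj C" "b \<in> obj C"
  shows "os.map (Some (a, b, f)) a b \<longleftrightarrow> f \<in> hom C a b \<and>
    leq C a a (idn C a) (cmp C a b a f (dag a b f)) \<and> leq C b b (cmp C b a b (dag a b f) f) (idn C b)"
  unfolding os.map_def Typed_def using assms by (auto simp: One_def)

text \<open>In one direction the converse serves as right adjoint; in the other, the given right
  adjoint is shown to be the converse.\<close>

lemma map_iff: "os.map p a b \<longleftrightarrow> a \<in> obj C \<and> b \<in> obj C \<and> (\<exists>f\<in>hom (LAdj C) a b. p = Some (a, b, f))"
proof
  assume p: "os.map p a b"
  then have "Typed p a b" by (rule os.map_typed)
  then obtain f where f: "a \<in> obj C" "b \<in> obj C" "f \<in> hom C a b" "p = Some (a, b, f)"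
    unfolding Typed_def by auto
  then have "adjoint_pair C a b f (dag a b f)"
    using p map_Some_iff[of a b f] unfolding adjoint_pair_def by auto
  then show "a \<in> obj C \<and> b \<in> obj C \<and> (\<exists>f\<in>hom (LAdj C) a b. p = Some (a, b, f))"
    using f unfolding LAdj_def by auto
next
  assume "a \<in> obj C \<and> b \<in> obj C \<and> (\<exists>f\<in>hom (LAdj C) a b. p = Some (a, b, f))"
  then obtain f r where p: "a \<in> obj C" "b \<in> obj C" "p = Some (a, b, f)" and adj: "adjoint_pair C a b f r"
    unfolding LAdj_def by auto
  have "Some (b, a, r) = Conv (Some (a, b, f))"
    by (rule os.adjoint_imp_conv[of _ a b]) (use p(1,2) adj in \<open>auto simp: adjoint_pair_def Typed_def One_def\<close>)
  then show "os.map p a b"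
    using p adj by (simp add: map_Some_iff adjoint_pair_def)
qed

lemma one_sorted_tabular: "one_sorted_tabular_allegory arr Mult Conv Meet Le One (obj C) Typed U"
proof
  show "U \<in> obj C" by (rule U_obj)
  show "Le r (One U)" if "Typed r U U" for r
    using that U_leq unfolding Typed_def One_def by auto
  show "\<exists>f. Typed f a U \<and> Le (One a) (Mult f (Conv f))" if "a \<in> obj C" for a
  proof -
    note a = that
    obtain f where "f \<in> hom C a U" "leq C a a (idn C a) (cmp C a U a f (dag a U f))"
      using U_total[OF a] by blast
    then show ?thesis
      using a U_obj by (intro exI[of _ "Some (a, U, f)"]) (auto simp: Typed_def One_def)
  qed
  show "\<exists>t f g. os.tabulates r a b t f g" if "Typed r a b" for r a b
  proof -
    note r0 = that
    obtain r' where ab: "a \<in> obj C" "b \<in> obj C" and r: "r' \<in> hom C a b" "r = Some (a, b, r')"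
      using r0 unfolding Typed_def by blast
    obtain t f g where t: "t \<in> obj C" "f \<in> hom C t a" "g \<in> hom C t b"
      "leq C t t (idn C t) (cmp C t a t f (dag t a f))" "leq C a a (cmp C a t a (dag t a f) f) (idn C a)"
      "leq C t t (idn C t) (cmp C t b t g (dag t b g))" "leq C b b (cmp C b t b (dag t b g) g) (idn C b)"
      "cmp C a t b (dag t a f) g = r'"
      "leq C t t (meet t t (cmp C t a t f (dag t a f)) (cmp C t b t g (dag t b g))) (idn C t)"
      using tabulating_maps[OF ab r(1)] by blast
    then show ?thesis
      unfolding os.tabulates_def r(2) using ab r
      by (intro exI[of _ t] exI[of _ "Some (t, a, f)"] exI[of _ "Some (t, b, g)"]) (auto simp: map_Some_iff One_def)
  qed
qed

interpretation ot: one_sorted_tabular_allegory arr Mult Conv Meet Le One "obj C" Typed U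
  by (rule one_sorted_tabular)

lemma LAdj_simps [simp]: "obj (LAdj C) = obj C" "cmp (LAdj C) = cmp C" "idn (LAdj C) = idn C"
  unfolding LAdj_def by simp_all

lemma map_LAdj [simp]:
  "a \<in> obj C \<Longrightarrow> b \<in> obj C \<Longrightarrow> os.map (Some (a, b, f)) a b \<longleftrightarrow> f \<in> hom (LAdj C) a b"
  by (simp add: map_iff)

text \<open>Universal properties concern tagged arrows on one side and bare ones on the other;
  unique existence passes between them because the objects determine the tags.\<close>

lemma ex1_map:
  assumes "a \<in> obj C" "b \<in> obj C"
  shows "(\<exists>!h. os.map h a b \<and> Q h) \<longleftrightarrow> (\<exists>!h. h \<in> hom (LAdj C) a b \<and> Q (Some (a, b, h)))"
proof
  assume L: "\<exists>!h. os.map h a b \<and> Q h"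
  then obtain f where f: "f \<in> hom (LAdj C) a b" "Q (Some (a, b, f))" unfolding map_iff by auto
  have "g = f" if "g \<in> hom (LAdj C) a b \<and> Q (Some (a, b, g))" for g
  proof -
    have "os.map (Some (a, b, f)) a b \<and> Q (Some (a, b, f))" "os.map (Some (a, b, g)) a b \<and> Q (Some (a, b, g))"
      using f that assms by auto
    then have "Some (a, b, g) = Some (a, b, f)" using L by blast
    then show ?thesis by simp
  qed
  with f show "\<exists>!h. h \<in> hom (LAdj C) a b \<and> Q (Some (a, b, h))" by blast
next
  assume R: "\<exists>!h. h \<in> hom (LAdj C) a b \<and> Q (Some (a, b, h))"
  then obtain f where f: "f \<in> hom (LAdj C) a b" "Q (Some (a, b, f))" by blast
  show "\<exists>!h. os.map h a b \<and> Q h"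
  proof (rule ex1I[of _ "Some (a, b, f)"])
    fix h assume "os.map h a b \<and> Q h"
    then obtain g where "g \<in> hom (LAdj C) a b" "h = Some (a, b, g)" "Q h" unfolding map_iff by auto
    then show "h = Some (a, b, f)" using R f by blast
  qed (use f assms in simp)
qed

lemma category_LAdj: "category (LAdj C)"
proof
  have hom: "f \<in> hom C a b" if "a \<in> obj C" "b \<in> obj C" "f \<in> hom (LAdj C) a b" for a b f
    using that unfolding LAdj_def adjoint_pair_def by auto
  show "idn (LAdj C) x \<in> hom (LAdj C) x x" if "x \<in> obj (LAdj C)" for x
    using os.map_one[of x] that by (simp add: One_def)
  show "cmp (LAdj C) x y z f g \<in> hom (LAdj C) x z"
    if "x \<in> obj (LAdj C)" "y \<in> obj (LAdj C)" "z \<in> obj (LAdj C)" "f \<in> hom (LAdj C) x y" "g \<in> hom (LAdj C) y z" for x y z f g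
    using os.map_mult[of "Some (x, y, f)" x y "Some (y, z, g)" z] that by simp
  show "cmp (LAdj C) x x y (idn (LAdj C) x) f = f" "cmp (LAdj C) x y y f (idn (LAdj C) y) = f"
    if "x \<in> obj (LAdj C)" "y \<in> obj (LAdj C)" "f \<in> hom (LAdj C) x y" for x y f
    using that hom by auto
  show "cmp (LAdj C) w y z (cmp (LAdj C) w x y f g) h = cmp (LAdj C) w x z f (cmp (LAdj C) x y z g h)"
    if "w \<in> obj (LAdj C)" "x \<in> obj (LAdj C)" "y \<in> obj (LAdj C)" "z \<in> obj (LAdj C)"
      "f \<in> hom (LAdj C) w x" "g \<in> hom (LAdj C) x y" "h \<in> hom (LAdj C) y z" for w x y z f g h
    using that hom by simp
qed

lemma pullback_LAdj:
  "pullback (LAdj C) x y z f g p p1 p2 \<longleftrightarrow> x \<in> obj C \<and> y \<in> obj C \<and> z \<in> obj C \<and> p \<in> obj C \<and>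
    os.is_pullback x y z (Some (x, z, f)) (Some (y, z, g)) p (Some (p, x, p1)) (Some (p, y, p2))"
proof (cases "x \<in> obj C \<and> y \<in> obj C \<and> z \<in> obj C \<and> p \<in> obj C")
  case True
  have "(\<forall>w a b. os.map a w x \<longrightarrow> os.map b w y \<longrightarrow> Mult a (Some (x, z, f)) = Mult b (Some (y, z, g)) \<longrightarrow>
      (\<exists>!h. os.map h w p \<and> Mult h (Some (p, x, p1)) = a \<and> Mult h (Some (p, y, p2)) = b)) \<longleftrightarrow>
    (\<forall>w\<in>obj C. \<forall>a\<in>hom (LAdj C) w x. \<forall>b\<in>hom (LAdj C) w y. cmp C w x z a f = cmp C w y z b g \<longrightarrow>
      (\<exists>!h. h \<in> hom (LAdj C) w p \<and> cmp C w p x h p1 = a \<and> cmp C w p y h p2 = b))" (is "?L \<longleftrightarrow> ?R")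
  proof
    assume L: ?L
    show ?R
    proof (intro ballI impI)
      fix w a b assume w: "w \<in> obj C" "a \<in> hom (LAdj C) w x" "b \<in> hom (LAdj C) w y" "cmp C w x z a f = cmp C w y z b g"
      then have "\<exists>!h. os.map h w p \<and> Mult h (Some (p, x, p1)) = Some (w, x, a) \<and> Mult h (Some (p, y, p2)) = Some (w, y, b)"
        using True by (intro L[rule_format]) auto
      then show "\<exists>!h. h \<in> hom (LAdj C) w p \<and> cmp C w p x h p1 = a \<and> cmp C w p y h p2 = b"
        using w True by (simp add: ex1_map)
    qed
  next
    assume R: ?R
    show ?L
    proof (intro allI impI)
      fix w a b assume "os.map a w x" "os.map b w y" and eq: "Mult a (Some (x, z, f)) = Mult b (Some (y, z, g))"
      then obtain a' b' where w: "w \<in> obj C" "a' \<in> hom (LAdj C) w x" "b' \<in> hom (LAdj C) w y" "a = Some (w, x, a')" "b = Some (w, y, b')"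
        unfolding map_iff by auto
      then have "\<exists>!h. h \<in> hom (LAdj C) w p \<and> cmp C w p x h p1 = a' \<and> cmp C w p y h p2 = b'"
        using True eq by (intro R[rule_format]) auto
      then show "\<exists>!h. os.map h w p \<and> Mult h (Some (p, x, p1)) = a \<and> Mult h (Some (p, y, p2)) = b"
        using w True by (simp add: ex1_map)
    qed
  qed
  then show ?thesis
    unfolding pullback_def os.is_pullback_def using True by simp
qed (auto simp: pullback_def)

lemma coequalizer_LAdj:
  "coequalizer (LAdj C) x y u v q e \<longleftrightarrow> x \<in> obj C \<and> y \<in> obj C \<and> q \<in> obj C \<and>
    os.is_coequalizer x y (Some (x, y, u)) (Some (x, y, v)) q (Some (y, q, e))"
proof (cases "x \<in> obj C \<and> y \<in> obj C \<and> q \<in> obj C")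
  case True
  have "(\<forall>w g. os.map g y w \<longrightarrow> Mult (Some (x, y, u)) g = Mult (Some (x, y, v)) g \<longrightarrow>
      (\<exists>!h. os.map h q w \<and> Mult (Some (y, q, e)) h = g)) \<longleftrightarrow>
    (\<forall>w\<in>obj C. \<forall>g\<in>hom (LAdj C) y w. cmp C x y w u g = cmp C x y w v g \<longrightarrow>
      (\<exists>!h. h \<in> hom (LAdj C) q w \<and> cmp C y q w e h = g))" (is "?L \<longleftrightarrow> ?R")
  proof
    assume L: ?L
    show ?R
    proof (intro ballI impI)
      fix w g assume w: "w \<in> obj C" "g \<in> hom (LAdj C) y w" "cmp C x y w u g = cmp C x y w v g"
      then have "\<exists>!h. os.map h q w \<and> Mult (Some (y, q, e)) h = Some (y, w, g)"
        using True by (intro L[rule_format]) auto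
      then show "\<exists>!h. h \<in> hom (LAdj C) q w \<and> cmp C y q w e h = g"
        using w True by (simp add: ex1_map)
    qed
  next
    assume R: ?R
    show ?L
    proof (intro allI impI)
      fix w g assume "os.map g y w" and eq: "Mult (Some (x, y, u)) g = Mult (Some (x, y, v)) g"
      then obtain g' where w: "w \<in> obj C" "g' \<in> hom (LAdj C) y w" "g = Some (y, w, g')"
        unfolding map_iff by auto
      then have "\<exists>!h. h \<in> hom (LAdj C) q w \<and> cmp C y q w e h = g'"
        using True eq by (intro R[rule_format]) auto
      then show "\<exists>!h. os.map h q w \<and> Mult (Some (y, q, e)) h = g"
        using w True by (simp add: ex1_map)
    qed
  qed
  then show ?thesis
    unfolding coequalizer_def os.is_coequalizer_def using True by simp
qed (auto simp: coequalizer_def)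

lemma has_finite_limits_LAdj: "has_finite_limits (LAdj C)"
proof -
  interpret L: category "LAdj C" by (rule category_LAdj)
  show ?thesis
  proof (rule L.has_finite_limitsI)
    have "\<exists>!f. f \<in> hom (LAdj C) a U" if "a \<in> obj C" for a
      using ot.terminal_U[OF that] ex1_map[of a U "\<lambda>_. True"] that U_obj by simp
    then show "\<exists>u\<in>obj (LAdj C). \<forall>a\<in>obj (LAdj C). \<exists>!f. f \<in> hom (LAdj C) a u"
      using U_obj by (intro bexI[of _ U] ballI) simp_all
  next
    fix a b assume ab: "a \<in> obj (LAdj C)" "b \<in> obj (LAdj C)"
    then obtain t f g where "os.map f t a" "os.map g t b"
      and un: "\<And>w x y. os.map x w a \<Longrightarrow> os.map y w b \<Longrightarrow> \<exists>!h. os.map h w t \<and> Mult h f = x \<and> Mult h g = y"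
      using ot.binary_products[of a b] by auto
    then obtain f' g' where t: "t \<in> obj C" "f' \<in> hom (LAdj C) t a" "g' \<in> hom (LAdj C) t b" "f = Some (t, a, f')" "g = Some (t, b, g')"
      unfolding map_iff by auto
    have "\<exists>!h. h \<in> hom (LAdj C) w t \<and> cmp C w t a h f' = x \<and> cmp C w t b h g' = y"
      if "w \<in> obj C" "x \<in> hom (LAdj C) w a" "y \<in> hom (LAdj C) w b" for w x y
      using un[of "Some (w, a, x)" w "Some (w, b, y)"] that ab t by (simp add: ex1_map)
    then show "\<exists>t\<in>obj (LAdj C). \<exists>f\<in>hom (LAdj C) t a. \<exists>g\<in>hom (LAdj C) t b.
      \<forall>w\<in>obj (LAdj C). \<forall>x\<in>hom (LAdj C) w a. \<forall>y\<in>hom (LAdj C) w b.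
        \<exists>!h. h \<in> hom (LAdj C) w t \<and> cmp (LAdj C) w t a h f = x \<and> cmp (LAdj C) w t b h g = y"
      using t by (intro bexI[of _ t] bexI[of _ f'] bexI[of _ g']) auto
  next
    fix a b f g assume ab: "a \<in> obj (LAdj C)" "b \<in> obj (LAdj C)" "f \<in> hom (LAdj C) a b" "g \<in> hom (LAdj C) a b"
    then obtain t e where "os.map e t a" and eq: "Mult e (Some (a, b, f)) = Mult e (Some (a, b, g))"
      and un: "\<And>w x. os.map x w a \<Longrightarrow> Mult x (Some (a, b, f)) = Mult x (Some (a, b, g)) \<Longrightarrow> \<exists>!h. os.map h w t \<and> Mult h e = x"
      using ot.equalizers[of "Some (a, b, f)" a b "Some (a, b, g)"] by auto
    then obtain e' where t: "t \<in> obj C" "e' \<in> hom (LAdj C) t a" "e = Some (t, a, e')"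
      unfolding map_iff by auto
    have "\<exists>!h. h \<in> hom (LAdj C) w t \<and> cmp C w t a h e' = x"
      if "w \<in> obj C" "x \<in> hom (LAdj C) w a" "cmp C w a b x f = cmp C w a b x g" for w x
      using un[of "Some (w, a, x)" w] that ab t by (simp add: ex1_map)
    then show "\<exists>t\<in>obj (LAdj C). \<exists>e\<in>hom (LAdj C) t a. cmp (LAdj C) t a b e f = cmp (LAdj C) t a b e g \<and>
        (\<forall>w\<in>obj (LAdj C). \<forall>x\<in>hom (LAdj C) w a. cmp (LAdj C) w a b x f = cmp (LAdj C) w a b x g \<longrightarrow>
          (\<exists>!h. h \<in> hom (LAdj C) w t \<and> cmp (LAdj C) w t a h e = x))"
      using t eq by (intro bexI[of _ t] bexI[of _ e']) auto
  qed
qed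

theorem regular_category_LAdj: "regular_category (LAdj C)"
proof -
  interpret L: category "LAdj C" by (rule category_LAdj)
  show ?thesis
  proof
    show "has_finite_limits (LAdj C)" by (rule has_finite_limits_LAdj)
  next
    fix x y f k k1 k2 assume pb: "pullback (LAdj C) x x y f f k k1 k2"
    then obtain q e where co: "os.is_coequalizer k x (Some (k, x, k1)) (Some (k, x, k2)) q e"
      using ot.kernel_pair_coequalizer unfolding pullback_LAdj by blast
    then have "os.map e x q" unfolding os.is_coequalizer_def by simp
    then obtain e' where "q \<in> obj C" "e = Some (x, q, e')" unfolding map_iff by auto
    then have "coequalizer (LAdj C) k x k1 k2 q e'"
      using co pb unfolding coequalizer_LAdj pullback_LAdj by simp
    then show "\<exists>q e. coequalizer (LAdj C) k x k1 k2 q e" by blast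
  next
    fix x y z f g p p1 p2
    assume pb: "pullback (LAdj C) x y z f g p p1 p2" and "regular_epi (LAdj C) x z f"
    then obtain a u v where co: "coequalizer (LAdj C) a x u v z f" unfolding regular_epi_def by blast
    obtain k k1 k2 where k: "os.is_coequalizer k p k1 k2 y (Some (p, y, p2))"
      using ot.regular_epi_stable pb co unfolding pullback_LAdj coequalizer_LAdj by blast
    then have "os.map k1 k p" "os.map k2 k p" unfolding os.is_coequalizer_def by auto
    then obtain k1' k2' where "k \<in> obj C" "k1 = Some (k, p, k1')" "k2 = Some (k, p, k2')" unfolding map_iff by auto
    then have "coequalizer (LAdj C) k p k1' k2' y p2"
      using k pb unfolding coequalizer_LAdj pullback_LAdj by simp
    then show "regular_epi (LAdj C) p y p2" unfolding regular_epi_def by blast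
  qed
qed

end

section \<open>Forcing\<close>

text \<open>The definition of composition substitutes along a map into the first arrangement, with
  the shared variable doubled in the middle, while the laxator takes values over the second.
  Concatenation is strictly associative, so both are the same context and both tuples the same
  function.\<close>

lemma FRg_tuple_assoc:
  assumes "w \<in> obj (FRg T)" "x \<in> obj (FRg T)" "y \<in> obj (FRg T)" "z \<in> obj (FRg T)"
    and "f \<in> hom (FRg T) w x" "g \<in> hom (FRg T) w y" "h \<in> hom (FRg T) w z"
  defines "F \<equiv> FRg T"
  shows "prd F (prd F x (prd F y y)) z = prd F (prd F x y) (prd F y z)"
    and "tuple F w (prd F x (prd F y y)) z (tuple F w x (prd F y y) f (tuple F w y y g g)) h =
      tuple F w (prd F x y) (prd F y z) (tuple F w x y f g) (tuple F w y z g h)"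
proof -
  interpret fp_category "FRg T" by (rule fp_category_FRg)
  obtain tx X ty Y tz Z where [simp]: "x = (tx, X)" "y = (ty, Y)" "z = (tz, Z)"
    by (cases x; cases y; cases z) auto
  show "prd F (prd F x (prd F y y)) z = prd F (prd F x y) (prd F y z)"
    unfolding F_def by auto
  have yy: "tuple (FRg T) w y y g g \<in> hom (FRg T) w (ty @ ty, Y \<union> Y)"
    and xy: "tuple (FRg T) w x y f g \<in> hom (FRg T) w (tx @ ty, X \<union> Y)"
    and yz: "tuple (FRg T) w y z g h \<in> hom (FRg T) w (ty @ tz, Y \<union> Z)"
    using tuple_hom[of w y y g g] tuple_hom[of w x y f g] tuple_hom[of w y z g h] assms by auto
  have xyy: "tuple (FRg T) w x (ty @ ty, Y \<union> Y) f (tuple (FRg T) w y y g g) \<in> hom (FRg T) w (tx @ ty @ ty, X \<union> (Y \<union> Y))"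
    using tuple_hom[of w x "(ty @ ty, Y \<union> Y)" f "tuple (FRg T) w y y g g"] yy assms by auto
  have o: "(ty @ ty, Y \<union> Y) \<in> obj (FRg T)" "(tx @ ty @ ty, X \<union> (Y \<union> Y)) \<in> obj (FRg T)"
    "(tx @ ty, X \<union> Y) \<in> obj (FRg T)" "(ty @ tz, Y \<union> Z) \<in> obj (FRg T)"
    using assms(2-4) by auto
  have p: "prd F y y = (ty @ ty, Y \<union> Y)" "prd F x (prd F y y) = (tx @ ty @ ty, X \<union> (Y \<union> Y))"
    "prd F x y = (tx @ ty, X \<union> Y)" "prd F y z = (ty @ tz, Y \<union> Z)"
    unfolding F_def by auto
  have t1: "tuple (FRg T) w (tx @ ty @ ty, X \<union> (Y \<union> Y)) (tz, Z) (tuple (FRg T) w (tx, X) (ty @ ty, Y \<union> Y) f (tuple (FRg T) w (ty, Y) (ty, Y) g g)) h =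
    (\<lambda>i\<in>{..<length (tx @ ty @ ty) + length tz}. if i < length (tx @ ty @ ty)
      then (\<lambda>i\<in>{..<length tx + length (ty @ ty)}. if i < length tx then f i else
         (\<lambda>i\<in>{..<length ty + length ty}. if i < length ty then g i else g (i - length ty)) (i - length tx)) i
      else h (i - length (tx @ ty @ ty)))" (is "_ = ?L")
    using assms(1-7) o yy xyy by (simp only: FRg_tuple \<open>x = _\<close> \<open>y = _\<close> \<open>z = _\<close>)
  have t2: "tuple (FRg T) w (tx @ ty, X \<union> Y) (ty @ tz, Y \<union> Z) (tuple (FRg T) w (tx, X) (ty, Y) f g) (tuple (FRg T) w (ty, Y) (tz, Z) g h) =
    (\<lambda>i\<in>{..<length (tx @ ty) + length (ty @ tz)}. if i < length (tx @ ty)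
      then (\<lambda>i\<in>{..<length tx + length ty}. if i < length tx then f i else g (i - length tx)) i
      else (\<lambda>i\<in>{..<length ty + length tz}. if i < length ty then g i else h (i - length ty)) (i - length (tx @ ty)))" (is "_ = ?R")
    using assms(1-7) o xy yz by (simp only: FRg_tuple \<open>x = _\<close> \<open>y = _\<close> \<open>z = _\<close>)
  have "?L = ?R"
  proof
    fix i
    \<comment> \<open>One case for each block of positions: \<open>f\<close>, the two copies of
      \<open>g\<close>, and \<open>h\<close>. The last case also covers positions beyond the end,
      where both sides are undefined.\<close>
    consider "i < length tx" | j where "i = length tx + j" "j < length ty"
      | j where "i = length tx + length ty + j" "j < length ty"
      | j where "i = length tx + length ty + length ty + j"
      by (metis add_less_cancel_left le_Suc_ex not_less)
    then show "?L i = ?R i"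
      by cases auto
  qed
  then show "tuple F w (prd F x (prd F y y)) z (tuple F w x (prd F y y) f (tuple F w y y g g)) h =
      tuple F w (prd F x y) (prd F y z) (tuple F w x y f g) (tuple F w y z g h)"
    using t1 t2 unfolding p by (simp add: F_def)
qed

text \<open>Deleting the middle variable leaves a factor \<open>one\<close> in the definition of
  composition; strict unitality removes it.\<close>

lemma FRg_tuple_one:
  assumes "w \<in> obj (FRg T)" "x \<in> obj (FRg T)" "f \<in> hom (FRg T) w x"
  shows "prd (FRg T) x (one (FRg T)) = x"
    and "tuple (FRg T) w x (one (FRg T)) f (bang (FRg T) w) = f"
proof -
  interpret fp_category "FRg T" by (rule fp_category_FRg)
  obtain tx X where [simp]: "x = (tx, X)" by (cases x) auto
  show x1: "prd (FRg T) x (one (FRg T)) = x" by simp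
  have "bang (FRg T) w \<in> hom (FRg T) w ([], {})" using bang_hom[of w] assms(1) by simp
  moreover have "([], {}) \<in> obj (FRg T)" using one_obj by simp
  ultimately have "tuple (FRg T) w (tx, X) ([], {}) f (bang (FRg T) w) =
      (\<lambda>i\<in>{..<length tx + length ([] :: 'a list)}. if i < length tx then f i else bang (FRg T) w (i - length tx))"
    using assms by (intro FRg_tuple) auto
  moreover obtain tw W where "w = (tw, W)" by (cases w)
  ultimately show "tuple (FRg T) w x (one (FRg T)) f (bang (FRg T) w) = f"
    using assms(3) by (auto simp: fun_eq_iff PiE_iff extensional_def)
qed

context doctrine
begin

text \<open>Kripke--Joyal semantics: at the stage \<open>(w, \<chi>)\<close> the generalized elements \<open>x\<close>, \<open>y\<close> are
  related by \<open>\<theta>\<close>. Passing to a cover of the stage turns an existential quantifier into a witness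
  and an internal equality into an equality of morphisms.\<close>

definition forces :: "'o \<Rightarrow> 'p \<Rightarrow> 'o \<Rightarrow> 'o \<Rightarrow> 'm \<Rightarrow> 'm \<Rightarrow> 'p \<Rightarrow> bool"
  where "forces w \<chi> a b x y \<theta> \<longleftrightarrow> w \<in> obj C \<and> a \<in> obj C \<and> b \<in> obj C \<and> \<chi> \<in> pred w \<and> \<theta> \<in> pred (prd C a b) \<and>
    x \<in> hom C w a \<and> y \<in> hom C w b \<and> (\<chi>, pb w (prd C a b) (tuple C w a b x y) \<theta>) \<in> ob P w"

definition holds :: "'o \<Rightarrow> 'p \<Rightarrow> 'o \<Rightarrow> 'm \<Rightarrow> 'p \<Rightarrow> bool"
  where "holds w \<chi> a x \<phi> \<longleftrightarrow> w \<in> obj C \<and> a \<in> obj C \<and> \<chi> \<in> pred w \<and> \<phi> \<in> pred a \<and>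
    x \<in> hom C w a \<and> (\<chi>, pb w a x \<phi>) \<in> ob P w"

lemma forces_iff_holds:
  "forces w \<chi> a b x y \<theta> \<longleftrightarrow> a \<in> obj C \<and> b \<in> obj C \<and> x \<in> hom C w a \<and> y \<in> hom C w b \<and>
    holds w \<chi> (prd C a b) (tuple C w a b x y) \<theta>"
  unfolding forces_def holds_def by auto

lemma holdsD:
  "holds w \<chi> a x \<phi> \<Longrightarrow> w \<in> obj C \<and> a \<in> obj C \<and> \<chi> \<in> pred w \<and> \<phi> \<in> pred a \<and> x \<in> hom C w a"
  unfolding holds_def by blast

lemma forcesD:
  "forces w \<chi> a b x y \<theta> \<Longrightarrow> w \<in> obj C \<and> a \<in> obj C \<and> b \<in> obj C \<and> \<chi> \<in> pred w \<and> \<theta> \<in> pred (prd C a b) \<and>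
    x \<in> hom C w a \<and> y \<in> hom C w b"
  unfolding forces_def by blast

lemma coverD: "cover p \<chi>' w \<chi> c \<Longrightarrow> p \<in> obj C \<and> c \<in> hom C p w \<and> \<chi>' \<in> pred p"
  unfolding cover_def by blast

lemma holds_cover:
  assumes "cover p \<chi>' w \<chi> c" "holds w \<chi> a x \<phi>"
  shows "holds p \<chi>' a (cmp C p w a c x) \<phi>"
proof -
  note D = assms[unfolded cover_def holds_def]
  have "(pb p w c \<chi>, pb p w c (pb w a x \<phi>)) \<in> ob P p"
    using D by (intro pb_mono) auto
  then have "(\<chi>', pb p w c (pb w a x \<phi>)) \<in> ob P p" using D le_trans by blast
  then show ?thesis using D by (simp add: holds_def pb_cmp)
qed

text \<open>Adjointness turns the hypothesis on the cover into a bound on the image of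
  \<open>\<chi>'\<close> along \<open>c\<close>, and \<open>\<chi>\<close> lies below that
  image.\<close>

lemma holds_local:
  assumes "cover p \<chi>' w \<chi> c" "holds p \<chi>' a (cmp C p w a c x) \<phi>" "w \<in> obj C" "\<chi> \<in> pred w" "x \<in> hom C w a"
  shows "holds w \<chi> a x \<phi>"
proof -
  note D = assms[unfolded cover_def holds_def]
  have "(\<chi>', pb p w c (pb w a x \<phi>)) \<in> ob P p" using D pb_cmp[of p w a c x \<phi>] by auto
  then have "(im p w c \<chi>', pb w a x \<phi>) \<in> ob P w" using D by (subst im_le_iff) auto
  then have "(\<chi>, pb w a x \<phi>) \<in> ob P w" using D le_trans by blast
  then show ?thesis using D by (simp add: holds_def)
qed

lemma forces_cover:
  assumes "cover p \<chi>' w \<chi> c" "forces w \<chi> a b x y \<theta>"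
  shows "forces p \<chi>' a b (cmp C p w a c x) (cmp C p w b c y) \<theta>"
proof -
  note D = coverD[OF assms(1)] forcesD[OF assms(2)]
  have "cmp C p w (prd C a b) c (tuple C w a b x y) = tuple C p a b (cmp C p w a c x) (cmp C p w b c y)"
    using D by (simp add: cmp_tuple)
  then show ?thesis
    using holds_cover[OF assms(1)] assms(2) D unfolding forces_iff_holds by force
qed

lemma forces_local:
  assumes "cover p \<chi>' w \<chi> c" "forces p \<chi>' a b (cmp C p w a c x) (cmp C p w b c y) \<theta>"
    and "w \<in> obj C" "\<chi> \<in> pred w" "x \<in> hom C w a" "y \<in> hom C w b"
  shows "forces w \<chi> a b x y \<theta>"
proof -
  note D = coverD[OF assms(1)] forcesD[OF assms(2)]
  have "cmp C p w (prd C a b) c (tuple C w a b x y) = tuple C p a b (cmp C p w a c x) (cmp C p w b c y)"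
    using D assms by (simp add: cmp_tuple)
  then have "holds w \<chi> (prd C a b) (tuple C w a b x y) \<theta>"
    using assms D by (intro holds_local[OF assms(1)]) (auto simp: forces_iff_holds)
  then show ?thesis using assms D unfolding forces_iff_holds by auto
qed

lemma forces_generic:
  assumes "a \<in> obj C" "b \<in> obj C" "\<theta> \<in> pred (prd C a b)"
  shows "forces (prd C a b) \<theta> a b (pr1 C a b) (pr2 C a b) \<theta>"
proof -
  have "tuple C (prd C a b) a b (pr1 C a b) (pr2 C a b) = idn C (prd C a b)"
    by (rule into_prd_eqI[of "prd C a b" a b]) (use assms in auto)
  then show ?thesis using assms unfolding forces_def by (auto simp: pb_idn)
qed

text \<open>Completeness of the semantics: the hypothesis is applied to the generic pair, the two
  projections at the stage with predicate \<open>\<theta>\<close>.\<close>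

lemma le_forcesI:
  assumes "a \<in> obj C" "b \<in> obj C" "\<theta> \<in> pred (prd C a b)" "\<theta>' \<in> pred (prd C a b)"
    and "\<And>w \<chi> x y. forces w \<chi> a b x y \<theta> \<Longrightarrow> forces w \<chi> a b x y \<theta>'"
  shows "(\<theta>, \<theta>') \<in> ob P (prd C a b)"
proof -
  have "tuple C (prd C a b) a b (pr1 C a b) (pr2 C a b) = idn C (prd C a b)"
    by (rule into_prd_eqI[of "prd C a b" a b]) (use assms in auto)
  then show ?thesis
    using assms(5)[OF forces_generic[OF assms(1-3)]] assms(1-4) unfolding forces_def by (simp add: pb_idn)
qed

lemma forces_le:
  assumes "(\<theta>, \<theta>') \<in> ob P (prd C a b)" "forces w \<chi> a b x y \<theta>"
  shows "forces w \<chi> a b x y \<theta>'"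
proof -
  note D = assms(2)[unfolded forces_def]
  have "(pb w (prd C a b) (tuple C w a b x y) \<theta>, pb w (prd C a b) (tuple C w a b x y) \<theta>') \<in> ob P w"
    using D assms(1) by (intro pb_mono) auto
  then show ?thesis
    using D le_pred(2)[OF assms(1)] le_trans unfolding forces_def by blast
qed

lemma forces_meet_iff:
  assumes "\<theta> \<in> pred (prd C a b)" "\<theta>' \<in> pred (prd C a b)"
  shows "forces w \<chi> a b x y (meet (prd C a b) \<theta> \<theta>') \<longleftrightarrow> forces w \<chi> a b x y \<theta> \<and> forces w \<chi> a b x y \<theta>'"
  using assms unfolding forces_def by (auto simp: le_meet_iff simp flip: im_le_iff)

definition dagger :: "'o \<Rightarrow> 'o \<Rightarrow> 'p \<Rightarrow> 'p"
  where "dagger a b \<theta> = pb (prd C b a) (prd C a b) (prod_swap C b a) \<theta>"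

lemma dagger_pred [simp]:
  "a \<in> obj C \<Longrightarrow> b \<in> obj C \<Longrightarrow> \<theta> \<in> pred (prd C a b) \<Longrightarrow> dagger a b \<theta> \<in> pred (prd C b a)"
  unfolding dagger_def prod_swap_def by simp

lemma forces_dagger_iff:
  assumes "a \<in> obj C" "b \<in> obj C" "\<theta> \<in> pred (prd C a b)"
  shows "forces w \<chi> b a y x (dagger a b \<theta>) \<longleftrightarrow> forces w \<chi> a b x y \<theta>"
proof (cases "w \<in> obj C \<and> x \<in> hom C w a \<and> y \<in> hom C w b")
  case True
  have "cmp C w (prd C b a) (prd C a b) (tuple C w b a y x) (prod_swap C b a) = tuple C w a b x y"
    unfolding prod_swap_def using True assms by (simp add: cmp_tuple)
  moreover have "prod_swap C b a \<in> hom C (prd C b a) (prd C a b)"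
    unfolding prod_swap_def using assms by simp
  ultimately have "pb w (prd C b a) (tuple C w b a y x) (dagger a b \<theta>) = pb w (prd C a b) (tuple C w a b x y) \<theta>"
    unfolding dagger_def using True assms by (simp flip: pb_cmp)
  then show ?thesis using assms unfolding forces_def by auto
qed (use assms in \<open>auto simp: forces_def\<close>)

text \<open>The graph of \<open>h\<close> cut down to arguments satisfying \<open>\<phi>\<close>.
  For \<open>h\<close> the identity this is the identity relation on
  \<open>(a, \<phi>)\<close>.\<close>

definition graph_of :: "'o \<Rightarrow> 'o \<Rightarrow> 'm \<Rightarrow> 'p \<Rightarrow> 'p"
  where "graph_of a b h \<phi> = im a (prd C a b) (tuple C a a b (idn C a) h) \<phi>"

lemma graph_of_pred [simp]:
  "a \<in> obj C \<Longrightarrow> b \<in> obj C \<Longrightarrow> h \<in> hom C a b \<Longrightarrow> \<phi> \<in> pred a \<Longrightarrow> graph_of a b h \<phi> \<in> pred (prd C a b)"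
  unfolding graph_of_def by simp

lemma forces_graph_intro:
  assumes "holds w \<chi> a x \<phi>" "b \<in> obj C" "h \<in> hom C a b"
  shows "forces w \<chi> a b x (cmp C w a b x h) (graph_of a b h \<phi>)"
proof -
  note D = assms(1)[unfolded holds_def]
  have "(\<chi>, pb w (prd C a b) (cmp C w a (prd C a b) x (tuple C a a b (idn C a) h)) (im a (prd C a b) (tuple C a a b (idn C a) h) \<phi>)) \<in> ob P w"
    using D assms(2,3) by (intro exists_intro) auto
  then show ?thesis
    using D assms(2,3) unfolding forces_def graph_of_def by (simp add: cmp_tuple)
qed

text \<open>The image defining the graph yields an element \<open>k\<close> of \<open>a\<close> on a
  cover; the first coordinate forces \<open>k\<close> to be the restriction of
  \<open>x\<close>.\<close>

lemma forces_graph_elim: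
  assumes "forces w \<chi> a b x y (graph_of a b h \<phi>)" "h \<in> hom C a b" "\<phi> \<in> pred a"
  obtains p \<chi>' c where "cover p \<chi>' w \<chi> c" "holds p \<chi>' a (cmp C p w a c x) \<phi>"
    "cmp C p w b c y = cmp C p a b (cmp C p w a c x) h"
proof -
  note D = assms(1)[unfolded forces_def graph_of_def]
  obtain p \<chi>' c k where p: "cover p \<chi>' w \<chi> c" "k \<in> hom C p a"
    and eq: "cmp C p a (prd C a b) k (tuple C a a b (idn C a) h) = cmp C p w (prd C a b) c (tuple C w a b x y)"
    and le: "(\<chi>', pb p a k \<phi>) \<in> ob P p"
    by (rule exists_elim[of w \<chi> a "prd C a b" "tuple C a a b (idn C a) h" "tuple C w a b x y" \<phi>])
      (use D assms(2,3) in auto)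
  note E = coverD[OF p(1)]
  have "k = cmp C p w a c x" "cmp C p a b k h = cmp C p w b c y"
    using arg_cong[OF eq, of "\<lambda>q. cmp C p (prd C a b) a q (pr1 C a b)"]
      arg_cong[OF eq, of "\<lambda>q. cmp C p (prd C a b) b q (pr2 C a b)"] D E p(2) assms(2) by auto
  then show thesis
    using that[OF p(1)] le D E p(2) assms(3) unfolding holds_def by auto
qed

lemma diag_graph: "im a (prd C a a) (diag C a) \<phi> = graph_of a a (idn C a) \<phi>"
  unfolding graph_of_def diag_def ..

lemma forces_idn_intro:
  assumes "holds w \<chi> a x \<phi>"
  shows "forces w \<chi> a a x x (graph_of a a (idn C a) \<phi>)"
  using forces_graph_intro[OF assms, of a "idn C a"] holdsD[OF assms] by simp

lemma forces_idn_elim: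
  assumes "forces w \<chi> a a x y (graph_of a a (idn C a) \<phi>)" "\<phi> \<in> pred a"
  obtains p \<chi>' c where "cover p \<chi>' w \<chi> c" "holds p \<chi>' a (cmp C p w a c x) \<phi>" "cmp C p w a c y = cmp C p w a c x"
proof -
  note D = forcesD[OF assms(1)]
  obtain p \<chi>' c where p: "cover p \<chi>' w \<chi> c" "holds p \<chi>' a (cmp C p w a c x) \<phi>"
    "cmp C p w a c y = cmp C p a a (cmp C p w a c x) (idn C a)"
    by (rule forces_graph_elim[OF assms(1) _ assms(2)]) (use D in auto)
  then show thesis using that[OF p(1,2)] coverD[OF p(1)] D by simp
qed

end

section \<open>Composition of internal relations and graphs of morphisms\<close>

context doctrine
begin

text \<open>This is \<open>\<exists>y. \<theta>(x, y) \<and> \<theta>'(y, z)\<close> over the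
  product with coordinates \<open>f\<close>, \<open>g\<close>, \<open>h\<close>. Tuples make it
  meaningful without strictly associative products; for contexts it agrees with
  \<open>intrel_comp\<close>.\<close>

definition rcomp :: "'o \<Rightarrow> 'o \<Rightarrow> 'o \<Rightarrow> 'p \<Rightarrow> 'p \<Rightarrow> 'p"
  where "rcomp a b c \<theta> \<theta>' =
    (let w = prd C (prd C a b) c;
         f = cmp C w (prd C a b) a (pr1 C (prd C a b) c) (pr1 C a b);
         g = cmp C w (prd C a b) b (pr1 C (prd C a b) c) (pr2 C a b);
         h = pr2 C (prd C a b) c
     in im w (prd C a c) (tuple C w a c f h)
          (pb w (prd C (prd C a b) (prd C b c)) (tuple C w (prd C a b) (prd C b c) (tuple C w a b f g) (tuple C w b c g h))
            (lax P (prd C a b) (prd C b c) (\<theta>, \<theta>'))))"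

context
  fixes a b c :: 'o and \<theta> \<theta>' :: 'p
  assumes o [simp]: "a \<in> obj C" "b \<in> obj C" "c \<in> obj C"
    and th [simp]: "\<theta> \<in> pred (prd C a b)" "\<theta>' \<in> pred (prd C b c)"
begin

lemma rcomp_pred [simp]: "rcomp a b c \<theta> \<theta>' \<in> pred (prd C a c)"
  unfolding rcomp_def by (simp add: Let_def)

lemma forces_rcomp_intro:
  assumes "forces w \<chi> a b x y \<theta>" "forces w \<chi> b c y z \<theta>'"
  shows "forces w \<chi> a c x z (rcomp a b c \<theta> \<theta>')"
proof -
  note D = assms[unfolded forces_def]
  let ?w = "prd C (prd C a b) c"
  let ?f = "cmp C ?w (prd C a b) a (pr1 C (prd C a b) c) (pr1 C a b)"
  let ?g = "cmp C ?w (prd C a b) b (pr1 C (prd C a b) c) (pr2 C a b)"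
  let ?h = "pr2 C (prd C a b) c"
  let ?del = "tuple C ?w a c ?f ?h"
  let ?dup = "tuple C ?w (prd C a b) (prd C b c) (tuple C ?w a b ?f ?g) (tuple C ?w b c ?g ?h)"
  let ?l = "lax P (prd C a b) (prd C b c) (\<theta>, \<theta>')"
  \<comment> \<open>The point \<open>((x, y), z)\<close> witnesses the quantifier.\<close>
  let ?k = "tuple C w (prd C a b) c (tuple C w a b x y) z"
  have k: "?k \<in> hom C w ?w" using D by simp
  have dup: "cmp C w ?w (prd C (prd C a b) (prd C b c)) ?k ?dup =
      tuple C w (prd C a b) (prd C b c) (tuple C w a b x y) (tuple C w b c y z)"
    using D by (simp add: cmp_tuple)
  have del: "cmp C w ?w (prd C a c) ?k ?del = tuple C w a c x z"
    using D by (simp add: cmp_tuple)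
  have "(\<chi>, pb w (prd C (prd C a b) (prd C b c)) (cmp C w ?w (prd C (prd C a b) (prd C b c)) ?k ?dup) ?l) \<in> ob P w"
    unfolding dup using D by (subst le_pb_lax_iff) auto
  then have "(\<chi>, pb w ?w ?k (pb ?w (prd C (prd C a b) (prd C b c)) ?dup ?l)) \<in> ob P w"
    using D k by (subst (asm) pb_cmp) auto
  then have "(\<chi>, pb w (prd C a c) (cmp C w ?w (prd C a c) ?k ?del)
      (im ?w (prd C a c) ?del (pb ?w (prd C (prd C a b) (prd C b c)) ?dup ?l))) \<in> ob P w"
    using D k by (intro exists_intro) auto
  then show ?thesis
    unfolding del using D by (simp add: forces_def) (simp add: rcomp_def Let_def)
qed

lemma forces_rcomp_elim:
  assumes "forces w \<chi> a c x z (rcomp a b c \<theta> \<theta>')"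
  obtains p \<chi>' k y where "cover p \<chi>' w \<chi> k" "forces p \<chi>' a b (cmp C p w a k x) y \<theta>"
    "forces p \<chi>' b c y (cmp C p w c k z) \<theta>'"
proof -
  note D = forcesD[OF assms]
  let ?w = "prd C (prd C a b) c"
  let ?f = "cmp C ?w (prd C a b) a (pr1 C (prd C a b) c) (pr1 C a b)"
  let ?g = "cmp C ?w (prd C a b) b (pr1 C (prd C a b) c) (pr2 C a b)"
  let ?h = "pr2 C (prd C a b) c"
  let ?del = "tuple C ?w a c ?f ?h"
  let ?dup = "tuple C ?w (prd C a b) (prd C b c) (tuple C ?w a b ?f ?g) (tuple C ?w b c ?g ?h)"
  let ?l = "lax P (prd C a b) (prd C b c) (\<theta>, \<theta>')"
  have "(\<chi>, pb w (prd C a c) (tuple C w a c x z) (im ?w (prd C a c) ?del (pb ?w (prd C (prd C a b) (prd C b c)) ?dup ?l))) \<in> ob P w"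
    using assms unfolding forces_def rcomp_def Let_def by blast
  then obtain p \<chi>' k q where k: "cover p \<chi>' w \<chi> k" and q: "q \<in> hom C p ?w"
    and eq: "cmp C p ?w (prd C a c) q ?del = cmp C p w (prd C a c) k (tuple C w a c x z)"
    and le: "(\<chi>', pb p ?w q (pb ?w (prd C (prd C a b) (prd C b c)) ?dup ?l)) \<in> ob P p"
    by (rule exists_elim[rotated 7]) (use D in auto)
  note E = coverD[OF k]
  have f: "cmp C p ?w a q ?f = cmp C p w a k x" and h: "cmp C p ?w c q ?h = cmp C p w c k z"
    using arg_cong[OF eq, of "\<lambda>q. cmp C p (prd C a c) a q (pr1 C a c)"]
      arg_cong[OF eq, of "\<lambda>q. cmp C p (prd C a c) c q (pr2 C a c)"] D E q by auto
  \<comment> \<open>The intermediate element is the middle coordinate of the point \<open>q\<close>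
    found on the cover; the outer two are fixed by \<open>eq\<close>.\<close>
  let ?y = "cmp C p ?w b q ?g"
  have y: "?y \<in> hom C p b" using E q by simp
  have kx: "cmp C p w a k x \<in> hom C p a" "cmp C p w c k z \<in> hom C p c" using D E by auto
  have "cmp C p ?w (prd C (prd C a b) (prd C b c)) q ?dup =
      tuple C p (prd C a b) (prd C b c) (tuple C p a b (cmp C p ?w a q ?f) ?y) (tuple C p b c ?y (cmp C p ?w c q ?h))"
    using E q by (simp add: cmp_tuple)
  then have dup: "cmp C p ?w (prd C (prd C a b) (prd C b c)) q ?dup =
      tuple C p (prd C a b) (prd C b c) (tuple C p a b (cmp C p w a k x) ?y) (tuple C p b c ?y (cmp C p w c k z))"
    unfolding f h .
  have "(\<chi>', pb p (prd C (prd C a b) (prd C b c)) (cmp C p ?w (prd C (prd C a b) (prd C b c)) q ?dup) ?l) \<in> ob P p"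
    using le E q by (subst pb_cmp) auto
  then have "(\<chi>', pb p (prd C a b) (tuple C p a b (cmp C p w a k x) ?y) \<theta>) \<in> ob P p"
    "(\<chi>', pb p (prd C b c) (tuple C p b c ?y (cmp C p w c k z)) \<theta>') \<in> ob P p"
    unfolding dup using E y kx by (subst (asm) le_pb_lax_iff; simp del: cmp_assoc)+
  then show thesis
    using E y kx by (intro that[OF k, of ?y]) (auto simp: forces_def simp del: cmp_assoc)
qed

end

text \<open>A morphism carrying \<open>\<phi>\<close> into \<open>\<psi>\<close> induces a map of
  internal relations: its restricted graph is total, single-valued and supported on the two
  predicates. This is needed for the projections and for the morphism to the terminal
  object.\<close>

lemma map_relations:
  assumes a: "a \<in> obj C" "b \<in> obj C" "h \<in> hom C a b" "\<phi> \<in> pred a" and \<psi>: "\<psi> \<in> pred b" and le: "(\<phi>, pb a b h \<psi>) \<in> ob P a"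
  shows "(graph_of a a (idn C a) \<phi>, rcomp a b a (graph_of a b h \<phi>) (dagger a b (graph_of a b h \<phi>))) \<in> ob P (prd C a a)"
    and "(rcomp b a b (dagger a b (graph_of a b h \<phi>)) (graph_of a b h \<phi>), graph_of b b (idn C b) \<psi>) \<in> ob P (prd C b b)"
    and "\<And>w \<chi> x y. forces w \<chi> a b x y (graph_of a b h \<phi>) \<Longrightarrow> holds w \<chi> a x \<phi> \<and> holds w \<chi> b y \<psi>"
proof -
  have push: "holds w \<chi> b (cmp C w a b x h) \<psi>" if "holds w \<chi> a x \<phi>" for w \<chi> x
  proof -
    note D = that[unfolded holds_def]
    have "(pb w a x \<phi>, pb w a x (pb a b h \<psi>)) \<in> ob P w" using D a le by (intro pb_mono) auto
    then have "(\<chi>, pb w b (cmp C w a b x h) \<psi>) \<in> ob P w"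
      using D a \<psi> pb_cmp[of w a b x h \<psi>] le_trans[of w \<chi> "pb w a x \<phi>"] by auto
    then show ?thesis using D a \<psi> unfolding holds_def by auto
  qed
  let ?g = "graph_of a b h \<phi>"
  have g: "?g \<in> pred (prd C a b)" using a by simp
  show "(graph_of a a (idn C a) \<phi>, rcomp a b a ?g (dagger a b ?g)) \<in> ob P (prd C a a)"
  proof (rule le_forcesI)
    fix w \<chi> x y assume f: "forces w \<chi> a a x y (graph_of a a (idn C a) \<phi>)"
    note D = forcesD[OF f]
    obtain p \<chi>' c where c: "cover p \<chi>' w \<chi> c" and hx: "holds p \<chi>' a (cmp C p w a c x) \<phi>" and eq: "cmp C p w a c y = cmp C p w a c x"
      by (rule forces_idn_elim[OF f a(4)])
    have 1: "forces p \<chi>' a b (cmp C p w a c x) (cmp C p a b (cmp C p w a c x) h) ?g"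
      by (rule forces_graph_intro[OF hx a(2,3)])
    have "forces p \<chi>' a a (cmp C p w a c x) (cmp C p w a c x) (rcomp a b a ?g (dagger a b ?g))"
      by (rule forces_rcomp_intro[OF a(1,2,1) g _ 1]) (use 1 a g forces_dagger_iff in auto)
    then show "forces w \<chi> a a x y (rcomp a b a ?g (dagger a b ?g))"
      by (intro forces_local[OF c]) (use D eq in auto)
  qed (use a in auto)
  show "(rcomp b a b (dagger a b ?g) ?g, graph_of b b (idn C b) \<psi>) \<in> ob P (prd C b b)"
  proof (rule le_forcesI)
    fix w \<chi> y z assume f: "forces w \<chi> b b y z (rcomp b a b (dagger a b ?g) ?g)"
    note D = forcesD[OF f]
    obtain p \<chi>' c x where c: "cover p \<chi>' w \<chi> c" and 1: "forces p \<chi>' b a (cmp C p w b c y) x (dagger a b ?g)"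
      and 2: "forces p \<chi>' a b x (cmp C p w b c z) ?g"
      by (rule forces_rcomp_elim[OF a(2,1,2) _ g f]) (use a in auto)
    have 1: "forces p \<chi>' a b x (cmp C p w b c y) ?g" using 1 forces_dagger_iff[OF a(1,2) g] by blast
    note E = coverD[OF c] forcesD[OF 1]
    \<comment> \<open>Both values are traced back to the same \<open>x\<close>: on one cover
      \<open>y\<close> becomes its image under \<open>h\<close>, and on a further cover so does
      \<open>z\<close>.\<close>
    obtain q \<chi>2 d where d: "cover q \<chi>2 p \<chi>' d" and h1: "holds q \<chi>2 a (cmp C q p a d x) \<phi>"
      and e1: "cmp C q p b d (cmp C p w b c y) = cmp C q a b (cmp C q p a d x) h"
      by (rule forces_graph_elim[OF 1 a(3,4)])
    note E2 = coverD[OF d]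
    obtain r \<chi>3 k where k: "cover r \<chi>3 q \<chi>2 k" and h2: "holds r \<chi>3 a (cmp C r q a k (cmp C q p a d x)) \<phi>"
      and e2: "cmp C r q b k (cmp C q p b d (cmp C p w b c z)) = cmp C r a b (cmp C r q a k (cmp C q p a d x)) h"
      by (rule forces_graph_elim[OF forces_cover[OF d 2] a(3,4)])
    note E3 = coverD[OF k]
    let ?u = "cmp C r q a k (cmp C q p a d x)"
    have u: "?u \<in> hom C r a" using E E2 E3 by simp
    have y: "cmp C r q b k (cmp C q p b d (cmp C p w b c y)) = cmp C r a b ?u h"
      unfolding e1 using E E2 E3 a by simp
    have "forces r \<chi>3 b b (cmp C r a b ?u h) (cmp C r a b ?u h) (graph_of b b (idn C b) \<psi>)"
      by (rule forces_idn_intro[OF push[OF h2]])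
    then have "forces r \<chi>3 b b (cmp C r q b k (cmp C q p b d (cmp C p w b c y)))
        (cmp C r q b k (cmp C q p b d (cmp C p w b c z))) (graph_of b b (idn C b) \<psi>)"
      unfolding y e2 .
    then show "forces w \<chi> b b y z (graph_of b b (idn C b) \<psi>)"
      by (intro forces_local[OF c] forces_local[OF d] forces_local[OF k]) (use D E E2 in auto)
  qed (use a \<psi> in auto)
  fix w \<chi> x y assume f: "forces w \<chi> a b x y ?g"
  note D = forcesD[OF f]
  obtain p \<chi>' c where c: "cover p \<chi>' w \<chi> c" and hx: "holds p \<chi>' a (cmp C p w a c x) \<phi>"
    and eq: "cmp C p w b c y = cmp C p a b (cmp C p w a c x) h"
    by (rule forces_graph_elim[OF f a(3,4)])
  show "holds w \<chi> a x \<phi> \<and> holds w \<chi> b y \<psi>"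
    using holds_local[OF c hx] holds_local[OF c push[OF hx, folded eq]] D by blast
qed

text \<open>By adjointness the hom condition puts \<open>\<theta>\<close> below both substituted
  predicates. On generalized elements this is an implication, and the generic pair gives the
  converse.\<close>

lemma le_pb_pr_iff:
  assumes "a \<in> obj C" "b \<in> obj C" "\<theta> \<in> pred (prd C a b)" "\<phi> \<in> pred a" "\<psi> \<in> pred b"
  shows "(im (prd C a b) a (pr1 C a b) \<theta>, \<phi>) \<in> ob P a \<and> (im (prd C a b) b (pr2 C a b) \<theta>, \<psi>) \<in> ob P b \<longleftrightarrow>
    (\<forall>w \<chi> x y. forces w \<chi> a b x y \<theta> \<longrightarrow> holds w \<chi> a x \<phi> \<and> holds w \<chi> b y \<psi>)" (is "?L \<longleftrightarrow> ?R")
proof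
  assume L: ?L
  show ?R
  proof (intro allI impI)
    fix w \<chi> x y assume f: "forces w \<chi> a b x y \<theta>"
    note D = f[unfolded forces_def]
    have t: "tuple C w a b x y \<in> hom C w (prd C a b)" using D by simp
    have "(\<theta>, pb (prd C a b) a (pr1 C a b) \<phi>) \<in> ob P (prd C a b)" "(\<theta>, pb (prd C a b) b (pr2 C a b) \<psi>) \<in> ob P (prd C a b)"
      using L assms by (auto simp: im_le_iff)
    then have "(pb w (prd C a b) (tuple C w a b x y) \<theta>, pb w (prd C a b) (tuple C w a b x y) (pb (prd C a b) a (pr1 C a b) \<phi>)) \<in> ob P w"
      "(pb w (prd C a b) (tuple C w a b x y) \<theta>, pb w (prd C a b) (tuple C w a b x y) (pb (prd C a b) b (pr2 C a b) \<psi>)) \<in> ob P w"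
      using D t by (auto intro: pb_mono)
    moreover have "pb w (prd C a b) (tuple C w a b x y) (pb (prd C a b) a (pr1 C a b) \<phi>) = pb w a x \<phi>"
      "pb w (prd C a b) (tuple C w a b x y) (pb (prd C a b) b (pr2 C a b) \<psi>) = pb w b y \<psi>"
      using D t assms by (simp_all flip: pb_cmp)
    ultimately show "holds w \<chi> a x \<phi> \<and> holds w \<chi> b y \<psi>"
      using D assms le_trans unfolding holds_def by metis
  qed
next
  assume ?R
  then show ?L
    using forces_generic[OF assms(1-3)] assms unfolding holds_def by (auto simp: im_le_iff)
qed

end

section \<open>Allegory laws and tabulations, verified on generalized elements\<close>

context doctrine
begin

lemma eq_forcesI:
  assumes "a \<in> obj C" "b \<in> obj C" "\<theta> \<in> pred (prd C a b)" "\<theta>' \<in> pred (prd C a b)"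
    and "\<And>w \<chi> x y. forces w \<chi> a b x y \<theta> \<Longrightarrow> forces w \<chi> a b x y \<theta>'"
    and "\<And>w \<chi> x y. forces w \<chi> a b x y \<theta>' \<Longrightarrow> forces w \<chi> a b x y \<theta>"
  shows "\<theta> = \<theta>'"
  using assms by (auto intro!: le_antisym[of "prd C a b"] le_forcesI)

lemma cover_cmp:
  assumes "cover p \<chi>' w \<chi> c" "cover q \<chi>2 p \<chi>' d" "w \<in> obj C" "\<chi> \<in> pred w"
  shows "cover q \<chi>2 w \<chi> (cmp C q p w d c)"
proof -
  note D = assms[unfolded cover_def]
  have "(\<chi>2, pb q w (cmp C q p w d c) \<chi>) \<in> ob P q"
    using D pb_mono[of q p d \<chi>' "pb p w c \<chi>"] le_trans[of q \<chi>2] pb_cmp[of q p w d c \<chi>] by auto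
  moreover have "(\<chi>, im q w (cmp C q p w d c) \<chi>2) \<in> ob P w"
  proof -
    \<comment> \<open>The bound on \<open>\<chi>\<close> is a local statement about the element
      \<open>idn C w\<close>, so it may be checked after passing to both covers.\<close>
    have "holds w \<chi> w (idn C w) (im q w (cmp C q p w d c) \<chi>2)"
    proof (rule holds_local[OF assms(1)], rule holds_local[OF assms(2)])
      show "holds q \<chi>2 w (cmp C q p w d (cmp C p w w c (idn C w))) (im q w (cmp C q p w d c) \<chi>2)"
        using D im_pb_unit[of q w "cmp C q p w d c" \<chi>2] unfolding holds_def by auto
    qed (use D in auto)
    then show ?thesis using D by (simp add: holds_def pb_idn)
  qed
  ultimately show ?thesis using D by (auto simp: cover_def)
qed

text \<open>The hom-set from \<open>(a, \<phi>)\<close> to \<open>(b, \<psi>)\<close>, with the two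
  image conditions restated on elements.\<close>

definition internal_rels :: "'o \<Rightarrow> 'p \<Rightarrow> 'o \<Rightarrow> 'p \<Rightarrow> 'p set"
  where "internal_rels a \<phi> b \<psi> = {\<theta> \<in> pred (prd C a b).
    \<forall>w \<chi> x y. forces w \<chi> a b x y \<theta> \<longrightarrow> holds w \<chi> a x \<phi> \<and> holds w \<chi> b y \<psi>}"

lemma internal_rels_pred: "\<theta> \<in> internal_rels a \<phi> b \<psi> \<Longrightarrow> \<theta> \<in> pred (prd C a b)"
  unfolding internal_rels_def by simp

lemma internal_rels_holds:
  "\<theta> \<in> internal_rels a \<phi> b \<psi> \<Longrightarrow> forces w \<chi> a b x y \<theta> \<Longrightarrow> holds w \<chi> a x \<phi>"
  "\<theta> \<in> internal_rels a \<phi> b \<psi> \<Longrightarrow> forces w \<chi> a b x y \<theta> \<Longrightarrow> holds w \<chi> b y \<psi>"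
  unfolding internal_rels_def by auto

lemma graph_of_internal:
  assumes "a \<in> obj C" "b \<in> obj C" "h \<in> hom C a b" "\<phi> \<in> pred a" "\<psi> \<in> pred b" "(\<phi>, pb a b h \<psi>) \<in> ob P a"
  shows "graph_of a b h \<phi> \<in> internal_rels a \<phi> b \<psi>"
  unfolding internal_rels_def using map_relations(3)[OF assms] assms by simp

lemma idn_internal: "a \<in> obj C \<Longrightarrow> \<phi> \<in> pred a \<Longrightarrow> graph_of a a (idn C a) \<phi> \<in> internal_rels a \<phi> a \<phi>"
  by (intro graph_of_internal) (auto simp: pb_idn)

lemma rcomp_internal:
  assumes o: "a \<in> obj C" "b \<in> obj C" "c \<in> obj C" and r: "r \<in> internal_rels a \<phi> b \<psi>" and s: "s \<in> internal_rels b \<psi> c \<xi>"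
  shows "rcomp a b c r s \<in> internal_rels a \<phi> c \<xi>"
proof -
  note p = internal_rels_pred[OF r] internal_rels_pred[OF s]
  have "holds w \<chi> a x \<phi> \<and> holds w \<chi> c z \<xi>" if f: "forces w \<chi> a c x z (rcomp a b c r s)" for w \<chi> x z
  proof -
    obtain p \<chi>' k y where k: "cover p \<chi>' w \<chi> k" and 1: "forces p \<chi>' a b (cmp C p w a k x) y r"
      and 2: "forces p \<chi>' b c y (cmp C p w c k z) s"
      by (rule forces_rcomp_elim[OF o p f])
    show ?thesis
      using holds_local[OF k internal_rels_holds(1)[OF r 1]] holds_local[OF k internal_rels_holds(2)[OF s 2]] forcesD[OF f]
      by blast
  qed
  then show ?thesis unfolding internal_rels_def using rcomp_pred[OF o p] by simp
qed

text \<open>The identity is equality restricted to \<open>\<phi>\<close>. Introducing it uses that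
  \<open>r\<close> relates only elements satisfying \<open>\<phi>\<close>; eliminating it makes the
  intermediate element equal to \<open>x\<close> on a cover.\<close>

lemma rcomp_idn_left:
  assumes o: "a \<in> obj C" "b \<in> obj C" and \<phi>: "\<phi> \<in> pred a" and r: "r \<in> internal_rels a \<phi> b \<psi>"
  shows "rcomp a a b (graph_of a a (idn C a) \<phi>) r = r"
proof (rule eq_forcesI)
  note p = internal_rels_pred[OF r]
  have i: "graph_of a a (idn C a) \<phi> \<in> pred (prd C a a)" using o \<phi> by simp
  show "rcomp a a b (graph_of a a (idn C a) \<phi>) r \<in> pred (prd C a b)" by (rule rcomp_pred[OF o(1,1,2) i p])
  fix w \<chi> x y
  show "forces w \<chi> a b x y (rcomp a a b (graph_of a a (idn C a) \<phi>) r)" if f: "forces w \<chi> a b x y r"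
    by (rule forces_rcomp_intro[OF o(1,1,2) i p forces_idn_intro[OF internal_rels_holds(1)[OF r f]] f])
  assume f: "forces w \<chi> a b x y (rcomp a a b (graph_of a a (idn C a) \<phi>) r)"
  obtain p \<chi>' k u where k: "cover p \<chi>' w \<chi> k" and 1: "forces p \<chi>' a a (cmp C p w a k x) u (graph_of a a (idn C a) \<phi>)"
    and 2: "forces p \<chi>' a b u (cmp C p w b k y) r"
    by (rule forces_rcomp_elim[OF o(1,1,2) i p f])
  obtain q \<chi>2 l where l: "cover q \<chi>2 p \<chi>' l" and eq: "cmp C q p a l u = cmp C q p a l (cmp C p w a k x)"
    by (rule forces_idn_elim[OF 1 \<phi>])
  note D = forcesD[OF f] coverD[OF k] coverD[OF l]
  show "forces w \<chi> a b x y r"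
    by (intro forces_local[OF k] forces_local[OF l] forces_cover[OF l 2, unfolded eq]) (use D in auto)
qed (use o internal_rels_pred[OF r] in auto)

lemma dagger_internal:
  assumes o: "a \<in> obj C" "b \<in> obj C" and r: "r \<in> internal_rels a \<phi> b \<psi>"
  shows "dagger a b r \<in> internal_rels b \<psi> a \<phi>"
  using o r internal_rels_pred[OF r] unfolding internal_rels_def by (auto simp: forces_dagger_iff)

lemma dagger_dagger:
  assumes "a \<in> obj C" "b \<in> obj C" "r \<in> pred (prd C a b)"
  shows "dagger b a (dagger a b r) = r"
  by (rule eq_forcesI[of a b]) (use assms in \<open>auto simp: forces_dagger_iff\<close>)

lemma dagger_mono:
  assumes "a \<in> obj C" "b \<in> obj C" "(r, s) \<in> ob P (prd C a b)"
  shows "(dagger a b r, dagger a b s) \<in> ob P (prd C b a)"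
  by (rule le_forcesI)
    (use assms le_pred[OF assms(3)] in \<open>auto simp: forces_dagger_iff intro: forces_le\<close>)

lemma dagger_idn:
  assumes "a \<in> obj C" "\<phi> \<in> pred a"
  shows "dagger a a (graph_of a a (idn C a) \<phi>) = graph_of a a (idn C a) \<phi>"
proof -
  let ?i = "graph_of a a (idn C a) \<phi>"
  have i: "?i \<in> pred (prd C a a)" using assms by simp
  have sym: "forces w \<chi> a a y x ?i" if f: "forces w \<chi> a a x y ?i" for w \<chi> x y
  proof -
    obtain p \<chi>' c where c: "cover p \<chi>' w \<chi> c" and hx: "holds p \<chi>' a (cmp C p w a c x) \<phi>" and eq: "cmp C p w a c y = cmp C p w a c x"
      by (rule forces_idn_elim[OF f assms(2)])
    show ?thesis
      by (rule forces_local[OF c]) (use forces_idn_intro[OF hx] eq forcesD[OF f] in auto)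
  qed
  show ?thesis
    by (rule eq_forcesI[of a a]) (use assms i sym in \<open>auto simp: forces_dagger_iff\<close>)
qed

lemma dagger_rcomp:
  assumes o: "a \<in> obj C" "b \<in> obj C" "c \<in> obj C" and r: "r \<in> pred (prd C a b)" and s: "s \<in> pred (prd C b c)"
  shows "dagger a c (rcomp a b c r s) = rcomp c b a (dagger b c s) (dagger a b r)"
proof (rule eq_forcesI)
  have d: "dagger b c s \<in> pred (prd C c b)" "dagger a b r \<in> pred (prd C b a)" using o r s by auto
  show "dagger a c (rcomp a b c r s) \<in> pred (prd C c a)" "rcomp c b a (dagger b c s) (dagger a b r) \<in> pred (prd C c a)"
    using o r s d by (auto intro: rcomp_pred)
  fix w \<chi> z x
  show "forces w \<chi> c a z x (rcomp c b a (dagger b c s) (dagger a b r))" if "forces w \<chi> c a z x (dagger a c (rcomp a b c r s))"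
  proof -
    have f: "forces w \<chi> a c x z (rcomp a b c r s)"
      using that o r s by (simp add: forces_dagger_iff rcomp_pred)
    obtain p \<chi>' k y where k: "cover p \<chi>' w \<chi> k" and 1: "forces p \<chi>' a b (cmp C p w a k x) y r"
      and 2: "forces p \<chi>' b c y (cmp C p w c k z) s"
      by (rule forces_rcomp_elim[OF o r s f])
    have "forces p \<chi>' c a (cmp C p w c k z) (cmp C p w a k x) (rcomp c b a (dagger b c s) (dagger a b r))"
      by (rule forces_rcomp_intro[OF o(3,2,1) d]) (use 1 2 o r s in \<open>auto simp: forces_dagger_iff\<close>)
    then show ?thesis by (rule forces_local[OF k]) (use forcesD[OF f] in auto)
  qed
  show "forces w \<chi> c a z x (dagger a c (rcomp a b c r s))" if f: "forces w \<chi> c a z x (rcomp c b a (dagger b c s) (dagger a b r))"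
  proof -
    obtain p \<chi>' k y where k: "cover p \<chi>' w \<chi> k" and 1: "forces p \<chi>' c b (cmp C p w c k z) y (dagger b c s)"
      and 2: "forces p \<chi>' b a y (cmp C p w a k x) (dagger a b r)"
      by (rule forces_rcomp_elim[OF o(3,2,1) d f])
    have "forces p \<chi>' a c (cmp C p w a k x) (cmp C p w c k z) (rcomp a b c r s)"
      by (rule forces_rcomp_intro[OF o r s]) (use 1 2 o r s in \<open>auto simp: forces_dagger_iff\<close>)
    then have "forces w \<chi> a c x z (rcomp a b c r s)" by (rule forces_local[OF k]) (use forcesD[OF f] in auto)
    then show ?thesis using o r s by (simp add: forces_dagger_iff rcomp_pred)
  qed
qed (use o in auto)

text \<open>The left unit law for the converse relation.\<close>

lemma rcomp_idn_right:
  assumes o: "a \<in> obj C" "b \<in> obj C" and \<psi>: "\<psi> \<in> pred b" and r: "r \<in> internal_rels a \<phi> b \<psi>"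
  shows "rcomp a b b r (graph_of b b (idn C b) \<psi>) = r"
proof -
  have p: "r \<in> pred (prd C a b)" "graph_of b b (idn C b) \<psi> \<in> pred (prd C b b)"
    using internal_rels_pred[OF r] o \<psi> by auto
  have "dagger a b (rcomp a b b r (graph_of b b (idn C b) \<psi>)) = dagger a b r"
    using o p \<psi> rcomp_idn_left[OF o(2,1) \<psi> dagger_internal[OF o r]] by (simp add: dagger_rcomp dagger_idn)
  then show ?thesis using dagger_dagger o p rcomp_pred[OF o(1,2,2) p] by metis
qed

text \<open>The witness of the inner composite exists on a second cover, to which the relation found
  on the first one is restricted before regrouping.\<close>

lemma rcomp_assoc:
  assumes o: "a \<in> obj C" "b \<in> obj C" "c \<in> obj C" "d \<in> obj C"
    and r: "r \<in> pred (prd C a b)" and s: "s \<in> pred (prd C b c)" and t: "t \<in> pred (prd C c d)"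
  shows "rcomp a c d (rcomp a b c r s) t = rcomp a b d r (rcomp b c d s t)"
proof (rule eq_forcesI)
  note rs = rcomp_pred[OF o(1,2,3) r s] and st = rcomp_pred[OF o(2,3,4) s t]
  show "rcomp a c d (rcomp a b c r s) t \<in> pred (prd C a d)" "rcomp a b d r (rcomp b c d s t) \<in> pred (prd C a d)"
    by (rule rcomp_pred[OF o(1,3,4) rs t], rule rcomp_pred[OF o(1,2,4) r st])
  fix w \<chi> x z
  show "forces w \<chi> a d x z (rcomp a b d r (rcomp b c d s t))" if f: "forces w \<chi> a d x z (rcomp a c d (rcomp a b c r s) t)"
  proof -
    obtain p \<chi>' k v where k: "cover p \<chi>' w \<chi> k" and 1: "forces p \<chi>' a c (cmp C p w a k x) v (rcomp a b c r s)"
      and 2: "forces p \<chi>' c d v (cmp C p w d k z) t"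
      by (rule forces_rcomp_elim[OF o(1,3,4) rs t f])
    obtain q \<chi>2 l u where l: "cover q \<chi>2 p \<chi>' l" and 3: "forces q \<chi>2 a b (cmp C q p a l (cmp C p w a k x)) u r"
      and 4: "forces q \<chi>2 b c u (cmp C q p c l v) s"
      by (rule forces_rcomp_elim[OF o(1,2,3) r s 1])
    note g = forces_rcomp_intro[OF o(1,2,4) r st 3 forces_rcomp_intro[OF o(2,3,4) s t 4 forces_cover[OF l 2]]]
    show ?thesis
      by (intro forces_local[OF k] forces_local[OF l g]) (use forcesD[OF f] coverD[OF k] in auto)
  qed
  show "forces w \<chi> a d x z (rcomp a c d (rcomp a b c r s) t)" if f: "forces w \<chi> a d x z (rcomp a b d r (rcomp b c d s t))"
  proof -
    obtain p \<chi>' k u where k: "cover p \<chi>' w \<chi> k" and 1: "forces p \<chi>' a b (cmp C p w a k x) u r"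
      and 2: "forces p \<chi>' b d u (cmp C p w d k z) (rcomp b c d s t)"
      by (rule forces_rcomp_elim[OF o(1,2,4) r st f])
    obtain q \<chi>2 l v where l: "cover q \<chi>2 p \<chi>' l" and 3: "forces q \<chi>2 b c (cmp C q p b l u) v s"
      and 4: "forces q \<chi>2 c d v (cmp C q p d l (cmp C p w d k z)) t"
      by (rule forces_rcomp_elim[OF o(2,3,4) s t 2])
    note g = forces_rcomp_intro[OF o(1,3,4) rs t forces_rcomp_intro[OF o(1,2,3) r s forces_cover[OF l 1] 3] 4]
    show ?thesis
      by (intro forces_local[OF k] forces_local[OF l g]) (use forcesD[OF f] coverD[OF k] in auto)
  qed
qed (use o in auto)

lemma rcomp_mono:
  assumes o: "a \<in> obj C" "b \<in> obj C" "c \<in> obj C" and r: "(r, r') \<in> ob P (prd C a b)" and s: "(s, s') \<in> ob P (prd C b c)"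
  shows "(rcomp a b c r s, rcomp a b c r' s') \<in> ob P (prd C a c)"
proof (rule le_forcesI)
  note p = le_pred[OF r] le_pred[OF s]
  show "rcomp a b c r s \<in> pred (prd C a c)" "rcomp a b c r' s' \<in> pred (prd C a c)"
    using o p by (auto intro: rcomp_pred)
  fix w \<chi> x z assume f: "forces w \<chi> a c x z (rcomp a b c r s)"
  obtain p \<chi>' k y where k: "cover p \<chi>' w \<chi> k" and 1: "forces p \<chi>' a b (cmp C p w a k x) y r"
    and 2: "forces p \<chi>' b c y (cmp C p w c k z) s"
    by (rule forces_rcomp_elim[OF o p(1,3) f])
  show "forces w \<chi> a c x z (rcomp a b c r' s')"
    by (rule forces_local[OF k forces_rcomp_intro[OF o p(2,4) forces_le[OF r 1] forces_le[OF s 2]]]) (use forcesD[OF f] in auto)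
qed (use o in auto)

text \<open>The \<open>y\<close> witnessing the composite of \<open>r\<close> and \<open>s\<close>
  is also related to \<open>x\<close> by \<open>t\<close> followed by the converse of
  \<open>s\<close>, through \<open>z\<close>; so the same witness serves on the right.\<close>

lemma rcomp_modular:
  assumes o: "a \<in> obj C" "b \<in> obj C" "c \<in> obj C"
    and r: "r \<in> pred (prd C a b)" and s: "s \<in> pred (prd C b c)" and t: "t \<in> pred (prd C a c)"
  shows "(meet (prd C a c) (rcomp a b c r s) t,
    rcomp a b c (meet (prd C a b) r (rcomp a c b t (dagger b c s))) s) \<in> ob P (prd C a c)"
proof (rule le_forcesI)
  have rs: "rcomp a b c r s \<in> pred (prd C a c)" using o r s by (intro rcomp_pred)
  have sd: "dagger b c s \<in> pred (prd C c b)" using o s by simp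
  have ts: "rcomp a c b t (dagger b c s) \<in> pred (prd C a b)" using o t sd by (intro rcomp_pred)
  have m: "meet (prd C a b) r (rcomp a c b t (dagger b c s)) \<in> pred (prd C a b)" using o r ts by simp
  show "meet (prd C a c) (rcomp a b c r s) t \<in> pred (prd C a c)" using o rs t by simp
  show "rcomp a b c (meet (prd C a b) r (rcomp a c b t (dagger b c s))) s \<in> pred (prd C a c)"
    using o m s by (intro rcomp_pred)
  fix w \<chi> x z assume "forces w \<chi> a c x z (meet (prd C a c) (rcomp a b c r s) t)"
  then have f: "forces w \<chi> a c x z (rcomp a b c r s)" and ft: "forces w \<chi> a c x z t"
    using forces_meet_iff[OF rs t] by auto
  obtain p \<chi>' k y where k: "cover p \<chi>' w \<chi> k" and 1: "forces p \<chi>' a b (cmp C p w a k x) y r"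
    and 2: "forces p \<chi>' b c y (cmp C p w c k z) s"
    by (rule forces_rcomp_elim[OF o r s f])
  have "forces p \<chi>' a b (cmp C p w a k x) y (rcomp a c b t (dagger b c s))"
    by (rule forces_rcomp_intro[OF o(1,3,2) t sd forces_cover[OF k ft]]) (use 2 o s forces_dagger_iff in auto)
  then have "forces p \<chi>' a b (cmp C p w a k x) y (meet (prd C a b) r (rcomp a c b t (dagger b c s)))"
    using 1 forces_meet_iff[OF r ts] by blast
  from forces_local[OF k forces_rcomp_intro[OF o m s this 2]]
  show "forces w \<chi> a c x z (rcomp a b c (meet (prd C a b) r (rcomp a c b t (dagger b c s))) s)"
    using forcesD[OF f] by blast
qed (use o in auto)

text \<open>\<open>f\<close> and \<open>g\<close> relate a point of \<open>r\<close> to its two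
  coordinates. A pair related by the span comes from such a point on a cover, and points with equal
  coordinates are equal by the universal property of the product.\<close>

lemma tabulation_span:
  assumes o: "a \<in> obj C" "b \<in> obj C" and r: "r \<in> pred (prd C a b)"
  defines "t \<equiv> prd C a b"
  defines "f \<equiv> graph_of t a (pr1 C a b) r" and "g \<equiv> graph_of t b (pr2 C a b) r"
  shows "rcomp a t b (dagger t a f) g = r"
    and "(meet (prd C t t) (rcomp t a t f (dagger t a f)) (rcomp t b t g (dagger t b g)), graph_of t t (idn C t) r) \<in> ob P (prd C t t)"
proof -
  have t: "t \<in> obj C" "r \<in> pred t" using o r unfolding t_def by auto
  have pr: "pr1 C a b \<in> hom C t a" "pr2 C a b \<in> hom C t b" unfolding t_def using o by auto
  have fg: "f \<in> pred (prd C t a)" "g \<in> pred (prd C t b)" using o t pr unfolding f_def g_def by auto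
  have d: "dagger t a f \<in> pred (prd C a t)" "dagger t b g \<in> pred (prd C b t)" using o t fg by auto
  show "rcomp a t b (dagger t a f) g = r"
  proof (rule eq_forcesI)
    show "rcomp a t b (dagger t a f) g \<in> pred (prd C a b)" by (rule rcomp_pred[OF o(1) t(1) o(2) d(1) fg(2)])
    fix w \<chi> x y
    show "forces w \<chi> a b x y (rcomp a t b (dagger t a f) g)" if "forces w \<chi> a b x y r"
    proof -
      have h: "holds w \<chi> t (tuple C w a b x y) r" and D: "w \<in> obj C" "x \<in> hom C w a" "y \<in> hom C w b"
        using that unfolding forces_iff_holds t_def holds_def by auto
      have e: "cmp C w t a (tuple C w a b x y) (pr1 C a b) = x" "cmp C w t b (tuple C w a b x y) (pr2 C a b) = y"
        unfolding t_def using D o by auto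
      have "forces w \<chi> t a (tuple C w a b x y) x f" "forces w \<chi> t b (tuple C w a b x y) y g"
        using forces_graph_intro[OF h o(1) pr(1)] forces_graph_intro[OF h o(2) pr(2)] unfolding e f_def g_def .
      then show ?thesis
        using forces_rcomp_intro[OF o(1) t(1) o(2) d(1) fg(2)] forces_dagger_iff[OF t(1) o(1) fg(1)] by blast
    qed
    assume F: "forces w \<chi> a b x y (rcomp a t b (dagger t a f) g)"
    obtain p \<chi>' k u where k: "cover p \<chi>' w \<chi> k" and 1: "forces p \<chi>' a t (cmp C p w a k x) u (dagger t a f)"
      and 2: "forces p \<chi>' t b u (cmp C p w b k y) g"
      by (rule forces_rcomp_elim[OF o(1) t(1) o(2) d(1) fg(2) F])
    have 1: "forces p \<chi>' t a u (cmp C p w a k x) f" using 1 forces_dagger_iff[OF t(1) o(1) fg(1)] by blast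
    obtain q \<chi>2 l where l: "cover q \<chi>2 p \<chi>' l" and h: "holds q \<chi>2 t (cmp C q p t l u) r"
      and e1: "cmp C q p a l (cmp C p w a k x) = cmp C q t a (cmp C q p t l u) (pr1 C a b)"
      by (rule forces_graph_elim[OF 1[unfolded f_def] pr(1) t(2)])
    obtain s \<chi>3 m where m: "cover s \<chi>3 q \<chi>2 m"
      and e2: "cmp C s q b m (cmp C q p b l (cmp C p w b k y)) = cmp C s t b (cmp C s q t m (cmp C q p t l u)) (pr2 C a b)"
      by (rule forces_graph_elim[OF forces_cover[OF l 2, unfolded g_def] pr(2) t(2)])
    note D = forcesD[OF F] coverD[OF k] coverD[OF l] coverD[OF m] forcesD[OF 1]
    let ?z = "cmp C s q t m (cmp C q p t l u)"
    have z: "?z \<in> hom C s t" using D by simp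
    have e1: "cmp C s q a m (cmp C q p a l (cmp C p w a k x)) = cmp C s t a ?z (pr1 C a b)"
      unfolding e1 using D pr by simp
    have "tuple C s a b (cmp C s q a m (cmp C q p a l (cmp C p w a k x))) (cmp C s q b m (cmp C q p b l (cmp C p w b k y))) = ?z"
      unfolding e1 e2 using tuple_expand[of s a b ?z] z D o unfolding t_def by simp
    then have "forces s \<chi>3 a b (cmp C s q a m (cmp C q p a l (cmp C p w a k x))) (cmp C s q b m (cmp C q p b l (cmp C p w b k y))) r"
      using holds_cover[OF m h] D o unfolding forces_iff_holds t_def by auto
    then show "forces w \<chi> a b x y r"
      by (intro forces_local[OF k] forces_local[OF l] forces_local[OF m]) (use D in auto)
  qed (use o r in auto)
  show "(meet (prd C t t) (rcomp t a t f (dagger t a f)) (rcomp t b t g (dagger t b g)), graph_of t t (idn C t) r) \<in> ob P (prd C t t)"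
  proof (rule le_forcesI)
    note ff = rcomp_pred[OF t(1) o(1) t(1) fg(1) d(1)] and gg = rcomp_pred[OF t(1) o(2) t(1) fg(2) d(2)]
    show "meet (prd C t t) (rcomp t a t f (dagger t a f)) (rcomp t b t g (dagger t b g)) \<in> pred (prd C t t)"
      using t ff gg by simp
    show "graph_of t t (idn C t) r \<in> pred (prd C t t)" using t by simp
    fix w \<chi> z z' assume "forces w \<chi> t t z z' (meet (prd C t t) (rcomp t a t f (dagger t a f)) (rcomp t b t g (dagger t b g)))"
    then have f1: "forces w \<chi> t t z z' (rcomp t a t f (dagger t a f))" and g1: "forces w \<chi> t t z z' (rcomp t b t g (dagger t b g))"
      using forces_meet_iff[OF ff gg] by auto
    \<comment> \<open>Sharing a value under one leg becomes, on a cover, an equation between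
      morphisms. The stage is kept arbitrary because the second leg is treated over the cover found
      for the first.\<close>
    have same: "\<exists>p \<chi>' k. cover p \<chi>' w \<chi> k \<and> holds p \<chi>' t (cmp C p w t k z) r \<and>
        cmp C p t c (cmp C p w t k z) h = cmp C p t c (cmp C p w t k z') h"
      if c: "c \<in> obj C" and h: "h \<in> hom C t c" and fo: "forces w \<chi> t t z z' (rcomp t c t (graph_of t c h r) (dagger t c (graph_of t c h r)))"
      for w \<chi> z z' c h
    proof -
      have e: "graph_of t c h r \<in> pred (prd C t c)" "dagger t c (graph_of t c h r) \<in> pred (prd C c t)"
        using t c h by auto
      obtain p \<chi>' k u where k: "cover p \<chi>' w \<chi> k" and 1: "forces p \<chi>' t c (cmp C p w t k z) u (graph_of t c h r)"
        and "forces p \<chi>' c t u (cmp C p w t k z') (dagger t c (graph_of t c h r))"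
        by (rule forces_rcomp_elim[OF t(1) c t(1) e fo])
      then have 2: "forces p \<chi>' t c (cmp C p w t k z') u (graph_of t c h r)"
        using forces_dagger_iff[OF t(1) c e(1)] by blast
      obtain q \<chi>2 l where l: "cover q \<chi>2 p \<chi>' l" and h1: "holds q \<chi>2 t (cmp C q p t l (cmp C p w t k z)) r"
        and e1: "cmp C q p c l u = cmp C q t c (cmp C q p t l (cmp C p w t k z)) h"
        by (rule forces_graph_elim[OF 1 h t(2)])
      obtain s \<chi>3 m where m: "cover s \<chi>3 q \<chi>2 m"
        and e2: "cmp C s q c m (cmp C q p c l u) = cmp C s t c (cmp C s q t m (cmp C q p t l (cmp C p w t k z'))) h"
        by (rule forces_graph_elim[OF forces_cover[OF l 2] h t(2)])
      note D = forcesD[OF fo] coverD[OF k] coverD[OF l] coverD[OF m] forcesD[OF 1]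
      \<comment> \<open>Three covers in succession: one for the intermediate element and one for
        each of the two graphs.\<close>
      let ?n = "cmp C s q w m (cmp C q p w l k)"
      have "cover s \<chi>3 w \<chi> ?n"
        using cover_cmp[OF cover_cmp[OF k l] m] D by simp
      moreover have "holds s \<chi>3 t (cmp C s w t ?n z) r"
        using holds_cover[OF m h1] D by simp
      moreover have "cmp C s t c (cmp C s w t ?n z) h = cmp C s t c (cmp C s w t ?n z') h"
      proof -
        have "cmp C s t c (cmp C s w t ?n z) h = cmp C s q c m (cmp C q t c (cmp C q p t l (cmp C p w t k z)) h)"
          using D h by simp
        also have "\<dots> = cmp C s t c (cmp C s w t ?n z') h"
          unfolding e1[symmetric] e2 using D h by simp
        finally show ?thesis .
      qed
      ultimately show ?thesis by blast
    qed
    obtain p \<chi>' k where k: "cover p \<chi>' w \<chi> k" 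
      and e1: "cmp C p t a (cmp C p w t k z) (pr1 C a b) = cmp C p t a (cmp C p w t k z') (pr1 C a b)"
      using same[OF o(1) pr(1) f1[unfolded f_def]] by blast
    obtain q \<chi>2 l where l: "cover q \<chi>2 p \<chi>' l" and h: "holds q \<chi>2 t (cmp C q p t l (cmp C p w t k z)) r"
      and e2: "cmp C q t b (cmp C q p t l (cmp C p w t k z)) (pr2 C a b) = cmp C q t b (cmp C q p t l (cmp C p w t k z')) (pr2 C a b)"
      using same[OF o(2) pr(2) forces_cover[OF k g1[unfolded g_def]]] by blast
    note D = forcesD[OF f1] coverD[OF k] coverD[OF l]
    have zz: "cmp C q p t l (cmp C p w t k z) = cmp C q p t l (cmp C p w t k z')" (is "?z = ?z'")
    proof (rule into_prd_eqI[of q a b])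
      show "?z \<in> hom C q (prd C a b)" "?z' \<in> hom C q (prd C a b)" using D unfolding t_def by auto
      have "cmp C q p a l (cmp C p t a (cmp C p w t k z) (pr1 C a b)) = cmp C q p a l (cmp C p t a (cmp C p w t k z') (pr1 C a b))"
        unfolding e1 ..
      then show "cmp C q (prd C a b) a ?z (pr1 C a b) = cmp C q (prd C a b) a ?z' (pr1 C a b)"
        using D o unfolding t_def by simp
      show "cmp C q (prd C a b) b ?z (pr2 C a b) = cmp C q (prd C a b) b ?z' (pr2 C a b)"
        using e2 unfolding t_def .
    qed (use D o in auto)
    have idf: "forces q \<chi>2 t t ?z ?z' (graph_of t t (idn C t) r)"
      using forces_idn_intro[OF h] zz by simp
    show "forces w \<chi> t t z z' (graph_of t t (idn C t) r)"
      by (rule forces_local[OF k forces_local[OF l idf]]) (use D in auto)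
  qed (use t in auto)
qed

text \<open>Any two elements of the terminal object are equal morphisms, so a relation on it is
  contained in equality.\<close>

lemma endo_one_le:
  assumes \<phi>: "\<phi> \<in> pred (one C)" and r: "r \<in> internal_rels (one C) \<phi> (one C) \<phi>"
  shows "(r, graph_of (one C) (one C) (idn C (one C)) \<phi>) \<in> ob P (prd C (one C) (one C))"
proof (rule le_forcesI)
  fix w \<chi> x y assume f: "forces w \<chi> (one C) (one C) x y r"
  then have "x = y" using into_one_unique forcesD by blast
  then show "forces w \<chi> (one C) (one C) x y (graph_of (one C) (one C) (idn C (one C)) \<phi>)"
    using forces_idn_intro[OF internal_rels_holds(1)[OF r f]] by simp
qed (use \<phi> internal_rels_pred[OF r] in auto)

end

section \<open>Internal relations form a tabular allegory\<close>

locale regular_calculus_locale =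
  fixes T :: "'t set" and P :: "('t, 'p) calculus"
  assumes calculus: "regular_calculus T P"
begin

sublocale doctrine "FRg T" P
  using regular_fp_category_FRg calculus unfolding regular_calculus_def by (rule doctrine.intro)

lemma push_im: "push T P = im" and pull_pb: "pull T P = pb"
  unfolding push_def pull_def im_def pb_def by (simp_all add: fun_eq_iff)

text \<open>The duplicating and deleting maps, built from products of maps, are rewritten as tuples
  of the three coordinates; strict associativity and unitality of contexts identify their targets
  with those in \<open>rcomp\<close>.\<close>

lemma intrel_comp_rcomp:
  assumes o: "a \<in> obj (FRg T)" "b \<in> obj (FRg T)" "c \<in> obj (FRg T)"
  shows "intrel_comp T P a b c = rcomp a b c"
proof (intro ext)
  fix \<theta> \<theta>'
  let ?F = "FRg T"
  let ?w = "prd ?F (prd ?F a b) c"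
  let ?f = "cmp ?F ?w (prd ?F a b) a (pr1 ?F (prd ?F a b) c) (pr1 ?F a b)"
  let ?g = "cmp ?F ?w (prd ?F a b) b (pr1 ?F (prd ?F a b) c) (pr2 ?F a b)"
  let ?h = "pr2 ?F (prd ?F a b) c"
  let ?G22 = "prd ?F b b"
  let ?G122 = "prd ?F a ?G22"
  let ?G10 = "prd ?F a (one ?F)"
  have w: "?w \<in> obj ?F" and fgh: "?f \<in> hom ?F ?w a" "?g \<in> hom ?F ?w b" "?h \<in> hom ?F ?w c"
    using o by auto
  have "times ?F (prd ?F a b) ?G122 c c (times ?F a a b ?G22 (idn ?F a) (diag ?F b)) (idn ?F c) =
      tuple ?F ?w ?G122 c (tuple ?F ?w a ?G22 ?f (tuple ?F ?w b b ?g ?g)) ?h"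
    unfolding times_def diag_def using o by (simp add: cmp_tuple)
  also have "\<dots> = tuple ?F ?w (prd ?F a b) (prd ?F b c) (tuple ?F ?w a b ?f ?g) (tuple ?F ?w b c ?g ?h)"
    by (rule FRg_tuple_assoc(2)[OF w o fgh])
  finally have dup: "times ?F (prd ?F a b) ?G122 c c (times ?F a a b ?G22 (idn ?F a) (diag ?F b)) (idn ?F c) = \<dots>" .
  have bw: "cmp ?F ?w b (one ?F) ?g (bang ?F b) = bang ?F ?w"
    using o w fgh by (intro into_one_unique[of ?w]) (auto simp del: cmp_assoc FRg_prd FRg_cmp)
  have "times ?F (prd ?F a b) ?G10 c c (times ?F a a b (one ?F) (idn ?F a) (bang ?F b)) (idn ?F c) =
      tuple ?F ?w ?G10 c (tuple ?F ?w a (one ?F) ?f (cmp ?F ?w b (one ?F) ?g (bang ?F b))) ?h"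
    unfolding times_def using o by (simp add: cmp_tuple del: FRg_prd FRg_cmp)
  also have "\<dots> = tuple ?F ?w a c ?f ?h"
    unfolding bw using FRg_tuple_one[OF w o(1) fgh(1)] by simp
  finally have del: "times ?F (prd ?F a b) ?G10 c c (times ?F a a b (one ?F) (idn ?F a) (bang ?F b)) (idn ?F c) = tuple ?F ?w a c ?f ?h" .
  show "intrel_comp T P a b c \<theta> \<theta>' = rcomp a b c \<theta> \<theta>'"
    unfolding intrel_comp_def Let_def rcomp_def push_im pull_pb dup del
    unfolding FRg_tuple_assoc(1)[OF w o fgh] FRg_tuple_one(1)[OF w o(1) fgh(1)] ..
qed

abbreviation "I \<equiv> IntRel T P"

lemma I_obj [simp]: "(a, \<phi>) \<in> obj I \<longleftrightarrow> a \<in> obj (FRg T) \<and> \<phi> \<in> pred a"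
  unfolding IntRel_def Let_def by simp

lemma I_hom [simp]:
  assumes "(a, \<phi>) \<in> obj I" "(b, \<psi>) \<in> obj I"
  shows "hom I (a, \<phi>) (b, \<psi>) = internal_rels a \<phi> b \<psi>"
proof -
  have "hom I (a, \<phi>) (b, \<psi>) = {\<theta> \<in> pred (prd (FRg T) a b).
      (im (prd (FRg T) a b) a (pr1 (FRg T) a b) \<theta>, \<phi>) \<in> ob P a \<and> (im (prd (FRg T) a b) b (pr2 (FRg T) a b) \<theta>, \<psi>) \<in> ob P b}"
    unfolding IntRel_def Let_def push_im by simp
  also have "\<dots> = internal_rels a \<phi> b \<psi>"
    unfolding internal_rels_def by (rule Collect_cong) (use assms le_pb_pr_iff[of a b _ \<phi> \<psi>] in \<open>simp only: I_obj cong: conj_cong\<close>)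
  finally show ?thesis .
qed

lemma I_cmp [simp]:
  "a \<in> obj (FRg T) \<Longrightarrow> b \<in> obj (FRg T) \<Longrightarrow> c \<in> obj (FRg T) \<Longrightarrow> cmp I (a, \<phi>) (b, \<psi>) (c, \<xi>) = rcomp a b c"
  unfolding IntRel_def Let_def by (simp add: intrel_comp_rcomp)

lemma I_idn [simp]: "idn I (a, \<phi>) = graph_of a a (idn (FRg T) a) \<phi>"
  unfolding IntRel_def Let_def by (simp add: push_im diag_graph)

lemma I_leq [simp]: "leq I (a, \<phi>) (b, \<psi>) \<theta> \<theta>' \<longleftrightarrow> (\<theta>, \<theta>') \<in> ob P (prd (FRg T) a b)"
  unfolding IntRel_def Let_def by simp

definition I_dag :: "'t ctx \<times> 'p \<Rightarrow> 't ctx \<times> 'p \<Rightarrow> 'p \<Rightarrow> 'p"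
  where "I_dag = (\<lambda>(a, _) (b, _). dagger a b)"

definition I_meet :: "'t ctx \<times> 'p \<Rightarrow> 't ctx \<times> 'p \<Rightarrow> 'p \<Rightarrow> 'p \<Rightarrow> 'p"
  where "I_meet = (\<lambda>(a, _) (b, _). meet (prd (FRg T) a b))"

lemma I_ops [simp]: "I_dag (a, \<phi>) (b, \<psi>) = dagger a b" "I_meet (a, \<phi>) (b, \<psi>) = meet (prd (FRg T) a b)"
  unfolding I_dag_def I_meet_def by simp_all

lemma meet_internal:
  assumes "a \<in> obj (FRg T)" "b \<in> obj (FRg T)" "r \<in> internal_rels a \<phi> b \<psi>" "s \<in> internal_rels a \<phi> b \<psi>"
  shows "meet (prd (FRg T) a b) r s \<in> internal_rels a \<phi> b \<psi>"
  using assms forces_meet_iff[of r a b s] unfolding internal_rels_def by auto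

lemma category_I: "category I"
proof
  show "idn I x \<in> hom I x x" if "x \<in> obj I" for x
    using that by (cases x) (auto intro: idn_internal)
  show "cmp I x y z f g \<in> hom I x z"
    if "x \<in> obj I" "y \<in> obj I" "z \<in> obj I" "f \<in> hom I x y" "g \<in> hom I y z" for x y z f g
    using that by (cases x; cases y; cases z) (auto intro: rcomp_internal)
  show "cmp I x x y (idn I x) f = f" "cmp I x y y f (idn I y) = f" if "x \<in> obj I" "y \<in> obj I" "f \<in> hom I x y" for x y f
    using that by (cases x; cases y; auto intro: rcomp_idn_left rcomp_idn_right)+
  show "cmp I w y z (cmp I w x y f g) h = cmp I w x z f (cmp I x y z g h)"
    if "w \<in> obj I" "x \<in> obj I" "y \<in> obj I" "z \<in> obj I" "f \<in> hom I w x" "g \<in> hom I x y" "h \<in> hom I y z" for w x y z f g h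
    using that by (cases w; cases x; cases y; cases z) (auto intro!: rcomp_assoc dest: internal_rels_pred)
qed

lemma I_tabulation:
  assumes "x \<in> obj I" "y \<in> obj I" "r \<in> hom I x y"
  shows "\<exists>t\<in>obj I. \<exists>f\<in>hom I t x. \<exists>g\<in>hom I t y.
    leq I t t (idn I t) (cmp I t x t f (I_dag t x f)) \<and> leq I x x (cmp I x t x (I_dag t x f) f) (idn I x) \<and>
    leq I t t (idn I t) (cmp I t y t g (I_dag t y g)) \<and> leq I y y (cmp I y t y (I_dag t y g) g) (idn I y) \<and>
    cmp I x t y (I_dag t x f) g = r \<and>
    leq I t t (I_meet t t (cmp I t x t f (I_dag t x f)) (cmp I t y t g (I_dag t y g))) (idn I t)"
proof -
  obtain a \<phi> b \<psi> where xy: "x = (a, \<phi>)" "y = (b, \<psi>)" by (cases x; cases y) auto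
  have o: "a \<in> obj (FRg T)" "b \<in> obj (FRg T)" "\<phi> \<in> pred a" "\<psi> \<in> pred b" and r: "r \<in> internal_rels a \<phi> b \<psi>"
    using assms unfolding xy by auto
  note rp = internal_rels_pred[OF r]
  let ?t = "prd (FRg T) a b"
  have t: "?t \<in> obj (FRg T)" and pr: "pr1 (FRg T) a b \<in> hom (FRg T) ?t a" "pr2 (FRg T) a b \<in> hom (FRg T) ?t b" using o by auto
  \<comment> \<open>Evaluating the hom condition at the generic pair shows that the points of
    \<open>r\<close> have coordinates in \<open>\<phi>\<close> and \<open>\<psi>\<close>, which
    types the two projections as arrows out of \<open>(?t, r)\<close>.\<close>
  have le: "(r, pb ?t a (pr1 (FRg T) a b) \<phi>) \<in> ob P ?t" "(r, pb ?t b (pr2 (FRg T) a b) \<psi>) \<in> ob P ?t"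
    using internal_rels_holds[OF r forces_generic[OF o(1,2) rp]] unfolding holds_def by auto
  note f = graph_of_internal[OF t o(1) pr(1) rp o(3) le(1)] and g = graph_of_internal[OF t o(2) pr(2) rp o(4) le(2)]
  note mf = map_relations[OF t o(1) pr(1) rp o(3) le(1)] and mg = map_relations[OF t o(2) pr(2) rp o(4) le(2)]
  show ?thesis
    unfolding xy
    by (intro bexI[of _ "(?t, r)"] bexI[of _ "graph_of ?t a (pr1 (FRg T) a b) r"] bexI[of _ "graph_of ?t b (pr2 (FRg T) a b) r"])
      (use o t rp f g mf(1,2) mg(1,2) tabulation_span[OF o(1,2) rp] in auto)
qed

text \<open>The predicate of the unit is the greatest one on the empty context. Hence every
  \<open>\<phi>\<close> lies below its substitute along the morphism to the empty context, and the
  graph of that morphism is a total relation into the unit.\<close>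

lemma tabular_allegory_I: "tabular_allegory I I_dag I_meet (one (FRg T), lax0 P ())"
proof -
  interpret I: category I by (rule category_I)
  show ?thesis
  proof
    fix x y assume "x \<in> obj I" "y \<in> obj I"
    then obtain a \<phi> b \<psi> where xy: "x = (a, \<phi>)" "y = (b, \<psi>)"
      and o: "a \<in> obj (FRg T)" "b \<in> obj (FRg T)" "\<phi> \<in> pred a" "\<psi> \<in> pred b"
      by (cases x; cases y) auto
    have h: "hom I x y = internal_rels a \<phi> b \<psi>" "hom I y x = internal_rels b \<psi> a \<phi>"
      unfolding xy using o by simp_all
    fix f assume "f \<in> hom I x y"
    then have f: "f \<in> internal_rels a \<phi> b \<psi>" unfolding h .
    show "leq I x y f f" using internal_rels_pred[OF f] o unfolding xy by simp
    show "I_dag x y f \<in> hom I y x" unfolding h unfolding xy using o f by (simp add: dagger_internal)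
    show "I_dag y x (I_dag x y f) = f" unfolding xy using o internal_rels_pred[OF f] by (simp add: dagger_dagger)
    fix g assume "g \<in> hom I x y"
    then have g: "g \<in> internal_rels a \<phi> b \<psi>" unfolding h .
    show "f = g" if "leq I x y f g" "leq I x y g f"
      using that o unfolding xy by (auto intro: le_antisym[of "prd (FRg T) a b"])
    show "leq I y x (I_dag x y f) (I_dag x y g)" if "leq I x y f g"
      using that o unfolding xy by (simp add: dagger_mono)
    show "I_meet x y f g \<in> hom I x y" unfolding h unfolding xy using meet_internal[OF o(1,2) f g] by simp
    fix k assume "k \<in> hom I x y"
    then have k: "k \<in> internal_rels a \<phi> b \<psi>" unfolding h .
    show "leq I x y f k" if "leq I x y f g" "leq I x y g k"
      using that o le_trans[of "prd (FRg T) a b"] unfolding xy by auto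
    show "leq I x y k (I_meet x y f g) \<longleftrightarrow> leq I x y k f \<and> leq I x y k g"
      using o internal_rels_pred[OF f] internal_rels_pred[OF g] internal_rels_pred[OF k] unfolding xy by (simp add: le_meet_iff)
  next
    fix x y z f f' g g'
    assume "x \<in> obj I" "y \<in> obj I" "z \<in> obj I" "leq I x y f f'" "leq I y z g g'"
    then show "leq I x z (cmp I x y z f g) (cmp I x y z f' g')"
      by (cases x; cases y; cases z) (auto intro: rcomp_mono)
  next
    fix x y z f g
    assume "x \<in> obj I" "y \<in> obj I" "z \<in> obj I" "f \<in> hom I x y" "g \<in> hom I y z"
    then show "I_dag x z (cmp I x y z f g) = cmp I z y x (I_dag y z g) (I_dag x y f)"
      by (cases x; cases y; cases z) (auto intro!: dagger_rcomp dest: internal_rels_pred)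
  next
    fix x assume "x \<in> obj I"
    then show "I_dag x x (idn I x) = idn I x"
      by (cases x) (auto intro: dagger_idn)
  next
    fix x y z f g h
    assume "x \<in> obj I" "y \<in> obj I" "z \<in> obj I" "f \<in> hom I x y" "g \<in> hom I y z" "h \<in> hom I x z"
    then show "leq I x z (I_meet x z (cmp I x y z f g) h) (cmp I x y z (I_meet x y f (cmp I x z y h (I_dag y z g))) g)"
      by (cases x; cases y; cases z) (auto intro!: rcomp_modular dest: internal_rels_pred)
  next
    show "(one (FRg T), lax0 P ()) \<in> obj I" by (simp add: lax0_pred del: FRg_prd)
  next
    fix f assume "f \<in> hom I (one (FRg T), lax0 P ()) (one (FRg T), lax0 P ())"
    then show "leq I (one (FRg T), lax0 P ()) (one (FRg T), lax0 P ()) f (idn I (one (FRg T), lax0 P ()))"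
      using endo_one_le[OF lax0_pred] by (simp add: lax0_pred del: FRg_prd)
  next
    fix x assume "x \<in> obj I"
    then obtain a \<phi> where x: "x = (a, \<phi>)" and o: "a \<in> obj (FRg T)" "\<phi> \<in> pred a" by (cases x) auto
    note b = o(1) one_obj bang_hom[OF o(1)] o(2) lax0_pred pb_bang_top[OF o]
    show "\<exists>f\<in>hom I x (one (FRg T), lax0 P ()). leq I x x (idn I x)
        (cmp I x (one (FRg T), lax0 P ()) x f (I_dag x (one (FRg T), lax0 P ()) f))"
      unfolding x using graph_of_internal[OF b] map_relations(1)[OF b] o lax0_pred
      by (intro bexI[of _ "graph_of a (one (FRg T)) (bang (FRg T) a) \<phi>"]) (auto simp del: FRg_prd)
  qed (rule I_tabulation)
qed

end

theorem theorem7p3: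
  fixes T :: "'t set" and P :: "('t, 'p) calculus"
  assumes "regular_calculus T P"
  shows "regular_category (LAdj (IntRel T P))"
proof -
  interpret regular_calculus_locale T P by unfold_locales (rule assms)
  show ?thesis
    using tabular_allegory.regular_category_LAdj[OF tabular_allegory_I] .
qed

end
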